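(* Let $n,m$ be positive integers with $m\le\lfloor n/2\rfloor$, let $\boldsymbol{x}=\{x_1,\dots,x_n\}$ be distinct real points, and let $\boldsymbol{\xi}=\{\xi_1,\dots,\xi_m\}\subset\mathbb{C}\setminus\boldsymbol{x}$ be distinct points, closed under complex conjugation. Then the following are equivalent (so that the classifications of the three kinds of objects coincide): (i) $\boldsymbol{x}$ (as growth points) and $\boldsymbol{\xi}$ (as screening charges) define a multiple chordal $\mathrm{SLE}(0)$ system, i.e. they solve the stationary relations $$-\sum_{j=1}^{n}\frac{1}{\xi_k-x_j}+\sum_{l\neq k}\frac{2}{\xi_k-\xi_l}=0,\qquad k=1,\dots,m .$$ (ii) There is a rational function $R\in\mathcal{CR}_{m,n}(\boldsymbol{x})$ with $\boldsymbol{\xi}$ as finite poles and $\boldsymbol{x}$ as finite critical points, whose real locus forms an $(n,m)$ chordal link pattern. (iii) $\boldsymbol{\xi}$ is a critical point, with respect to the variables $\xi_1,\dots,\xi_m$ (with $\boldsymbol{x}$ fixed), of the master function $$\Phi(\boldsymbol{x},\boldsymbol{\xi})=\prod_{1\le i<j\le n}(x_i-x_j)^{2}\prod_{1\le i<j\le m}(\xi_i-\xi_j)^{8}\prod_{i=1}^{n}\prod_{j=1}^{m}(x_i-\xi_j)^{-4}.$$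
   Context: $\mathcal{CR}_{m,n}(\boldsymbol{x})$: the class of rational functions $R(z)$ such that (a) $\overline{R(\bar z)}=R(z)$; (b) the finite critical points of $R$ are exactly $x_1,\dots,x_n$ and are simple; (c) the finite poles of $R$ are $m$ distinct simple poles; (d) $R$ has a pole of order $n-2m+1$ at $\infty$. Real locus of $R$: $\Gamma(R)=\{z\in\widehat{\mathbb{C}}:R(z)\in\mathbb{R}\cup\{\infty\}\}$. It forms an $(n,m)$ chordal link pattern if $\Gamma(R)\cap\mathbb{H}$ consists of pairwise disjoint simple curves such that $m$ of them connect disjoint pairs of points among $x_1,\dots,x_n$ and each of the remaining $n-2m$ points $x_j$ is connected by one of the curves to the marked boundary point $\infty$. *)

theory Defs
  imports "HOL-Complex_Analysis.Complex_Analysis" "HOL-Library.Disjoint_Sets"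
    "HOL-Computational_Algebra.Polynomial"
begin

text \<open>
  Points are indexed by \<open>{1..n}\<close> and \<open>{1..m}\<close>; values of \<open>x\<close> and \<open>\<xi>\<close> outside these ranges
  are irrelevant. Real points \<open>x j\<close> are coerced into the complex plane.
\<close>

definition stationary_relations ::
    "nat \<Rightarrow> nat \<Rightarrow> (nat \<Rightarrow> real) \<Rightarrow> (nat \<Rightarrow> complex) \<Rightarrow> bool" where
  "stationary_relations n m x \<xi> \<longleftrightarrow>
     (\<forall>k\<in>{1..m}. - (\<Sum>j\<in>{1..n}. 1 / (\<xi> k - of_real (x j)))
                 + (\<Sum>l\<in>{1..m} - {k}. 2 / (\<xi> k - \<xi> l)) = 0)"

definition master_function ::
    "nat \<Rightarrow> nat \<Rightarrow> (nat \<Rightarrow> real) \<Rightarrow> (nat \<Rightarrow> complex) \<Rightarrow> complex" where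
  "master_function n m x \<xi> =
     (\<Prod>i\<in>{1..n}. \<Prod>j\<in>{i<..n}. (of_real (x i) - of_real (x j)) ^ 2) *
     (\<Prod>i\<in>{1..m}. \<Prod>j\<in>{i<..m}. (\<xi> i - \<xi> j) ^ 8) *
     (\<Prod>i\<in>{1..n}. \<Prod>j\<in>{1..m}. (of_real (x i) - \<xi> j) powi (-4))"

text \<open>All partial derivatives with respect to the complex variables \<open>\<xi> 1, \<dots>, \<xi> m\<close> vanish.\<close>

definition master_critical_point ::
    "nat \<Rightarrow> nat \<Rightarrow> (nat \<Rightarrow> real) \<Rightarrow> (nat \<Rightarrow> complex) \<Rightarrow> bool" where
  "master_critical_point n m x \<xi> \<longleftrightarrow>
     (\<forall>k\<in>{1..m}.
        ((\<lambda>w. master_function n m x (\<xi>(k := w))) has_field_derivative 0) (at (\<xi> k)))"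

text \<open>
  A rational function is the quotient of two coprime polynomials. Since \<open>u / 0 = 0\<close>, the HOL
  function has the junk value \<open>0\<close> at its poles, so poles are always treated separately below.
\<close>

definition rational_function :: "(complex \<Rightarrow> complex) \<Rightarrow> bool" where
  "rational_function R \<longleftrightarrow>
     (\<exists>p q. q \<noteq> 0 \<and> coprime p q \<and> (\<forall>z. R z = poly p z / poly q z))"

text \<open>
  Finite critical points are those of \<open>R\<close> as a map into the Riemann sphere; at a pole this
  concerns \<open>1 / R\<close>, so a pole is critical iff it is multiple, and simply critical iff it is double.
\<close>

definition finite_critical_point :: "(complex \<Rightarrow> complex) \<Rightarrow> complex \<Rightarrow> bool" where
  "finite_critical_point R z \<longleftrightarrow>
     (if is_pole R z then zorder R z \<le> -2 else deriv R z = 0)"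

definition simple_critical_point :: "(complex \<Rightarrow> complex) \<Rightarrow> complex \<Rightarrow> bool" where
  "simple_critical_point R z \<longleftrightarrow>
     (if is_pole R z then zorder R z = -2 else deriv R z = 0 \<and> deriv (deriv R) z \<noteq> 0)"

text \<open>The pole at \<open>\<infinity>\<close> of \<open>R\<close> is the pole at \<open>0\<close> of \<open>z \<mapsto> R (1 / z)\<close>.\<close>

definition CR :: "nat \<Rightarrow> nat \<Rightarrow> (nat \<Rightarrow> real) \<Rightarrow> (complex \<Rightarrow> complex) set" where
  "CR m n x = {R. rational_function R
     \<and> (\<forall>z. cnj (R (cnj z)) = R z)
     \<and> {z. finite_critical_point R z} = (\<lambda>j. of_real (x j)) ` {1..n}
     \<and> (\<forall>j\<in>{1..n}. simple_critical_point R (of_real (x j)))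
     \<and> finite {z. is_pole R z} \<and> card {z. is_pole R z} = m
     \<and> (\<forall>z. is_pole R z \<longrightarrow> zorder R z = -1)
     \<and> is_pole (\<lambda>z. R (1 / z)) 0
     \<and> zorder (\<lambda>z. R (1 / z)) 0 = - (int n - 2 * int m + 1)}"

text \<open>
  Only the finite part of the real locus is recorded, as it is only ever intersected with the
  upper half-plane.
\<close>

definition real_locus :: "(complex \<Rightarrow> complex) \<Rightarrow> complex set" where
  "real_locus R = {z. is_pole R z \<or> R z \<in> \<real>}"

text \<open>
  \<open>C\<close> is a simple curve in the open upper half-plane (without its end points) joining two
  boundary points. The end points are given by the filters of their neighbourhoods in the
  Riemann sphere: \<open>nhds a\<close> for a finite point and \<open>at_infinity\<close> for \<open>\<infinity>\<close>.
\<close>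

definition simple_curve_in_H :: "complex filter \<Rightarrow> complex filter \<Rightarrow> complex set \<Rightarrow> bool" where
  "simple_curve_in_H A B C \<longleftrightarrow>
     C \<subseteq> {z. Im z > 0} \<and>
     (\<exists>\<gamma>::real \<Rightarrow> complex. continuous_on {0<..<1} \<gamma> \<and> inj_on \<gamma> {0<..<1} \<and> C = \<gamma> ` {0<..<1}
        \<and> filterlim \<gamma> A (at_right 0) \<and> filterlim \<gamma> B (at_left 1))"

text \<open>
  \<open>P\<close> is the set of linked pairs of indices. The curves \<open>C\<close> are indexed by these pairs and by
  the singletons \<open>{j}\<close> of the unpaired indices, whose points are linked to \<open>\<infinity>\<close>.
\<close>

definition chordal_link_pattern :: "nat \<Rightarrow> nat \<Rightarrow> (nat \<Rightarrow> real) \<Rightarrow> (complex \<Rightarrow> complex) \<Rightarrow> bool" where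
  "chordal_link_pattern n m x R \<longleftrightarrow>
     (\<exists>(P::nat set set) (C::nat set \<Rightarrow> complex set).
        (let S = {{j} |j. j \<in> {1..n} - \<Union>P} in
        (\<forall>p\<in>P. p \<subseteq> {1..n} \<and> card p = 2) \<and> disjoint P \<and> card P = m
        \<and> (\<forall>i j. {i, j} \<in> P \<longrightarrow>
              simple_curve_in_H (nhds (of_real (x i))) (nhds (of_real (x j))) (C {i, j}))
        \<and> (\<forall>j\<in>{1..n} - \<Union>P. simple_curve_in_H (nhds (of_real (x j))) at_infinity (C {j}))
        \<and> disjoint_family_on C (P \<union> S)
        \<and> real_locus R \<inter> {z. Im z > 0} = (\<Union>b\<in>P \<union> S. C b)))"

end

theory Submission
  imports Defs "HOL-Computational_Algebra.Fundamental_Theorem_Algebra"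
begin

text \<open>
  Put \<open>N = p' q - p q'\<close> for \<open>R = p / q\<close>, so that \<open>R' = N / q\<^sup>2\<close>. If \<open>N\<close> is a multiple of
  \<open>\<Prod>j. (z - x j)\<close> and \<open>q\<close> one of \<open>\<Prod>k. (z - \<xi> k)\<close>, then \<open>N = - p q'\<close> and \<open>N' = - p q''\<close> at \<open>\<xi> k\<close>, and
  comparing \<open>N' / N\<close> with \<open>q'' / q'\<close> gives the stationary relations. Conversely these relations say
  that \<open>N / q\<^sup>2\<close> has no residues, hence a rational antiderivative \<open>R\<close>.

  It remains to see that the real locus of such an \<open>R\<close> is always a link pattern. All critical values
  of \<open>R\<close> are real or infinite, so \<open>W = (R - \<i>) / (R + \<i>)\<close> is a covering over the unit disc and has
  inverse branches \<open>g\<close> there. A branch in the upper half-plane has boundary values on the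
  circle, and every component of the real locus in the half-plane consists of the boundary
  values of some \<open>g\<close> along an open arc, on which \<open>W \<circ> g = id\<close> yields injectivity. The arc omits
  two points of the circle: otherwise \<open>g\<close> could be glued to a branch over the complementary disc to
  give a nonconstant entire function into the half-plane. Hence each component is a curve whose two
  ends are distinct, as \<open>W\<close> takes distinct values there. Near a boundary point at which \<open>R\<close>
  has local degree \<open>k\<close> the locus consists of \<open>k - 1\<close> rays; so exactly one curve ends at each \<open>x j\<close>,
  \<open>n - 2 * m\<close> curves end at \<open>\<infinity>\<close>, and none elsewhere.
\<close>

subsection \<open>Inverse branches over the disc\<close>

text \<open>The poles of \<open>R\<close> may lie on the curves themselves. \<open>W\<close> sends
  the real line together with \<open>\<infinity>\<close> to one compact circle, so poles look like
  ordinary points there, and \<open>z = \<infinity>\<close> receives the value \<open>1\<close>. The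
  obstacle is global. Counting rays at the ends excludes neither a closed loop, which has no ends,
  nor a curve with both ends at \<open>\<infinity>\<close>. Either would be an arc of boundary
  values that omits at most one point of the circle, and this is what the gluing argument forbids.
  The number of curves at \<open>\<infinity>\<close> comes from degrees: the leading coefficient of
  the Wronskian forces the numerator to have degree \<open>n + 1 - m\<close>, so \<open>R\<close>
  has local degree \<open>n - 2 * m + 1\<close> at \<open>\<infinity>\<close>, which gives
  \<open>n - 2 * m\<close> rays in the half-plane. The pairing is then a count: each
  \<open>x j\<close> lies on exactly one curve, \<open>n - 2 * m\<close> of these curves run to
  \<open>\<infinity>\<close>, and the remaining \<open>2 * m\<close> points must be joined in
  pairs.\<close>

definition wronskian :: "complex poly \<Rightarrow> complex poly \<Rightarrow> complex poly" where
  "wronskian p q = pderiv p * q - p * pderiv q"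

lemma poly_card_roots_simple:
  fixes P :: "complex poly"
  assumes "P \<noteq> 0" and simple: "\<And>z. poly P z = 0 \<Longrightarrow> poly (pderiv P) z \<noteq> 0"
  shows "card {z. poly P z = 0} = degree P"
proof -
  have "rsquarefree P" using simple by (auto simp: rsquarefree_roots)
  then have eq: "smult (lead_coeff P) (\<Prod>z|poly P z = 0. [:-z, 1:]) = P"
    by (rule complex_poly_decompose_rsquarefree)
  have "degree P = degree (\<Prod>z|poly P z = 0. [:-z, 1:])"
    using assms(1) by (subst eq[symmetric]) simp
  also have "\<dots> = (\<Sum>z|poly P z = 0. degree [:-z, 1:])"
    by (rule degree_prod_eq_sum_degree) auto
  finally show ?thesis by simp
qed

text \<open>Detaching the analysis from \<open>x\<close> and \<open>\<xi>\<close> allows it to be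
  applied to the pair \<open>(- p, q)\<close> as well, which describes the complementary
  disc.\<close>

locale real_pair =
  fixes p q :: "complex poly"
  assumes real_p: "poly p (cnj z) = cnj (poly p z)"
    and real_q: "poly q (cnj z) = cnj (poly q z)"
    and no_common_root: "poly p z = 0 \<Longrightarrow> poly q z \<noteq> 0"
    and degree_less: "degree q < degree p"
    and noncritical: "Im z \<noteq> 0 \<Longrightarrow> poly (wronskian p q) z \<noteq> 0"
begin

text \<open>\<open>A / B\<close> is the Cayley transform \<open>(R - \<i>) / (R + \<i>)\<close> of \<open>R = p / q\<close>: it sends the real locus
  of \<open>R\<close>, poles included, to the unit circle.\<close>

definition A :: "complex \<Rightarrow> complex" where "A z = poly p z - \<i> * poly q z"
definition B :: "complex \<Rightarrow> complex" where "B z = poly p z + \<i> * poly q z"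
text \<open>This is \<open>Im R\<close> multiplied by the squared norm of \<open>q\<close>: it has
  the sign of \<open>Im R\<close> and also makes sense at the poles.\<close>

definition F :: "complex \<Rightarrow> real" where "F z = Im (poly p z * cnj (poly q z))"

lemma holomorphic_AB [holomorphic_intros]: "A holomorphic_on S" "B holomorphic_on S"
  unfolding A_def[abs_def] B_def[abs_def] by (auto intro!: holomorphic_intros)

lemma continuous_on_AB [continuous_intros]: "continuous_on S A" "continuous_on S B"
  by (auto intro!: holomorphic_on_imp_continuous_on holomorphic_intros)

lemma continuous_on_F: "continuous_on S F"
  unfolding F_def[abs_def] by (intro continuous_intros)

lemma F_eq: "4 * F z = (norm (B z))\<^sup>2 - (norm (A z))\<^sup>2"
  unfolding A_def B_def F_def cmod_power2 by (simp add: algebra_simps power2_eq_square)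

lemma F_pos_iff: "F z > 0 \<longleftrightarrow> norm (A z) < norm (B z)"
proof -
  have "F z > 0 \<longleftrightarrow> (norm (A z))\<^sup>2 < (norm (B z))\<^sup>2" using F_eq[of z] by linarith
  then show ?thesis by (smt (verit) norm_ge_zero power2_less_imp_less power_strict_mono pos2)
qed

lemma F_eq_0_iff: "F z = 0 \<longleftrightarrow> norm (A z) = norm (B z)"
proof -
  have "F z = 0 \<longleftrightarrow> (norm (A z))\<^sup>2 = (norm (B z))\<^sup>2" using F_eq[of z] by linarith
  then show ?thesis by simp
qed

lemma F_real: "Im z = 0 \<Longrightarrow> F z = 0"
proof -
  assume "Im z = 0"
  then have "cnj z = z" by (simp add: complex_eq_iff)
  then have "poly p z \<in> \<real>" "poly q z \<in> \<real>" using real_p[of z] real_q[of z] by (auto simp: Reals_cnj_iff)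
  then show ?thesis by (simp add: F_def complex_is_Real_iff)
qed

lemma A_B_not_both_0: "A z = 0 \<Longrightarrow> B z \<noteq> 0"
  using no_common_root[of z] by (auto simp: A_def B_def)

lemma B_nz: "A z = u * B z \<Longrightarrow> B z \<noteq> 0"
  using A_B_not_both_0[of z] by auto

text \<open>The Wronskian is bilinear and alternating, and \<open>(A, B)\<close> arises from
  \<open>(p, q)\<close> by a matrix of determinant \<open>2 * \<i>\<close>.\<close>

lemma deriv_AB:
  "deriv A z * B z - A z * deriv B z = 2 * \<i> * poly (wronskian p q) z"
proof -
  have "(A has_field_derivative (poly (pderiv p) z - \<i> * poly (pderiv q) z)) (at z)"
    "(B has_field_derivative (poly (pderiv p) z + \<i> * poly (pderiv q) z)) (at z)"
    unfolding A_def[abs_def] B_def[abs_def] by (auto intro!: derivative_eq_intros)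
  then have "deriv A z = poly (pderiv p) z - \<i> * poly (pderiv q) z"
     "deriv B z = poly (pderiv p) z + \<i> * poly (pderiv q) z"
    by (auto intro: DERIV_imp_deriv)
  then show ?thesis by (simp only: A_def B_def) (simp add: wronskian_def algebra_simps)
qed

lemma deriv_quotient_nz:
  assumes "Im z \<noteq> 0" "B z \<noteq> 0"
  shows "deriv (\<lambda>z. A z / B z) z \<noteq> 0"
proof -
  have "A field_differentiable at z" "B field_differentiable at z"
    using holomorphic_AB[of UNIV] by (auto simp: holomorphic_on_def)
  then have "deriv (\<lambda>z. A z / B z) z = (deriv A z * B z - A z * deriv B z) / (B z)^2"
    using assms by (intro deriv_divide) auto
  then show ?thesis using noncritical[OF assms(1)] assms(2) deriv_AB[of z] by simp
qed

text \<open>The inverse function theorem for \<open>W\<close> at a nonreal point. The ball of radius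
  \<open>e\<close> is where \<open>\<psi>\<close> solves the equation; the ball of radius
  \<open>\<delta>\<close> is where every solution is given by \<open>\<psi>\<close>, and this
  uniqueness later identifies branches with one another.\<close>

lemma local_inverse:
  assumes "Im z0 \<noteq> 0" "B z0 \<noteq> 0" "open S" "z0 \<in> S"
  obtains e \<delta> \<psi> where "e > 0" "\<delta> > 0" "\<psi> holomorphic_on ball (A z0 / B z0) e"
    "\<psi> (A z0 / B z0) = z0"
    "\<And>u. u \<in> ball (A z0 / B z0) e \<Longrightarrow> \<psi> u \<in> S \<and> A (\<psi> u) = u * B (\<psi> u) \<and> B (\<psi> u) \<noteq> 0"
    "\<And>z. z \<in> ball z0 \<delta> \<Longrightarrow> B z \<noteq> 0 \<and> A z / B z \<in> ball (A z0 / B z0) e \<and> \<psi> (A z / B z) = z"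
proof -
  define S' where "S' = S \<inter> {z. B z \<noteq> 0}"
  have "open {z. B z \<noteq> 0}"
    using continuous_on_AB(2)[of UNIV] by (intro open_Collect_neq) auto
  then have S': "open S'" "z0 \<in> S'" using assms by (auto simp: S'_def)
  have hol: "(\<lambda>z. A z / B z) holomorphic_on S'"
    by (auto simp: S'_def intro!: holomorphic_intros)
  obtain r' where r': "r' > 0" "ball z0 r' \<subseteq> S'" "inj_on (\<lambda>z. A z / B z) (ball z0 r')"
    using has_complex_derivative_locally_injective[OF hol S'(2,1) deriv_quotient_nz[OF assms(1,2)]]
    by metis
  let ?V = "ball z0 r'" and ?W = "\<lambda>z. A z / B z"
  have hol': "?W holomorphic_on ?V" using hol r'(2) holomorphic_on_subset by blast
  obtain \<psi> where \<psi>: "\<psi> holomorphic_on ?W ` ?V" "\<And>z. z \<in> ?V \<Longrightarrow> \<psi> (?W z) = z"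
    using holomorphic_has_inverse[OF hol' open_ball r'(3)] by metis
  have op: "open (?W ` ?V)"
    using open_mapping_thm3[OF hol' open_ball r'(3)] .
  then obtain e where e: "e > 0" "ball (?W z0) e \<subseteq> ?W ` ?V"
    using r'(1) by (elim openE[of _ "?W z0"]) auto
  have "continuous_on ?V ?W" using hol' holomorphic_on_imp_continuous_on by blast
  then have "open (?V \<inter> ?W -` ball (?W z0) e)"
    by (intro continuous_open_preimage) auto
  moreover have "z0 \<in> ?V \<inter> ?W -` ball (?W z0) e" using e(1) r'(1) by simp
  ultimately obtain \<delta> where \<delta>: "\<delta> > 0" "ball z0 \<delta> \<subseteq> ?V \<inter> ?W -` ball (?W z0) e"
    by (rule openE)
  show ?thesis
  proof (rule that[OF e(1) \<delta>(1)])
    show "\<psi> holomorphic_on ball (?W z0) e" using \<psi>(1) e(2) holomorphic_on_subset by blast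
    show "\<psi> (?W z0) = z0" using \<psi>(2) r'(1) by simp
    fix u assume "u \<in> ball (?W z0) e"
    then obtain z where "z \<in> ?V" "u = ?W z" using e(2) by auto
    then show "\<psi> u \<in> S \<and> A (\<psi> u) = u * B (\<psi> u) \<and> B (\<psi> u) \<noteq> 0"
      using \<psi>(2) r'(2) by (auto simp: S'_def)
  next
    fix z assume "z \<in> ball z0 \<delta>"
    then show "B z \<noteq> 0 \<and> ?W z \<in> ball (?W z0) e \<and> \<psi> (?W z) = z"
      using \<delta>(2) r'(2) \<psi>(2) by (auto simp: S'_def)
  qed
qed

text \<open>The fibre over \<open>w\<close> is the root set of
  \<open>(1 - w) * p - \<i> * (1 + w) * q\<close>, of full degree because
  \<open>w \<noteq> 1\<close>. Double roots would be critical points of \<open>R\<close>, hence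
  real, but the real axis is mapped to the circle and not into the disc.\<close>

lemma card_fibre:
  assumes "norm w < 1"
  shows "card {z. A z = w * B z} = degree p"
    and "finite {z. A z = w * B z}"
proof -
  define P where "P = smult (1 - w) p - smult (\<i> * (1 + w)) q"
  have w: "w \<noteq> 1" using assms by auto
  have deg: "degree P = degree p"
  proof -
    have "degree (- smult (\<i> * (1 + w)) q) < degree (smult (1 - w) p)"
      using w le_less_trans[OF degree_smult_le degree_less] by simp
    then have "degree (smult (1 - w) p + - smult (\<i> * (1 + w)) q) = degree (smult (1 - w) p)"
      by (rule degree_add_eq_left)
    then show ?thesis using w by (simp add: P_def)
  qed
  then have "P \<noteq> 0" using degree_less by auto
  have roots: "{z. A z = w * B z} = {z. poly P z = 0}"
    by (auto simp: P_def A_def B_def algebra_simps)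
  have nonreal: "Im z \<noteq> 0" if "poly P z = 0" for z
  proof
    assume "Im z = 0"
    then have "norm (A z) = norm (B z)" using F_real F_eq_0_iff by auto
    moreover have "A z = w * B z" "B z \<noteq> 0" using that roots B_nz[of z w] by auto
    ultimately show False using assms by (auto simp: norm_mult)
  qed
  have "card {z. poly P z = 0} = degree P"
  proof (rule poly_card_roots_simple[OF \<open>P \<noteq> 0\<close>])
    fix z assume z: "poly P z = 0"
    have "poly q z * poly (pderiv P) z - poly (pderiv q) z * poly P z
        = (1 - w) * poly (wronskian p q) z"
      by (simp add: P_def wronskian_def pderiv_diff pderiv_smult algebra_simps)
    then show "poly (pderiv P) z \<noteq> 0" using z noncritical[OF nonreal[OF z]] w by auto
  qed
  then show "card {z. A z = w * B z} = degree p" using roots deg by simp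
  show "finite {z. A z = w * B z}" using roots poly_roots_finite[OF \<open>P \<noteq> 0\<close>] by simp
qed

lemma covering: "covering_space {z. F z > 0} (\<lambda>z. A z / B z) (ball 0 1)"
proof
  let ?X = "{z. F z > 0}" and ?W = "\<lambda>z. A z / B z"
  have BX: "B z \<noteq> 0" if "z \<in> ?X" for z using that by (auto simp: F_pos_iff)
  show contW: "continuous_on ?X ?W"
    using BX by (intro continuous_intros) auto
  have iX: "?W z \<in> ball 0 1" if "z \<in> ?X" for z
    using that BX[OF that] by (auto simp: F_pos_iff norm_divide)
  have fX: "z \<in> ?X \<and> ?W z = w" if "A z = w * B z" "norm w < 1" for z w
    using that B_nz[of z w] by (auto simp: F_pos_iff norm_mult)
  have openX: "open ?X"
    using continuous_on_F[of UNIV] by (intro open_Collect_less) auto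
  have nr: "Im z \<noteq> 0" if "z \<in> ?X" for z using that F_real[of z] by auto
  have d0: "degree p > 0" using degree_less by auto
  show "?W ` ?X = ball 0 1"
  proof
    show "?W ` ?X \<subseteq> ball 0 1" using iX by blast
    show "ball 0 1 \<subseteq> ?W ` ?X"
    proof
      fix w :: complex assume w: "w \<in> ball 0 1"
      then have "card {z. A z = w * B z} > 0" using card_fibre[of w] d0 by simp
      then have "{z. A z = w * B z} \<noteq> {}" by force
      then show "w \<in> ?W ` ?X" using fX w by force
    qed
  qed
  fix w0 :: complex assume w0: "w0 \<in> ball 0 1"
  define Z where "Z = {z. A z = w0 * B z}"
  have Z: "finite Z" "card Z = degree p" using card_fibre[of w0] w0 by (auto simp: Z_def)
  have ZX: "z \<in> ?X" "?W z = w0" if "z \<in> Z" for z using that fX w0 by (auto simp: Z_def)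
  obtain d where d: "d > 0" "\<And>z z'. z \<in> Z \<Longrightarrow> z' \<in> Z \<Longrightarrow> z \<noteq> z' \<Longrightarrow> dist z z' \<ge> d"
  proof -
    have "\<exists>d>0. \<forall>z'\<in>Z. z' \<noteq> z \<longrightarrow> d \<le> dist z z'" for z
      by (rule finite_set_avoid[OF Z(1)])
    then obtain D where D: "\<And>z. D z > 0 \<and> (\<forall>z'\<in>Z. z' \<noteq> z \<longrightarrow> D z \<le> dist z z')"
      by metis
    have "finite (insert 1 (D ` Z))" using Z by simp
    then have "Min (insert 1 (D ` Z)) > 0" using D by (subst Min_gr_iff) auto
    moreover have "dist z z' \<ge> Min (insert 1 (D ` Z))" if "z \<in> Z" "z' \<in> Z" "z \<noteq> z'" for z z'
    proof -
      have "Min (insert 1 (D ` Z)) \<le> D z" using that Z by (intro Min_le) auto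
      also have "\<dots> \<le> dist z z'" using D that by auto
      finally show ?thesis .
    qed
    ultimately show ?thesis using that by blast
  qed
  have "\<forall>z0\<in>Z. \<exists>e \<psi>. e > 0 \<and> continuous_on (ball w0 e) \<psi> \<and>
      (\<forall>u\<in>ball w0 e. \<psi> u \<in> ?X \<inter> ball z0 (d/2) \<and> A (\<psi> u) = u * B (\<psi> u))"
  proof
    fix z0 assume z0: "z0 \<in> Z"
    have W0: "A z0 / B z0 = w0" using ZX[OF z0] by simp
    obtain e \<psi> where "e > 0" "\<psi> holomorphic_on ball w0 e"
       "\<And>u. u \<in> ball w0 e \<Longrightarrow> \<psi> u \<in> ?X \<inter> ball z0 (d/2) \<and> A (\<psi> u) = u * B (\<psi> u) \<and> B (\<psi> u) \<noteq> 0"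
      by (rule local_inverse[of z0 "?X \<inter> ball z0 (d/2)", unfolded W0])
         (use z0 ZX(1)[OF z0] BX nr openX d(1) in auto)
    then show "\<exists>e \<psi>. e > 0 \<and> continuous_on (ball w0 e) \<psi> \<and>
      (\<forall>u\<in>ball w0 e. \<psi> u \<in> ?X \<inter> ball z0 (d/2) \<and> A (\<psi> u) = u * B (\<psi> u))"
      using holomorphic_on_imp_continuous_on by metis
  qed
  then obtain E \<Psi> where E: "\<And>z0. z0 \<in> Z \<Longrightarrow> E z0 > 0"
    "\<And>z0. z0 \<in> Z \<Longrightarrow> continuous_on (ball w0 (E z0)) (\<Psi> z0)"
    "\<And>z0 u. z0 \<in> Z \<Longrightarrow> u \<in> ball w0 (E z0) \<Longrightarrow> \<Psi> z0 u \<in> ?X \<inter> ball z0 (d/2)"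
    "\<And>z0 u. z0 \<in> Z \<Longrightarrow> u \<in> ball w0 (E z0) \<Longrightarrow> A (\<Psi> z0 u) = u * B (\<Psi> z0 u)"
    by metis
  define e where "e = Min (insert (1 - norm w0) (E ` Z))"
  have e: "e > 0" "\<And>z. z \<in> Z \<Longrightarrow> e \<le> E z" "e \<le> 1 - norm w0"
    unfolding e_def using Z(1) E(1) w0 by (auto simp: Min_gr_iff)
  define T where "T = ball w0 e"
  have Tsub: "T \<subseteq> ball 0 1"
  proof
    fix u assume "u \<in> T"
    then have "dist w0 u < 1 - norm w0" using e(3) by (auto simp: T_def)
    moreover have "norm u \<le> norm w0 + dist w0 u" by (metis dist_norm norm_minus_commute norm_triangle_sub)
    ultimately show "u \<in> ball 0 1" by simp
  qed
  have TE: "T \<subseteq> ball w0 (E z)" if "z \<in> Z" for z using e(2)[OF that] by (simp add: T_def subset_ball)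
  \<comment> \<open>The sheet around \<open>z\<close>: the radius \<open>d/2\<close> keeps the
    sheets of different points of \<open>Z\<close> disjoint, and the preimage of \<open>T\<close>
    cuts each of them to lie exactly over \<open>T\<close>.\<close>
  define V where "V z = ?X \<inter> ball z (d/2) \<inter> ?W -` T" for z
  have disj: "z = z'" if "y \<in> V z" "y \<in> V z'" "z \<in> Z" "z' \<in> Z" for y z z'
  proof (rule ccontr)
    assume "z \<noteq> z'"
    then have "d \<le> dist z z'" using d(2) that by auto
    also have "\<dots> \<le> dist z y + dist z' y" by (rule dist_triangle2)
    also have "\<dots> < d" using that by (auto simp: V_def)
    finally show False by simp
  qed
  have PsiV: "\<Psi> z u \<in> V z" if "z \<in> Z" "u \<in> T" for z u
  proof -
    have "u \<in> ball w0 (E z)" using TE[OF that(1)] that(2) by blast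
    then have *: "\<Psi> z u \<in> ?X \<inter> ball z (d/2)" "A (\<Psi> z u) = u * B (\<Psi> z u)" using E(3,4) that by blast+
    then have "?W (\<Psi> z u) = u" using BX[of "\<Psi> z u"] by simp
    then show ?thesis using * that by (auto simp: V_def)
  qed
  text \<open>Counting: the fibre over \<open>u\<close> has \<open>degree p\<close> points, as many as the local branches supply.\<close>
  have fibre: "y \<in> (\<lambda>z. \<Psi> z u) ` Z" if "u \<in> T" "A y = u * B y" for u y
  proof -
    have inj: "inj_on (\<lambda>z. \<Psi> z u) Z"
    proof (rule inj_onI)
      fix z z' assume "z \<in> Z" "z' \<in> Z" "\<Psi> z u = \<Psi> z' u"
      then show "z = z'"
        using disj[of "\<Psi> z u" z z'] PsiV[of z u] PsiV[of z' u] \<open>u \<in> T\<close> by simp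
    qed
    have nu: "norm u < 1" using Tsub that by auto
    have "(\<lambda>z. \<Psi> z u) ` Z \<subseteq> {y. A y = u * B y}" using E(4) TE[THEN subsetD, OF _ that(1)] by (auto simp del: mem_ball)
    moreover have "card ((\<lambda>z. \<Psi> z u) ` Z) = card {y. A y = u * B y}"
      using card_image[OF inj] Z(2) card_fibre(1)[OF nu] by simp
    ultimately have "(\<lambda>z. \<Psi> z u) ` Z = {y. A y = u * B y}"
      using card_fibre(2)[OF nu] by (metis card_subset_eq)
    then show ?thesis using that(2) by blast
  qed
  have left_inv: "\<Psi> z (?W y) = y" if z: "z \<in> Z" and y: "y \<in> V z" for z y
  proof -
    have "A y = ?W y * B y" "?W y \<in> T" using y BX by (auto simp: V_def)
    then obtain z' where z': "z' \<in> Z" "y = \<Psi> z' (?W y)" using fibre by blast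
    then have "y \<in> V z'" using PsiV[OF z'(1) \<open>?W y \<in> T\<close>] by simp
    then have "z' = z" using disj y z z'(1) by blast
    then show ?thesis using z' by simp
  qed
  show "\<exists>T. w0 \<in> T \<and> openin (top_of_set (ball 0 1)) T \<and>
          (\<exists>v. \<Union> v = {z. F z > 0} \<inter> ?W -` T \<and> (\<forall>u\<in>v. openin (top_of_set {z. F z > 0}) u) \<and>
               pairwise disjnt v \<and> (\<forall>u\<in>v. Ex (homeomorphism u T ?W)))"
  proof (intro exI[of _ T] conjI exI[of _ "V ` Z"] ballI)
    show "w0 \<in> T" using e by (simp add: T_def)
    show "openin (top_of_set (ball 0 1)) T" using Tsub by (intro open_subset) (simp_all add: T_def)
    show "\<Union> (V ` Z) = ?X \<inter> ?W -` T"
    proof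
      show "\<Union> (V ` Z) \<subseteq> ?X \<inter> ?W -` T" by (auto simp: V_def)
      show "?X \<inter> ?W -` T \<subseteq> \<Union> (V ` Z)"
      proof
        fix y assume y: "y \<in> ?X \<inter> ?W -` T"
        then have "A y = ?W y * B y" "?W y \<in> T" using BX by auto
        then obtain z' where z': "z' \<in> Z" "y = \<Psi> z' (?W y)" using fibre by blast
        then have "y \<in> V z'" using PsiV[OF z'(1) \<open>?W y \<in> T\<close>] by simp
        then show "y \<in> \<Union> (V ` Z)" using z' by blast
      qed
    qed
    show "pairwise disjnt (V ` Z)"
      using disj unfolding pairwise_def disjnt_def by blast
    fix U assume "U \<in> V ` Z"
    then obtain z where z: "z \<in> Z" "U = V z" by auto
    have "open (?X \<inter> ?W -` T)"
      using contW openX by (intro continuous_open_preimage) (auto simp: T_def)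
    moreover have "V z = (?X \<inter> ?W -` T) \<inter> ball z (d/2)" by (auto simp: V_def)
    ultimately have "open (V z)" by (metis open_Int open_ball)
    then show "openin (top_of_set ?X) U" unfolding z(2) by (intro open_subset) (auto simp: V_def)
    show "Ex (homeomorphism U T ?W)"
    proof (intro exI[of _ "\<Psi> z"] homeomorphismI)
      show "continuous_on U ?W" using contW z by (auto simp: V_def intro: continuous_on_subset)
      show "continuous_on T (\<Psi> z)" using continuous_on_subset[OF E(2) TE] z(1) by simp
      show "?W ` U \<subseteq> T" using z by (auto simp: V_def)
      show "\<Psi> z ` T \<subseteq> U" using PsiV[OF z(1)] z(2) by blast
      show "\<Psi> z (?W y) = y" if "y \<in> U" for y using left_inv z that by simp
      show "?W (\<Psi> z u) = u" if "u \<in> T" for u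
      proof -
        have "A (\<Psi> z u) = u * B (\<Psi> z u)"
          using E(4)[OF z(1)] TE[OF z(1)] that by (simp add: subset_iff del: mem_ball)
        then show ?thesis using BX[of "\<Psi> z u"] PsiV[OF z(1) that] by (auto simp: V_def)
      qed
    qed
  qed
qed

text \<open>The equation \<open>W (g w) = w\<close> is written without division so that it passes
  directly to boundary limits.\<close>

definition branch :: "(complex \<Rightarrow> complex) \<Rightarrow> bool" where
  "branch g \<longleftrightarrow> g holomorphic_on ball 0 1 \<and> (\<forall>w\<in>ball 0 1. Im (g w) > 0 \<and> A (g w) = w * B (g w))"

lemma F_pos_eq: "A z = w * B z \<Longrightarrow> norm w < 1 \<Longrightarrow> F z > 0"
  using B_nz[of z w] by (auto simp: F_pos_iff norm_mult)

text \<open>The disc is simply connected, so its identity map lifts through the covering. The lift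
  cannot leave the upper half-plane, since by connectedness it would meet the real axis, where
  \<open>F\<close> vanishes.\<close>

lemma branch_exists:
  assumes "Im z > 0" "F z > 0"
  obtains g where "branch g" "g (A z / B z) = z"
proof -
  let ?W = "\<lambda>z. A z / B z" and ?X = "{z. F z > 0}" and ?D = "ball (0::complex) 1"
  have BX: "B z \<noteq> 0" if "F z > 0" for z using that by (auto simp: F_pos_iff)
  have w: "?W z \<in> ?D" using assms BX by (auto simp: F_pos_iff norm_divide)
  have cvx: "convex ?D" by simp
  obtain g where g: "continuous_on ?D g" "g \<in> ?D \<rightarrow> ?X" "g (?W z) = z" "\<And>y. y \<in> ?D \<Longrightarrow> ?W (g y) = y"
    by (rule covering_space_lift_strong[OF covering, of z "?W z" ?D "\<lambda>w. w"])
       (use assms w in \<open>auto simp: convex_imp_simply_connected convex_imp_locally_path_connected\<close>)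
  have gF: "F (g w) > 0" if "w \<in> ?D" for w using g(2) that by auto
  have openX: "open ?X"
    using continuous_on_F[of UNIV] by (intro open_Collect_less) auto
  have "g holomorphic_on ?D"
    by (rule covering_space_lift_is_holomorphic[OF covering openX _ _ _ g(2,1,4)])
       (use BX in \<open>auto intro!: holomorphic_intros\<close>)
  moreover have "A (g w) = w * B (g w)" if "w \<in> ?D" for w
    using g(4)[OF that] BX[OF gF[OF that]] by (auto simp: field_simps)
  moreover have "Im (g w) > 0" if "w \<in> ?D" for w
  proof (rule ccontr)
    assume "\<not> Im (g w) > 0"
    moreover have "connected ((\<lambda>w. Im (g w)) ` ?D)"
      by (intro connected_continuous_image continuous_intros g(1)) simp
    moreover have "Im (g w) \<in> (\<lambda>w. Im (g w)) ` ?D" "Im z \<in> (\<lambda>w. Im (g w)) ` ?D"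
      using that w g(3) by (auto intro: rev_image_eqI)
    ultimately have "0 \<in> (\<lambda>w. Im (g w)) ` ?D"
      using assms(1) unfolding connected_iff_interval by (meson not_less less_imp_le)
    then show False using gF F_real by fastforce
  qed
  ultimately show ?thesis using that g(3) unfolding branch_def by blast
qed

section \<open>Limits of branches at the boundary of the disc\<close>

lemma q_nz: "q \<noteq> 0"
proof
  assume "q = 0"
  moreover obtain z where "poly p z = 0"
    using fundamental_theorem_of_algebra[of p] degree_less by (metis constant_degree not_less_zero)
  ultimately show False using no_common_root by force
qed

text \<open>This covers boundary values \<open>u\<close> too, where roots may coincide and, for
  \<open>u = 1\<close>, the degree drops; different degrees of \<open>p\<close> and \<open>q\<close>
  still keep the polynomial nonzero.\<close>

lemma finite_fibre: "finite {z. A z = u * B z}"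
proof -
  define P where "P = smult (1 - u) p - smult (\<i> * (1 + u)) q"
  have "P \<noteq> 0"
  proof
    assume P: "P = 0"
    show False
    proof (cases "u = 1")
      case True then show False using P q_nz by (simp add: P_def)
    next
      case False
      have "degree (smult (1 - u) p) = degree (smult (\<i> * (1 + u)) q)"
        using P by (simp add: P_def)
      then show False using False degree_less degree_smult_le[of "\<i> * (1 + u)" q] by simp
    qed
  qed
  moreover have "{z. A z = u * B z} = {z. poly P z = 0}"
    by (auto simp: P_def A_def B_def algebra_simps)
  ultimately show ?thesis using poly_roots_finite by simp
qed

text \<open>The cluster set of \<open>g\<close> at \<open>u\<close> is connected and contained in
  the finite set of solutions of \<open>A z = u * B z\<close> together with
  \<open>\<infinity>\<close>; hence it is a single point.\<close>

lemma limit_exists: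
  assumes g: "continuous_on (ball 0 1) g" "\<And>w. w \<in> ball 0 1 \<Longrightarrow> A (g w) = w * B (g w)"
  shows "(\<exists>z. (g \<longlongrightarrow> z) (at u within ball 0 1)) \<or> filterlim g at_infinity (at u within ball 0 1)"
proof (cases "filterlim g at_infinity (at u within ball 0 1)")
  case False
  let ?D = "ball (0::complex) 1"
  define H where "H z = A z - u * B z" for z
  have contH: "continuous_on S H" for S unfolding H_def[abs_def] by (intro continuous_intros)
  obtain r where r: "r > 0" "\<exists>\<^sub>F w in at u within ?D. norm (g w) < r"
    using False unfolding filterlim_at_infinity[OF order_refl] by (auto simp: frequently_def not_less)
  have rel: "norm (H (g w)) = norm (w - u) * norm (B (g w))" if "w \<in> ?D" for w
    using g(2)[OF that] by (simp add: H_def left_diff_distrib[symmetric] norm_mult)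
  text \<open>Points of the disc near \<open>u\<close> are mapped away from any compact set free of zeros of \<open>H\<close>.\<close>
  have avoid: "\<forall>\<^sub>F w in at u within ?D. g w \<notin> K" if "compact K" "\<And>z. z \<in> K \<Longrightarrow> H z \<noteq> 0" for K
  proof (cases "K = {}")
    case False
    have "compact (H ` K)" using contH that(1) by (rule compact_continuous_image)
    moreover have "0 \<notin> H ` K" using that(2) by force
    ultimately obtain \<epsilon> where \<epsilon>: "\<epsilon> > 0" "\<And>z. z \<in> K \<Longrightarrow> \<epsilon> \<le> norm (H z)"
      using separate_point_closed[OF compact_imp_closed, of "H ` K" 0] by (metis dist_0_norm imageI)
    have "bounded (B ` K)" using continuous_on_AB(2) that(1) by (intro compact_imp_bounded compact_continuous_image)
    then obtain M where M: "M > 0" "\<And>z. z \<in> K \<Longrightarrow> norm (B z) \<le> M"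
      unfolding bounded_pos by auto
    have "\<forall>\<^sub>F w in at u within ?D. w \<in> ?D \<and> dist w u < \<epsilon> / M"
      using \<epsilon> M unfolding eventually_at by (intro exI[of _ "\<epsilon> / M"]) auto
    then show ?thesis
    proof eventually_elim
      case (elim w)
      show ?case
      proof
        assume "g w \<in> K"
        then have "\<epsilon> \<le> norm (w - u) * norm (B (g w))" using \<epsilon>(2) rel elim by metis
        also have "\<dots> \<le> norm (w - u) * M" using M(2)[OF \<open>g w \<in> K\<close>] by (intro mult_left_mono) auto
        also have "\<dots> < \<epsilon>" using elim M(1) by (simp add: dist_norm field_simps)
        finally show False by simp
      qed
    qed
  qed simp
  have fin: "finite {z. H z = 0}" using finite_fibre[of u] by (simp add: H_def)
  text \<open>Some zero \<open>z\<close> of \<open>H\<close> is approached frequently, and then connectedness traps \<open>g\<close> near \<open>z\<close>.\<close>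
  obtain z where z: "H z = 0" "\<And>e. e > 0 \<Longrightarrow> \<exists>\<^sub>F w in at u within ?D. g w \<in> ball z e"
  proof (rule ccontr)
    assume "\<not> thesis"
    then have "\<forall>z. H z = 0 \<longrightarrow> (\<exists>e>0. \<forall>\<^sub>F w in at u within ?D. g w \<notin> ball z e)"
      using that by (auto simp: frequently_def)
    then obtain E where E: "\<And>z. H z = 0 \<Longrightarrow> E z > 0"
       "\<And>z. H z = 0 \<Longrightarrow> \<forall>\<^sub>F w in at u within ?D. g w \<notin> ball z (E z)" by metis
    define K where "K = cball 0 r - (\<Union>z\<in>{z. H z = 0}. ball z (E z))"
    have "compact K" unfolding K_def by (intro compact_diff) auto
    moreover have "H z \<noteq> 0" if "z \<in> K" for z using that E(1)[of z] by (auto simp: K_def)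
    ultimately have "\<forall>\<^sub>F w in at u within ?D. g w \<notin> K" by (rule avoid)
    moreover have "\<forall>\<^sub>F w in at u within ?D. \<forall>z\<in>{z. H z = 0}. g w \<notin> ball z (E z)"
      using E(2) by (intro eventually_ball_finite[OF fin]) auto
    ultimately have "\<forall>\<^sub>F w in at u within ?D. \<not> norm (g w) < r"
      by eventually_elim (auto simp: K_def)
    then show False using r(2) by (simp add: frequently_def)
  qed
  have "(g \<longlongrightarrow> z) (at u within ?D)"
  proof (rule tendstoI)
    fix e :: real assume "e > 0"
    obtain d where d: "d > 0" "\<And>y. H y = 0 \<Longrightarrow> y \<noteq> z \<Longrightarrow> d \<le> dist z y"
      using finite_set_avoid[OF fin, of z] by auto
    \<comment> \<open>With \<open>c < d\<close> the circle of radius \<open>c\<close> around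
      \<open>z\<close> carries no zero of \<open>H\<close>, so \<open>g\<close> cannot cross it near
      \<open>u\<close>.\<close>
    define c where "c = min (d/2) e"
    have c: "c > 0" "c < d" "c \<le> e" using d \<open>e > 0\<close> by (auto simp: c_def)
    have "H y \<noteq> 0" if "y \<in> sphere z c" for y using that d(2)[of y] c by (cases "y = z") auto
    then have "\<forall>\<^sub>F w in at u within ?D. g w \<notin> sphere z c" by (intro avoid) auto
    then obtain \<eta> where \<eta>: "\<eta> > 0" "\<And>w. w \<in> ?D \<Longrightarrow> w \<noteq> u \<Longrightarrow> dist w u < \<eta> \<Longrightarrow> g w \<notin> sphere z c"
      unfolding eventually_at by blast
    \<comment> \<open>If \<open>u\<close> lies inside the disc, deleting it still leaves a connected
      set, because a point does not disconnect an open connected set in the plane.\<close>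
    define T where "T = ?D \<inter> ball u \<eta> - {u}"
    have T1: "w \<in> T \<Longrightarrow> g w \<notin> sphere z c" for w using \<eta>(2)[of w] by (auto simp: T_def dist_commute)
    have "connected T" unfolding T_def
      by (intro connected_open_delete open_Int convex_connected convex_Int) auto
    then have conn: "connected (g ` T)"
      by (intro connected_continuous_image continuous_on_subset[OF g(1)]) (auto simp: T_def)
    have evT: "\<forall>\<^sub>F w in at u within ?D. w \<in> T"
      using \<eta>(1) unfolding eventually_at by (intro exI[of _ \<eta>]) (auto simp: T_def dist_commute)
    have "\<exists>\<^sub>F w in at u within ?D. g w \<in> ball z c \<and> w \<in> T"
      using z(2)[OF c(1)] evT by (rule frequently_rev_mp[OF _ eventually_mono]) auto
    then obtain w0 where w0: "w0 \<in> T" "g w0 \<in> ball z c" by (auto dest: frequently_ex)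
    have "g ` T \<subseteq> ball z c"
    proof (rule ccontr)
      assume "\<not> g ` T \<subseteq> ball z c"
      then have "g ` T \<inter> frontier (ball z c) \<noteq> {}"
        using w0 by (intro connected_Int_frontier[OF conn]) auto
      then show False using T1 c by auto
    qed
    then show "\<forall>\<^sub>F w in at u within ?D. dist (g w) z < e"
      using evT by (elim eventually_mono) (use c in \<open>force simp: dist_commute\<close>)
  qed
  then show ?thesis by blast
qed auto

lemma at_within_disc_nonbot: "norm u \<le> 1 \<Longrightarrow> at u within ball (0::complex) 1 \<noteq> bot"
  by (simp add: trivial_limit_within islimpt_ball)

lemma limit_fibre:
  assumes "\<And>w. w \<in> ball 0 1 \<Longrightarrow> A (g w) = w * B (g w)" "norm u \<le> 1"
    "(g \<longlongrightarrow> z) (at u within ball 0 1)"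
  shows "A z = u * B z"
proof -
  have AB: "isCont A z" "isCont B z"
    using continuous_on_AB[of UNIV] by (auto simp: continuous_on_eq_continuous_at)
  have "((\<lambda>w. A (g w)) \<longlongrightarrow> A z) (at u within ball 0 1)"
    by (rule isCont_tendsto_compose[OF AB(1) assms(3)])
  moreover have "((\<lambda>w. w * B (g w)) \<longlongrightarrow> u * B z) (at u within ball 0 1)"
    by (intro tendsto_intros isCont_tendsto_compose[OF AB(2) assms(3)])
  then have "((\<lambda>w. A (g w)) \<longlongrightarrow> u * B z) (at u within ball 0 1)"
    by (rule Lim_transform_eventually) (auto simp: eventually_at_filter assms(1))
  ultimately show ?thesis
    by (rule tendsto_unique[OF at_within_disc_nonbot[OF assms(2)]])
qed

text \<open>As \<open>degree q < degree p\<close>, \<open>W\<close> tends to \<open>1\<close> at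
  \<open>\<infinity>\<close>. Solving \<open>A = w * B\<close> for \<open>q / p\<close> turns this
  into a statement about the limit of \<open>1 - w\<close>.\<close>

lemma limit_infinity:
  assumes "\<And>w. w \<in> ball 0 1 \<Longrightarrow> A (g w) = w * B (g w)" "norm u \<le> 1"
    "filterlim g at_infinity (at u within ball 0 1)"
  shows "u = 1"
proof -
  let ?Fl = "at u within ball 0 1"
  have "((\<lambda>z. poly q z / poly p z) \<longlongrightarrow> 0) at_infinity"
    by (rule poly_divide_tendsto_0_at_infinity[OF degree_less])
  then have "((\<lambda>w. poly q (g w) / poly p (g w)) \<longlongrightarrow> 0) ?Fl"
    by (rule filterlim_compose[OF _ assms(3)])
  then have "((\<lambda>w. \<i> * (1 + w) * (poly q (g w) / poly p (g w))) \<longlongrightarrow> \<i> * (1 + u) * 0) ?Fl"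
    by (intro tendsto_intros)
  moreover have "\<forall>\<^sub>F w in ?Fl. \<i> * (1 + w) * (poly q (g w) / poly p (g w)) = 1 - w"
  proof -
    have "filterlim (poly p) at_infinity at_infinity"
      using degree_less by (intro filterlim_poly_at_infinity) auto
    then have "filterlim (\<lambda>w. poly p (g w)) at_infinity ?Fl"
      by (rule filterlim_compose[OF _ assms(3)])
    then have "\<forall>\<^sub>F w in ?Fl. poly p (g w) \<noteq> 0"
      by (rule filterlim_at_infinity_imp_eventually_ne)
    moreover have "\<forall>\<^sub>F w in ?Fl. w \<in> ball 0 1" by (simp add: eventually_at_filter)
    ultimately show ?thesis
    proof eventually_elim
      case (elim w)
      then have "A (g w) = w * B (g w)" using assms(1) by blast
      then have "\<i> * (1 + w) * poly q (g w) = - (\<i> * \<i>) * (1 - w) * poly p (g w)"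
        by (simp add: A_def B_def algebra_simps)
      then show ?case using elim by (simp add: field_simps)
    qed
  qed
  ultimately have "((\<lambda>w. 1 - w) \<longlongrightarrow> 0) ?Fl"
    by (auto intro: Lim_transform_eventually)
  moreover have "((\<lambda>w. 1 - w) \<longlongrightarrow> 1 - u) ?Fl" by (intro tendsto_intros)
  ultimately have "1 - u = 0" 
    using tendsto_unique[OF at_within_disc_nonbot[OF assms(2)]] by blast
  then show ?thesis by simp
qed

end

subsection \<open>Boundary values of branches\<close>

text \<open>The boundary points of the half-plane in the sphere, encoded by the filters that
  \<open>simple_curve_in_H\<close> expects; equality of ends is equality of filters.\<close>

definition end_filter :: "complex filter \<Rightarrow> bool" where
  "end_filter E \<longleftrightarrow> E = at_infinity \<or> (\<exists>a::real. E = nhds (of_real a))"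

text \<open>If \<open>g\<close> stays in a closed set near \<open>u\<close>, then so do its limits
  at all nearby \<open>v\<close>, and closed neighbourhoods suffice to test convergence to
  \<open>E\<close>. This single fact yields both continuity of the extended branch and the limits at
  the ends of a curve.\<close>

lemma filterlim_boundary_values:
  fixes g h :: "complex \<Rightarrow> complex"
  assumes E: "E = at_infinity \<or> (\<exists>z. E = nhds z)"
    and lim: "filterlim g E (at u within D)"
    and vals: "\<And>v. v \<in> S \<Longrightarrow> v \<noteq> u \<Longrightarrow> (g \<longlongrightarrow> h v) (at v within D)"
    and nb: "\<And>v. v \<in> S \<Longrightarrow> at v within D \<noteq> bot"
  shows "filterlim h E (at u within S)"
proof -
  have key: "\<forall>\<^sub>F v in at u within S. h v \<in> K" if K: "closed K" "\<forall>\<^sub>F w in at u within D. g w \<in> K" for K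
  proof -
    obtain d where d: "d > 0" "\<And>w. w \<in> D \<Longrightarrow> w \<noteq> u \<Longrightarrow> dist w u < d \<Longrightarrow> g w \<in> K"
      using K(2) unfolding eventually_at by blast
    have "h v \<in> K" if v: "v \<in> S" "v \<noteq> u" "dist v u < d" for v
    proof (rule Lim_in_closed_set[OF \<open>closed K\<close> _ nb[OF v(1)] vals[OF v(1,2)]])
      \<comment> \<open>A ball of this radius around \<open>v\<close> stays within distance
        \<open>d\<close> of \<open>u\<close> and misses \<open>u\<close> itself.\<close>
      define r where "r = min (d - dist v u) (dist v u)"
      have "r > 0" using v by (auto simp: r_def)
      moreover have "g w \<in> K" if "w \<in> D" "dist w v < r" for w
      proof (rule d(2)[OF that(1)])
        show "w \<noteq> u" using that(2) by (auto simp: r_def dist_commute)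
        show "dist w u < d" using that(2) dist_triangle[of w u v] by (auto simp: r_def)
      qed
      ultimately show "\<forall>\<^sub>F w in at v within D. g w \<in> K" unfolding eventually_at by blast
    qed
    then show ?thesis unfolding eventually_at using d(1) by blast
  qed
  from E show ?thesis
  proof
    assume E: "E = at_infinity"
    show ?thesis unfolding E filterlim_at_infinity[OF order_refl]
    proof safe
      fix r :: real
      have "\<forall>\<^sub>F w in at u within D. r \<le> norm (g w)"
        using lim unfolding E filterlim_at_infinity[of 0, OF order_refl]
        by (metis (mono_tags, lifting) eventually_mono gt_ex linorder_not_le norm_ge_zero order_trans)
      then have "\<forall>\<^sub>F v in at u within S. h v \<in> {z. r \<le> norm z}"
        by (intro key closed_Collect_le continuous_intros) auto
      then show "\<forall>\<^sub>F v in at u within S. r \<le> norm (h v)" by simp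
    qed
  next
    assume "\<exists>z. E = nhds z"
    then obtain z where E: "E = nhds z" by blast
    show ?thesis unfolding E
    proof (rule tendstoI)
      fix e :: real assume "e > 0"
      then have "\<forall>\<^sub>F w in at u within D. dist (g w) z < e/2"
        using lim unfolding E by (intro tendstoD) auto
      then have "\<forall>\<^sub>F w in at u within D. g w \<in> cball z (e/2)"
        by eventually_elim (auto simp: dist_commute)
      then have "\<forall>\<^sub>F v in at u within S. h v \<in> cball z (e/2)" by (intro key) auto
      then show "\<forall>\<^sub>F v in at u within S. dist (h v) z < e"
        by eventually_elim (use \<open>e > 0\<close> in \<open>auto simp: dist_commute\<close>)
    qed
  qed
qed

context real_pair
begin

definition L :: "complex set" where "L = {z. Im z > 0 \<and> F z = 0}"

text \<open>A branch is extended by its boundary values; \<open>inner_pts g\<close> are the points of the unit circle whose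
  boundary value lies in the open upper half-plane. Elsewhere on the circle \<open>ext g\<close> may be junk,
  since the limit may be infinite.\<close>

definition ext :: "(complex \<Rightarrow> complex) \<Rightarrow> complex \<Rightarrow> complex" where
  "ext g u = Lim (at u within ball 0 1) g"

definition inner_pts :: "(complex \<Rightarrow> complex) \<Rightarrow> complex set" where
  "inner_pts g = {u. norm u = 1 \<and> (\<exists>z. Im z > 0 \<and> (g \<longlongrightarrow> z) (at u within ball 0 1))}"

lemma branchD:
  assumes "branch g"
  shows "g holomorphic_on ball 0 1" "continuous_on (ball 0 1) g"
    "\<And>w. w \<in> ball 0 1 \<Longrightarrow> Im (g w) > 0" "\<And>w. w \<in> ball 0 1 \<Longrightarrow> A (g w) = w * B (g w)"
  using assms by (auto simp: branch_def intro: holomorphic_on_imp_continuous_on)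

lemma ext_eqI: "(g \<longlongrightarrow> z) (at u within ball 0 1) \<Longrightarrow> norm u \<le> 1 \<Longrightarrow> ext g u = z"
  unfolding ext_def by (rule tendsto_Lim[OF at_within_disc_nonbot])

lemma branch_tendsto: "branch g \<Longrightarrow> u \<in> ball 0 1 \<Longrightarrow> (g \<longlongrightarrow> g u) (at u within ball 0 1)"
  using branchD(2) unfolding continuous_on_def by blast

lemma ext_inside: "branch g \<Longrightarrow> u \<in> ball 0 1 \<Longrightarrow> ext g u = g u"
  by (rule ext_eqI[OF branch_tendsto]) auto

lemma ext_tendsto:
  assumes "branch g" "u \<in> ball 0 1 \<union> inner_pts g"
  shows "(g \<longlongrightarrow> ext g u) (at u within ball 0 1)" "Im (ext g u) > 0" "A (ext g u) = u * B (ext g u)"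
    "norm u \<le> 1"
proof -
  obtain z where z: "(g \<longlongrightarrow> z) (at u within ball 0 1)" "Im z > 0"
    using assms branch_tendsto[OF assms(1)] branchD(3)[OF assms(1)] unfolding inner_pts_def by blast
  show u: "norm u \<le> 1" using assms(2) by (auto simp: inner_pts_def)
  then have "ext g u = z" using z ext_eqI by blast
  then show "(g \<longlongrightarrow> ext g u) (at u within ball 0 1)" "Im (ext g u) > 0" "A (ext g u) = u * B (ext g u)"
    using z limit_fibre[OF branchD(4)[OF assms(1)] u z(1)] by auto
qed

lemma F_fibre: "A z = u * B z \<Longrightarrow> norm u = 1 \<Longrightarrow> F z = 0"
  by (auto simp: F_eq_0_iff norm_mult)

lemma ext_L: "branch g \<Longrightarrow> u \<in> inner_pts g \<Longrightarrow> ext g u \<in> L"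
  using ext_tendsto[of g u] F_fibre by (auto simp: L_def inner_pts_def)

text \<open>A branch continues analytically across the circle wherever its boundary value is in the
  open half-plane: near that value the local inverse is the only solution, so it agrees with
  \<open>g\<close> on an open set, and then on the whole half-ball by the identity theorem.\<close>

lemma branch_local:
  assumes g: "branch g" and u0: "norm u0 = 1" and z0: "Im z0 > 0" and lim: "(g \<longlongrightarrow> z0) (at u0 within ball 0 1)"
  obtains e \<delta> \<psi> where "e > 0" "\<delta> > 0" "\<psi> holomorphic_on ball u0 e" "\<psi> u0 = z0"
    "\<And>u. u \<in> ball u0 e \<Longrightarrow> norm u \<le> 1 \<Longrightarrow> ext g u = \<psi> u"
    "\<And>u. u \<in> ball u0 e \<Longrightarrow> norm u = 1 \<Longrightarrow> u \<in> inner_pts g"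
    "\<And>z. z \<in> ball z0 \<delta> \<Longrightarrow> B z \<noteq> 0 \<and> A z / B z \<in> ball u0 e \<and> \<psi> (A z / B z) = z"
proof -
  let ?D = "ball (0::complex) 1"
  have Az: "A z0 = u0 * B z0" using limit_fibre[OF branchD(4)[OF g] _ lim] u0 by simp
  have Bz: "B z0 \<noteq> 0" using B_nz[OF Az] .
  have W0: "A z0 / B z0 = u0" using Az Bz by simp
  have Sin: "z0 \<in> {z. Im z > 0}" using z0 by simp
  have nz: "Im z0 \<noteq> 0" using z0 by simp
  have op: "open {z. Im z > 0}" by (simp add: open_halfspace_Im_gt)
  obtain e \<delta> \<psi> where *: "e > 0" "\<delta> > 0" "\<psi> holomorphic_on ball u0 e" "\<psi> u0 = z0"
     "\<And>u. u \<in> ball u0 e \<Longrightarrow> \<psi> u \<in> {z. Im z > 0} \<and> A (\<psi> u) = u * B (\<psi> u) \<and> B (\<psi> u) \<noteq> 0"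
    "\<And>z. z \<in> ball z0 \<delta> \<Longrightarrow> B z \<noteq> 0 \<and> A z / B z \<in> ball u0 e \<and> \<psi> (A z / B z) = z"
    by (rule local_inverse[OF nz Bz op Sin, unfolded W0]) (rule that)
  let ?T = "ball u0 e \<inter> ?D"
  have eq: "g w = \<psi> w" if "w \<in> ?T" for w
  proof -
    have "\<forall>\<^sub>F w in at u0 within ?D. dist (g w) z0 < \<delta>" using lim *(2) by (rule tendstoD)
    then have "\<forall>\<^sub>F w in at u0 within ?D. w \<in> ?T \<and> g w \<in> ball z0 \<delta>"
      using *(1) unfolding eventually_at
      by (metis Int_iff dist_commute mem_ball min_less_iff_conj)
    then obtain w1 where w1: "w1 \<in> ?T" "g w1 \<in> ball z0 \<delta>"
      using eventually_happens'[OF at_within_disc_nonbot[of u0]] u0 by auto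
    have cont: "continuous_on ?T g" using branchD(2)[OF g] by (rule continuous_on_subset) auto
    have "open (?T \<inter> g -` ball z0 \<delta>)"
      using cont by (intro continuous_open_preimage open_Int) auto
    moreover have "g w = \<psi> w" if "w \<in> ?T \<inter> g -` ball z0 \<delta>" for w
    proof -
      have "B (g w) \<noteq> 0" "\<psi> (A (g w) / B (g w)) = g w" using *(6) that by auto
      moreover have "A (g w) = w * B (g w)" using branchD(4)[OF g] that by auto
      ultimately show ?thesis by simp
    qed
    moreover have "connected ?T" by (intro convex_connected convex_Int) auto
    moreover have "g holomorphic_on ?T" "\<psi> holomorphic_on ?T"
      using branchD(1)[OF g] *(3) holomorphic_on_subset by blast+
    ultimately show ?thesis
      using analytic_continuation_open[of "?T \<inter> g -` ball z0 \<delta>" ?T g \<psi> w] w1 that by blast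
  qed
  have lim': "(g \<longlongrightarrow> \<psi> u) (at u within ?D)" if u: "u \<in> ball u0 e" for u
  proof -
    have "isCont \<psi> u"
      using *(3) u holomorphic_on_imp_continuous_on continuous_on_eq_continuous_at open_ball by metis
    then have "(\<psi> \<longlongrightarrow> \<psi> u) (at u within ?D)"
      using continuous_at_imp_continuous_at_within continuous_within by blast
    moreover have "\<forall>\<^sub>F w in at u within ?D. w \<in> ball u0 e"
      using u by (metis UNIV_I open_ball eventually_at_topological)
    then have "\<forall>\<^sub>F w in at u within ?D. \<psi> w = g w"
      using eventually_at_filter[of "\<lambda>w. w \<in> ?D" u ?D] eq
      by (auto simp: eventually_at_filter elim!: eventually_mono)
    ultimately show ?thesis by (rule Lim_transform_eventually)
  qed
  show ?thesis
  proof (rule that[OF *(1,2,3,4) _ _ *(6)])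
    show "ext g u = \<psi> u" if "u \<in> ball u0 e" "norm u \<le> 1" for u using ext_eqI lim' that by blast
    show "u \<in> inner_pts g" if "u \<in> ball u0 e" "norm u = 1" for u
      using lim' *(5) that unfolding inner_pts_def by blast
  qed
qed

lemma continuous_on_ext:
  assumes g: "branch g"
  shows "continuous_on (ball 0 1 \<union> inner_pts g) (ext g)"
  unfolding continuous_on_def
proof
  fix u assume u: "u \<in> ball 0 1 \<union> inner_pts g"
  show "(ext g \<longlongrightarrow> ext g u) (at u within ball 0 1 \<union> inner_pts g)"
    by (rule filterlim_boundary_values[OF _ ext_tendsto(1)[OF g u] ext_tendsto(1)[OF g]
         at_within_disc_nonbot[OF ext_tendsto(4)[OF g]]]) auto
qed

text \<open>Choose \<open>w1\<close> in the disc close to the circle point, take the branch through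
  \<open>\<psi> w1\<close>, and identify it with the local inverse \<open>\<psi>\<close> by analytic
  continuation.\<close>

lemma branch_at:
  assumes z0: "z0 \<in> L"
  obtains g where "branch g" "(g \<longlongrightarrow> z0) (at (A z0 / B z0) within ball 0 1)"
proof -
  let ?D = "ball (0::complex) 1"
  define u0 where "u0 = A z0 / B z0"
  have Im0: "Im z0 > 0" and nAB: "norm (A z0) = norm (B z0)" using z0 by (auto simp: L_def F_eq_0_iff)
  then have Bz: "B z0 \<noteq> 0" using A_B_not_both_0[of z0] by auto
  then have u0: "norm u0 = 1" using nAB by (simp add: u0_def norm_divide)
  have Sin: "z0 \<in> {z. Im z > 0}" using Im0 by simp
  have nz: "Im z0 \<noteq> 0" using Im0 by simp
  have op: "open {z. Im z > 0}" by (simp add: open_halfspace_Im_gt)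
  obtain e \<delta> \<psi> where *: "e > 0" "\<delta> > 0" "\<psi> holomorphic_on ball u0 e" "\<psi> u0 = z0"
     "\<And>u. u \<in> ball u0 e \<Longrightarrow> \<psi> u \<in> {z. Im z > 0} \<and> A (\<psi> u) = u * B (\<psi> u) \<and> B (\<psi> u) \<noteq> 0"
    "\<And>z. z \<in> ball z0 \<delta> \<Longrightarrow> B z \<noteq> 0 \<and> A z / B z \<in> ball u0 e \<and> \<psi> (A z / B z) = z"
    by (rule local_inverse[OF nz Bz op Sin, folded u0_def]) (rule that)
  let ?T = "ball u0 e \<inter> ?D"
  have isC: "isCont \<psi> u0"
    using *(1,3) holomorphic_on_imp_continuous_on continuous_on_eq_continuous_at open_ball centre_in_ball by metis
  have limpsi: "(\<psi> \<longlongrightarrow> z0) (at u0 within ?D)"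
    using isC *(4) continuous_at_imp_continuous_at_within continuous_within by metis
  have evT: "\<forall>\<^sub>F w in at u0 within ?D. w \<in> ?T"
    using *(1) unfolding eventually_at by (intro exI[of _ e]) (auto simp: dist_commute)
  then obtain w1 where w1: "w1 \<in> ?T"
    using eventually_happens'[OF at_within_disc_nonbot[of u0]] u0 by auto
  define z1 where "z1 = \<psi> w1"
  have z1: "Im z1 > 0" "A z1 = w1 * B z1" "B z1 \<noteq> 0" using *(5)[of w1] w1 by (auto simp: z1_def)
  moreover have "F z1 > 0" using F_pos_eq[OF z1(2)] w1 by simp
  moreover have "A z1 / B z1 = w1" using z1 by simp
  ultimately obtain g where g: "branch g" "g w1 = z1" using branch_exists by metis
  have nz1: "Im z1 \<noteq> 0" using z1 by simp
  \<comment> \<open>A second local inverse, at the interior point \<open>z1\<close>: both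
    \<open>g\<close> and \<open>\<psi>\<close> solve the same equation near \<open>z1\<close>, so
    uniqueness there gives the open set of agreement.\<close>
  obtain e1 \<delta>1 \<psi>1 where l1: "e1 > 0" "\<delta>1 > 0"
    "\<And>z. z \<in> ball z1 \<delta>1 \<Longrightarrow> B z \<noteq> 0 \<and> A z / B z \<in> ball w1 e1 \<and> \<psi>1 (A z / B z) = z"
    by (rule local_inverse[OF nz1 z1(3) open_UNIV UNIV_I, unfolded \<open>A z1 / B z1 = w1\<close>]) (rule that)
  have eq: "g w = \<psi> w" if "w \<in> ?T" for w
  proof -
    have cont: "continuous_on ?T g" "continuous_on ?T \<psi>"
      using branchD(2)[OF g(1)] holomorphic_on_imp_continuous_on[OF *(3)]
      by (auto intro: continuous_on_subset)
    define T1 where "T1 = (?T \<inter> g -` ball z1 \<delta>1) \<inter> (?T \<inter> \<psi> -` ball z1 \<delta>1)"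
    have "open T1" unfolding T1_def
      using cont by (intro continuous_open_preimage open_Int) auto
    moreover have "g w = \<psi> w" if "w \<in> T1" for w
    proof -
      have "B (g w) \<noteq> 0" "\<psi>1 (A (g w) / B (g w)) = g w" "B (\<psi> w) \<noteq> 0" "\<psi>1 (A (\<psi> w) / B (\<psi> w)) = \<psi> w"
        using l1(3) that by (auto simp: T1_def)
      moreover have "A (g w) = w * B (g w)" using branchD(4)[OF g(1)] that by (auto simp: T1_def)
      moreover have "A (\<psi> w) = w * B (\<psi> w)" using *(5) that by (auto simp: T1_def)
      ultimately show ?thesis by simp
    qed
    moreover have "connected ?T" by (intro convex_connected convex_Int) auto
    moreover have "g holomorphic_on ?T" "\<psi> holomorphic_on ?T"
      using branchD(1)[OF g(1)] *(3) holomorphic_on_subset by blast+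
    moreover have "w1 \<in> T1" using w1 g(2) z1_def l1(2) by (auto simp: T1_def)
    moreover have "T1 \<subseteq> ?T" by (auto simp: T1_def)
    ultimately show ?thesis
      using analytic_continuation_open[of T1 ?T g \<psi> w] that by blast
  qed
  have "\<forall>\<^sub>F w in at u0 within ?D. \<psi> w = g w" using evT by eventually_elim (simp add: eq)
  then have "(g \<longlongrightarrow> z0) (at u0 within ?D)" by (rule Lim_transform_eventually[OF limpsi])
  then show ?thesis using that g(1) unfolding u0_def by blast
qed

text \<open>A limit outside the open half-plane is real or infinite. The last two conclusions retain
  the value \<open>u\<close> of \<open>W\<close> at that end; they are what later tells the two ends
  of a curve apart.\<close>

lemma branch_limit_cases:
  assumes "branch g" "norm u = 1" "u \<notin> inner_pts g"
  obtains E where "end_filter E" "filterlim g E (at u within ball 0 1)"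
    "\<And>a. E = nhds (of_real a) \<Longrightarrow> A (of_real a) = u * B (of_real a)" "E = at_infinity \<Longrightarrow> u = 1"
proof -
  note rel = branchD(4)[OF assms(1)]
  have "(\<exists>z. (g \<longlongrightarrow> z) (at u within ball 0 1)) \<or> filterlim g at_infinity (at u within ball 0 1)"
    by (rule limit_exists[OF branchD(2)[OF assms(1)] rel])
  then show ?thesis
  proof
    assume inf: "filterlim g at_infinity (at u within ball 0 1)"
    have "nhds (complex_of_real a) \<noteq> at_infinity" for a
    proof
      assume "nhds (complex_of_real a) = at_infinity"
      then have "filterlim (\<lambda>z. z) at_infinity (nhds (complex_of_real a))" by (simp add: filterlim_ident)
      moreover have "filterlim (\<lambda>z. z) (nhds (complex_of_real a)) (nhds (complex_of_real a))" by (rule filterlim_ident)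
      ultimately show False using not_tendsto_and_filterlim_at_infinity nhds_neq_bot by blast
    qed
    then show ?thesis using that[of at_infinity] inf limit_infinity[OF rel _ inf] assms(2)
      unfolding end_filter_def by (metis order_refl)
  next
    assume "\<exists>z. (g \<longlongrightarrow> z) (at u within ball 0 1)"
    then obtain z where z: "(g \<longlongrightarrow> z) (at u within ball 0 1)" by blast
    have nb: "at u within ball 0 1 \<noteq> bot" using at_within_disc_nonbot assms(2) by simp
    have "\<forall>\<^sub>F w in at u within ball 0 1. Im (g w) \<ge> 0"
      using branchD(3)[OF assms(1)] by (auto simp: eventually_at_filter less_imp_le)
    then have "Im z \<ge> 0" by (rule tendsto_lowerbound[OF tendsto_Im[OF z] _ nb])
    moreover have "\<not> Im z > 0" using assms z by (auto simp: inner_pts_def)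
    ultimately have z': "z = of_real (Re z)" by (simp add: complex_eq_iff)
    have "nhds (of_real (Re z)) \<noteq> (at_infinity :: complex filter)"
    proof
      assume "nhds (complex_of_real (Re z)) = at_infinity"
      then have "filterlim g at_infinity (at u within ball 0 1)" using z z' by simp
      then show False using not_tendsto_and_filterlim_at_infinity[OF nb z] by blast
    qed
    moreover have "a = Re z" if "nhds (complex_of_real (Re z)) = nhds (complex_of_real a)" for a
    proof -
      have "(g \<longlongrightarrow> complex_of_real a) (at u within ball 0 1)" using that z z' by simp
      then have "complex_of_real a = z" using tendsto_unique[OF nb] z by blast
      then show ?thesis by auto
    qed
    moreover have "A z = u * B z" using limit_fibre[OF rel _ z] assms(2) by simp
    ultimately show ?thesis using that[of "nhds z"] z z' unfolding end_filter_def by metis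
  qed
qed

text \<open>Replacing \<open>R\<close> by \<open>- R\<close> replaces \<open>W\<close> by
  \<open>1 / W\<close>. Branches over the exterior of the circle thus become branches over the disc
  for the pair \<open>(- p, q)\<close>.\<close>

lemma real_pair_neg: "real_pair (- p) q"
proof
  show "poly (- p) (cnj z) = cnj (poly (- p) z)" "poly q (cnj z) = cnj (poly q z)" for z
    by (simp_all add: real_p real_q)
  show "poly (- p) z = 0 \<Longrightarrow> poly q z \<noteq> 0" for z using no_common_root by simp
  show "degree q < degree (- p)" using degree_less by simp
  show "Im z \<noteq> 0 \<Longrightarrow> poly (wronskian (- p) q) z \<noteq> 0" for z
    using noncritical[of z] by (auto simp: wronskian_def pderiv_minus algebra_simps)
qed

text \<open>If the boundary values of a branch \<open>g\<close> over the disc lay in the upper half-plane for all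
  but one point of the circle, then \<open>g\<close> could be glued to a branch over the complementary disc,
  giving an entire function into the upper half-plane after moving the exceptional point to infinity.\<close>
lemma outer_pt_exists:
  assumes g: "branch g" and u1: "norm u1 = 1"
  obtains u where "norm u = 1" "u \<noteq> u1" "u \<notin> inner_pts g"
proof (rule ccontr)
  assume contr: "\<not> thesis"
  note found = that
  have all: "u \<in> inner_pts g" if u: "norm u = 1" "u \<noteq> u1" for u
    using contr found[OF u] by blast
  interpret neg: real_pair "- p" q by (rule real_pair_neg)
  have negA: "neg.A z = - B z" and negB: "neg.B z = - A z" for z
    by (simp_all add: neg.A_def neg.B_def A_def B_def)
  have negL: "neg.L = L" by (auto simp: neg.L_def L_def neg.F_def F_def)
  \<comment> \<open>\<open>\<mu>\<close> is the Cayley map from the upper half-plane to the disc,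
    rotated so that the exceptional point \<open>u1\<close> corresponds to
    \<open>\<infinity>\<close>; \<open>\<nu>\<close> is its reciprocal and takes the lower
    half-plane to the disc.\<close>
  define \<mu> where "\<mu> t = u1 * ((t - \<i>) / (t + \<i>))" for t
  define \<nu> where "\<nu> t = inverse u1 * ((t + \<i>) / (t - \<i>))" for t
  have u1nz: "u1 \<noteq> 0" using u1 by auto
  have norm_sq: "(norm (t + \<i>))\<^sup>2 - (norm (t - \<i>))\<^sup>2 = 4 * Im t" for t
    by (simp only: cmod_power2) (simp add: power2_eq_square algebra_simps)
  have lt_iff: "norm (t - \<i>) < norm (t + \<i>) \<longleftrightarrow> Im t > 0" "norm (t + \<i>) < norm (t - \<i>) \<longleftrightarrow> Im t < 0" for t
    using norm_sq[of t] norm_ge_zero[of "t - \<i>"] norm_ge_zero[of "t + \<i>"]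
    by (smt (verit) power_strict_mono power_mono pos2)+
  have nz: "Im t \<ge> 0 \<Longrightarrow> t + \<i> \<noteq> 0" "Im t \<le> 0 \<Longrightarrow> t - \<i> \<noteq> 0" for t
    by (auto simp: complex_eq_iff)
  have norm_mu: "norm (\<mu> t) = norm (t - \<i>) / norm (t + \<i>)" and norm_nu: "norm (\<nu> t) = norm (t + \<i>) / norm (t - \<i>)" for t
    using u1 by (simp_all add: \<mu>_def \<nu>_def norm_mult norm_divide norm_inverse)
  have mu_disc: "\<mu> t \<in> ball 0 1" if "Im t > 0" for t
    using that lt_iff(1)[of t] nz(1)[of t] by (simp add: norm_mu)
  have nu_disc: "\<nu> t \<in> ball 0 1" if "Im t < 0" for t
    using that lt_iff(2)[of t] nz(2)[of t] by (simp add: norm_nu)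
  have real: "norm (\<mu> t) = 1" "norm (\<nu> t) = 1" "\<mu> t * \<nu> t = 1" "\<mu> t \<noteq> u1" if "Im t = 0" for t
  proof -
    have "norm (t - \<i>) = norm (t + \<i>)" using lt_iff[of t] that by linarith
    then show "norm (\<mu> t) = 1" "norm (\<nu> t) = 1" using nz[of t] that by (simp_all add: norm_mu norm_nu)
    show "\<mu> t * \<nu> t = 1" using nz[of t] that u1nz by (simp add: \<mu>_def \<nu>_def)
    show "\<mu> t \<noteq> u1" using nz[of t] that u1nz by (auto simp: \<mu>_def field_simps)
  qed
  have mu_inner: "\<mu> t \<in> inner_pts g" if "Im t = 0" for t using all real[OF that] by blast
  have contmu: "continuous_on {t. Im t \<ge> 0} \<mu>" and contnu: "continuous_on {t. Im t \<le> 0} \<nu>"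
    unfolding \<mu>_def[abs_def] \<nu>_def[abs_def] using nz by (auto intro!: continuous_intros)
  have contg: "continuous_on {t. Im t \<ge> 0} (\<lambda>t. ext g (\<mu> t))"
    by (rule continuous_on_compose2[OF continuous_on_ext[OF g] contmu])
       (use mu_disc mu_inner in \<open>force simp: le_less\<close>)
  define z0 where "z0 = ext g (\<mu> 0)"
  have z0L: "z0 \<in> neg.L" using ext_L[OF g] mu_inner[of 0] by (simp add: negL z0_def)
  have z0rel: "A z0 = \<mu> 0 * B z0" using ext_tendsto(3)[OF g] mu_inner[of 0] by (simp add: z0_def)
  have nu0: "neg.A z0 / neg.B z0 = \<nu> 0"
  proof -
    have "B z0 / A z0 = 1 / \<mu> 0" using z0rel B_nz[OF z0rel] by simp
    also have "\<dots> = \<nu> 0" using real(3)[of 0] by (metis inverse_eq_divide inverse_unique zero_complex.sel(2))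
    finally show ?thesis by (simp add: negA negB)
  qed
  obtain h where h: "neg.branch h" "(h \<longlongrightarrow> z0) (at (\<nu> 0) within ball 0 1)"
    using neg.branch_at[OF z0L] unfolding nu0 by blast
  \<comment> \<open>The branches \<open>g\<close> and \<open>h\<close> share the boundary value
    \<open>z0\<close> at parameter \<open>0\<close>. Agreement spreads along the real line because
    \<open>K\<close> is clopen; openness is local uniqueness of the solution of
    \<open>A z = u * B z\<close>.\<close>
  define K where "K = {t::real. \<nu> t \<in> neg.inner_pts h \<and> neg.ext h (\<nu> t) = ext g (\<mu> t)}"
  have "0 \<in> K"
  proof -
    have "Im z0 > 0" using z0L by (simp add: neg.L_def)
    then have "\<nu> 0 \<in> neg.inner_pts h" using h(2) real(2)[of 0] by (auto simp: neg.inner_pts_def)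
    moreover have "neg.ext h (\<nu> 0) = z0" using h(2) real(2)[of 0] by (intro neg.ext_eqI) auto
    ultimately show ?thesis by (simp add: K_def z0_def)
  qed
  have cont_real: "continuous_on UNIV (\<lambda>t::real. \<mu> t)" "continuous_on UNIV (\<lambda>t::real. \<nu> t)"
     "continuous_on UNIV (\<lambda>t::real. ext g (\<mu> t))"
    by (rule continuous_on_compose2[OF contmu] continuous_on_compose2[OF contnu]
        continuous_on_compose2[OF contg]; auto intro!: continuous_intros)+
  have "open K"
  proof (subst open_subopen, rule ballI)
    fix t assume t: "t \<in> K"
    define z1 where "z1 = ext g (\<mu> t)"
    have mt: "\<mu> t \<in> inner_pts g" and nt: "\<nu> t \<in> neg.inner_pts h" and hz: "neg.ext h (\<nu> t) = z1"
      using mu_inner[of "of_real t"] t by (auto simp: K_def z1_def)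
    have lg: "(g \<longlongrightarrow> z1) (at (\<mu> t) within ball 0 1)" and z1: "Im z1 > 0"
      using ext_tendsto[OF g, of "\<mu> t"] mt by (auto simp: z1_def)
    have lh: "(h \<longlongrightarrow> z1) (at (\<nu> t) within ball 0 1)"
      using neg.ext_tendsto(1)[OF h(1), of "\<nu> t"] nt hz by simp
    have n1: "norm (\<mu> t) = 1" "norm (\<nu> t) = 1" using real[of "of_real t"] by auto
    obtain e1 \<delta>1 \<psi>1 where p1: "e1 > 0" "\<delta>1 > 0" "\<psi>1 holomorphic_on ball (\<mu> t) e1" "\<psi>1 (\<mu> t) = z1"
      "\<And>u. u \<in> ball (\<mu> t) e1 \<Longrightarrow> norm u \<le> 1 \<Longrightarrow> ext g u = \<psi>1 u"
      "\<And>u. u \<in> ball (\<mu> t) e1 \<Longrightarrow> norm u = 1 \<Longrightarrow> u \<in> inner_pts g"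
      "\<And>z. z \<in> ball z1 \<delta>1 \<Longrightarrow> B z \<noteq> 0 \<and> A z / B z \<in> ball (\<mu> t) e1 \<and> \<psi>1 (A z / B z) = z"
      by (rule branch_local[OF g n1(1) z1 lg]) (rule that)
    obtain e2 \<delta>2 \<psi>2 where p2: "e2 > 0" "\<delta>2 > 0" "\<psi>2 holomorphic_on ball (\<nu> t) e2" "\<psi>2 (\<nu> t) = z1"
      "\<And>u. u \<in> ball (\<nu> t) e2 \<Longrightarrow> norm u \<le> 1 \<Longrightarrow> neg.ext h u = \<psi>2 u"
      "\<And>u. u \<in> ball (\<nu> t) e2 \<Longrightarrow> norm u = 1 \<Longrightarrow> u \<in> neg.inner_pts h"
      "\<And>z. z \<in> ball z1 \<delta>2 \<Longrightarrow> neg.B z \<noteq> 0 \<and> neg.A z / neg.B z \<in> ball (\<nu> t) e2 \<and> \<psi>2 (neg.A z / neg.B z) = z"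
      by (rule neg.branch_local[OF h(1) n1(2) z1 lh]) (rule that)
    have isC2: "isCont \<psi>2 (\<nu> t)"
      using p2(1,3) holomorphic_on_imp_continuous_on continuous_on_eq_continuous_at open_ball centre_in_ball by metis
    have isCnu: "isCont (\<lambda>t::real. \<nu> t) t" using cont_real(2) by (simp add: continuous_on_eq_continuous_at)
    have "((\<lambda>s::real. \<nu> s) \<longlongrightarrow> \<nu> t) (nhds t)" using isCnu by (simp add: isCont_def tendsto_nhds_iff)
    then have ev1: "\<forall>\<^sub>F s in nhds t. \<nu> (of_real s) \<in> ball (\<nu> t) e2"
      by (auto dest!: tendstoD[OF _ p2(1)] simp: dist_commute)
    have "((\<lambda>s::real. \<psi>2 (\<nu> s)) \<longlongrightarrow> \<psi>2 (\<nu> t)) (nhds t)"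
      using isCont_tendsto_compose[OF isC2 \<open>((\<lambda>s::real. \<nu> s) \<longlongrightarrow> \<nu> t) (nhds t)\<close>] .
    then have ev2: "\<forall>\<^sub>F s in nhds t. \<psi>2 (\<nu> (of_real s)) \<in> ball z1 \<delta>1"
      using p2(4) by (auto dest!: tendstoD[OF _ p1(2)] simp: dist_commute)
    have "\<forall>\<^sub>F s in nhds t. s \<in> K" using ev1 ev2
    proof eventually_elim
      case (elim s)
      have ns: "norm (\<nu> s) = 1" "norm (\<mu> s) = 1" "\<mu> s * \<nu> s = 1" using real[of "of_real s"] by auto
      then have inn: "\<nu> s \<in> neg.inner_pts h" and eh: "neg.ext h (\<nu> s) = \<psi>2 (\<nu> s)"
        using p2(5,6) elim by auto
      define z where "z = neg.ext h (\<nu> s)"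
      have "neg.A z = \<nu> s * neg.B z" using neg.ext_tendsto(3)[OF h(1), of "\<nu> s"] inn by (simp add: z_def)
      then have "\<mu> s * B z = (\<mu> s * \<nu> s) * A z" by (simp add: negA negB)
      then have "A z = \<mu> s * B z" using ns by simp
      moreover have "B z \<noteq> 0" "A z / B z \<in> ball (\<mu> t) e1" "\<psi>1 (A z / B z) = z"
        using p1(7)[of z] elim(2) eh by (auto simp: z_def)
      ultimately have "\<mu> s \<in> ball (\<mu> t) e1" "\<psi>1 (\<mu> s) = z" by auto
      then have "ext g (\<mu> s) = z" using p1(5) ns by auto
      then show ?case using inn by (simp add: K_def z_def)
    qed
    then show "\<exists>T. open T \<and> t \<in> T \<and> T \<subseteq> K" unfolding eventually_nhds by blast
  qed
  moreover have "closed K"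
    unfolding closed_limpt
  proof safe
    fix t assume t: "t islimpt K"
    let ?Fl = "at t within K"
    have nb: "?Fl \<noteq> bot" using t by (simp add: trivial_limit_within)
    have n1: "norm (\<mu> t) = 1" "norm (\<nu> t) = 1" using real[of "of_real t"] by auto
    \<comment> \<open>A limit of \<open>h\<close> at \<open>\<nu> t\<close> exists in any case.
      Along \<open>K\<close> it is approached by the values of \<open>ext g\<close>, which are
      continuous at \<open>t\<close>; so it equals a point of the upper half-plane and is neither
      real nor infinite.\<close>
    obtain E where E: "E = at_infinity \<or> (\<exists>z. E = nhds z)" "filterlim h E (at (\<nu> t) within ball 0 1)"
      using neg.limit_exists[OF neg.branchD(2,4)[OF h(1)], of "\<nu> t"] by blast
    have limh: "filterlim (neg.ext h) E (at (\<nu> t) within neg.inner_pts h)"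
      by (rule filterlim_boundary_values[OF E neg.ext_tendsto(1)[OF h(1)] neg.at_within_disc_nonbot])
         (auto simp: neg.inner_pts_def)
    have "filterlim (\<lambda>s::real. \<nu> s) (at (\<nu> t) within neg.inner_pts h) ?Fl"
      unfolding filterlim_at
    proof
      have "isCont (\<lambda>t::real. \<nu> t) t" using cont_real(2) by (simp add: continuous_on_eq_continuous_at)
      then show "((\<lambda>s::real. \<nu> s) \<longlongrightarrow> \<nu> t) ?Fl"
        using continuous_at_imp_continuous_at_within continuous_within by blast
      have inj: "\<nu> (of_real s) \<noteq> \<nu> (of_real t)" if "s \<noteq> t" for s
        using that nz(2)[of "of_real s"] nz(2)[of "of_real t"] u1nz by (auto simp: \<nu>_def field_simps)
      show "\<forall>\<^sub>F s in ?Fl. \<nu> (of_real s) \<in> neg.inner_pts h \<and> \<nu> (of_real s) \<noteq> \<nu> (of_real t)"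
        unfolding eventually_at_filter using inj by (auto simp: K_def)
    qed
    then have "filterlim (\<lambda>s::real. neg.ext h (\<nu> s)) E ?Fl"
      by (rule filterlim_compose[OF limh])
    moreover have "\<forall>\<^sub>F s in ?Fl. neg.ext h (\<nu> (of_real s)) = ext g (\<mu> (of_real s))"
      by (auto simp: eventually_at_filter K_def)
    ultimately have limE: "filterlim (\<lambda>s::real. ext g (\<mu> s)) E ?Fl"
      using filterlim_cong[OF refl refl, of "\<lambda>s::real. neg.ext h (\<nu> s)" "\<lambda>s::real. ext g (\<mu> s)" ?Fl E] by blast
    define z1 where "z1 = ext g (\<mu> t)"
    have "isCont (\<lambda>s::real. ext g (\<mu> s)) t" using cont_real(3) by (simp add: continuous_on_eq_continuous_at)
    then have lim1: "((\<lambda>s::real. ext g (\<mu> s)) \<longlongrightarrow> z1) ?Fl"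
      unfolding z1_def using continuous_at_imp_continuous_at_within continuous_within by blast
    then have "E = nhds z1"
      using E(1) limE tendsto_unique[OF nb lim1] not_tendsto_and_filterlim_at_infinity[OF nb lim1] by blast
    then have "(h \<longlongrightarrow> z1) (at (\<nu> t) within ball 0 1)" using E(2) by simp
    moreover have "Im z1 > 0" using ext_tendsto(2)[OF g] mu_inner[of "of_real t"] by (simp add: z1_def)
    ultimately show "t \<in> K" using n1(2) neg.ext_eqI[of h z1 "\<nu> t"]
      by (auto simp: K_def neg.inner_pts_def z1_def)
  qed
  ultimately have "K = UNIV" using \<open>0 \<in> K\<close> clopen[of K] by blast
  then have nu_inner: "\<nu> t \<in> neg.inner_pts h" and agree: "neg.ext h (\<nu> t) = ext g (\<mu> t)" if "Im t = 0" for t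
  proof -
    have "t = of_real (Re t)" using that by (simp add: complex_eq_iff)
    moreover have "Re t \<in> K" using \<open>K = UNIV\<close> by simp
    ultimately show "\<nu> t \<in> neg.inner_pts h" "neg.ext h (\<nu> t) = ext g (\<mu> t)" by (auto simp: K_def)
  qed
  define s where "s t = (if Im t \<ge> 0 then ext g (\<mu> t) else neg.ext h (\<nu> t))" for t
  have conth: "continuous_on {t. Im t \<le> 0} (\<lambda>t. neg.ext h (\<nu> t))"
    by (rule continuous_on_compose2[OF neg.continuous_on_ext[OF h(1)] contnu])
       (use nu_disc nu_inner in \<open>force simp: le_less\<close>)
  have conts: "continuous_on UNIV s"
  proof -
    have "continuous_on ({t. Im t \<ge> 0} \<union> {t. Im t \<le> 0}) (\<lambda>t. if Im t \<ge> 0 then ext g (\<mu> t) else neg.ext h (\<nu> t))"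
      by (rule continuous_on_cases[OF _ _ contg conth])
         (use agree in \<open>auto simp: closed_halfspace_Im_ge closed_halfspace_Im_le\<close>)
    moreover have "{t. Im t \<ge> 0} \<union> {t. Im t \<le> 0} = UNIV" by auto
    ultimately show ?thesis unfolding s_def[abs_def] by simp
  qed
  have pos: "Im (s t) > 0" for t
  proof (cases "Im t \<ge> 0")
    case True
    then have "\<mu> t \<in> ball 0 1 \<union> inner_pts g" using mu_disc mu_inner by (cases "Im t = 0") auto
    then show ?thesis using ext_tendsto(2)[OF g] True by (simp add: s_def)
  next
    case False
    then show ?thesis using neg.ext_tendsto(2)[OF h(1), of "\<nu> t"] nu_disc[of t] by (simp add: s_def)
  qed
  \<comment> \<open>Continuity across the real line suffices for holomorphy, as in the proof of the
    reflection principle.\<close>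
  have "s holomorphic_on UNIV"
  proof (rule holomorphic_on_paste_across_line[where d = \<i> and k = 0])
    have "(\<lambda>t. h (\<nu> t)) holomorphic_on {t. Im t < 0}"
      by (rule holomorphic_on_compose_gen[OF _ neg.branchD(1)[OF h(1)], unfolded o_def])
         (use nu_disc nz(2) in \<open>auto simp: \<nu>_def[abs_def] intro!: holomorphic_intros\<close>)
    then have "s holomorphic_on {t. Im t < 0}"
      by (rule holomorphic_transform) (use nu_disc neg.ext_inside[OF h(1)] in \<open>auto simp: s_def\<close>)
    then show "s holomorphic_on (UNIV \<inter> {z. \<i> \<bullet> z < 0})" by (simp add: inner_complex_def)
    have "(\<lambda>t. g (\<mu> t)) holomorphic_on {t. Im t > 0}"
      by (rule holomorphic_on_compose_gen[OF _ branchD(1)[OF g], unfolded o_def])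
         (use mu_disc nz(1) in \<open>auto simp: \<mu>_def[abs_def] intro!: holomorphic_intros\<close>)
    then have "s holomorphic_on {t. Im t > 0}"
      by (rule holomorphic_transform) (use mu_disc ext_inside[OF g] in \<open>auto simp: s_def\<close>)
    then show "s holomorphic_on (UNIV \<inter> {z. 0 < \<i> \<bullet> z})" by (simp add: inner_complex_def)
  qed (use conts in auto)
  moreover have nzs: "s t + \<i> \<noteq> 0" for t using pos[of t] by (auto simp: complex_eq_iff)
  \<comment> \<open>Since \<open>s\<close> takes values in the upper half-plane, this function is
    bounded by \<open>1\<close>, which brings Liouville into play.\<close>
  ultimately have "(\<lambda>t. 1 / (s t + \<i>)) holomorphic_on UNIV" by (intro holomorphic_intros) auto
  moreover have "bounded (range (\<lambda>t. 1 / (s t + \<i>)))"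
  proof -
    have "norm (1 / (s t + \<i>)) \<le> 1" for t
    proof -
      have "1 \<le> \<bar>Im (s t + \<i>)\<bar>" using pos[of t] by simp
      also have "\<dots> \<le> norm (s t + \<i>)" by (rule abs_Im_le_cmod)
      finally show ?thesis by (simp add: norm_divide divide_le_eq_1)
    qed
    then show ?thesis unfolding bounded_iff by blast
  qed
  ultimately have "(\<lambda>t. 1 / (s t + \<i>)) constant_on UNIV" by (rule Liouville_theorem)
  then obtain c where c: "\<And>t. 1 / (s t + \<i>) = c" unfolding constant_on_def by auto
  have eq: "s \<i> = s 0" using c[of \<i>] c[of 0] nzs[of \<i>] nzs[of 0]
    by (metis add_right_cancel divide_divide_eq_right mult_1 nonzero_eq_divide_eq)
  \<comment> \<open>A constant \<open>s\<close> contradicts that \<open>W\<close> recovers the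
    parameter: its values at \<open>s 0\<close> and \<open>s \<i>\<close> are \<open>- u1\<close>
    and \<open>0\<close>.\<close>
  have "A (s t) = \<mu> t * B (s t)" if "t \<in> {0, \<i>}" for t
    using ext_tendsto(3)[OF g, of "\<mu> t"] mu_disc[of t] mu_inner[of t] that by (auto simp: s_def)
  then have "A (s 0) = \<mu> 0 * B (s 0)" "A (s 0) = \<mu> \<i> * B (s 0)" using eq by (metis insertCI)+
  then have "\<mu> 0 = \<mu> \<i>" using B_nz[of "s 0" "\<mu> 0"] by auto
  then show False using u1nz by (simp add: \<mu>_def)
qed

end

subsection \<open>Components of the real locus are curves\<close>

lemma end_filter_compact:
  assumes "end_filter E" "compact K" "K \<subseteq> {z. Im z > 0}"
  shows "\<forall>\<^sub>F z in E. z \<notin> K"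
  using assms(1) unfolding end_filter_def
proof
  assume E: "E = at_infinity"
  obtain b where "\<And>z. z \<in> K \<Longrightarrow> norm z \<le> b"
    using compact_imp_bounded[OF assms(2)] unfolding bounded_iff by blast
  then show ?thesis unfolding E eventually_at_infinity by (intro exI[of _ "b + 1"]) force
next
  assume "\<exists>a::real. E = nhds (of_real a)"
  then obtain a :: real where E: "E = nhds (of_real a)" by blast
  have "open (- K)" using compact_imp_closed[OF assms(2)] by (rule open_Compl)
  moreover have "of_real a \<in> - K" using assms(3) by auto
  ultimately show ?thesis unfolding E eventually_nhds by blast
qed

lemma end_filter_separate:
  assumes "end_filter E" "end_filter E'" "E \<noteq> E'"
  obtains U V where "\<forall>\<^sub>F z in E. z \<in> U" "\<forall>\<^sub>F z in E'. z \<in> V" "U \<inter> V = {}"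
proof -
  have fin: "\<exists>U V. (\<forall>\<^sub>F z in nhds a. z \<in> U) \<and> (\<forall>\<^sub>F z in at_infinity. z \<in> V) \<and> U \<inter> V = {}" for a :: complex
  proof (intro exI conjI)
    show "\<forall>\<^sub>F z in nhds a. z \<in> ball a 1" by (intro eventually_nhds_in_open) auto
    show "\<forall>\<^sub>F z in at_infinity. z \<in> {z. norm z \<ge> norm a + 1}"
      unfolding eventually_at_infinity by (intro exI[of _ "norm a + 1"]) auto
    have "norm z < norm a + 1" if "dist a z < 1" for z
      using that norm_triangle_sub[of z a] by (simp add: dist_norm norm_minus_commute)
    then show "ball a 1 \<inter> {z. norm z \<ge> norm a + 1} = {}" by force
  qed
  have two: "\<exists>U V. (\<forall>\<^sub>F z in nhds a. z \<in> U) \<and> (\<forall>\<^sub>F z in nhds b. z \<in> V) \<and> U \<inter> V = {}" if "a \<noteq> b" for a b :: complex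
    using hausdorff[OF that] eventually_nhds_in_open by metis
  have "\<exists>U V. (\<forall>\<^sub>F z in E. z \<in> U) \<and> (\<forall>\<^sub>F z in E'. z \<in> V) \<and> U \<inter> V = {}"
    using assms fin two unfolding end_filter_def by (metis Int_commute)
  then show ?thesis using that by blast
qed

lemma simple_curve_in_H_commute:
  assumes "simple_curve_in_H E E' C"
  shows "simple_curve_in_H E' E C"
proof -
  obtain \<gamma> :: "real \<Rightarrow> complex" where \<gamma>: "continuous_on {0<..<1} \<gamma>" "inj_on \<gamma> {0<..<1}" "C = \<gamma> ` {0<..<1}"
    "filterlim \<gamma> E (at_right 0)" "filterlim \<gamma> E' (at_left 1)"
    using assms unfolding simple_curve_in_H_def by blast
  let ?r = "\<lambda>t::real. 1 - t"
  have img: "?r ` {0<..<1} = {0<..<1}" by (auto simp: image_iff intro!: bexI[of _ "1 - _"])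
  have "continuous_on {0<..<1} (\<lambda>t. \<gamma> (?r t))"
    by (rule continuous_on_compose2[OF \<gamma>(1)]) (auto intro!: continuous_intros)
  moreover have "inj_on (\<lambda>t. \<gamma> (?r t)) {0<..<1}"
  proof (rule inj_onI)
    fix s t :: real assume *: "s \<in> {0<..<1}" "t \<in> {0<..<1}" "\<gamma> (1 - s) = \<gamma> (1 - t)"
    then have "1 - s = 1 - t" by (intro inj_onD[OF \<gamma>(2)]) auto
    then show "s = t" by simp
  qed
  moreover have "C = (\<lambda>t. \<gamma> (?r t)) ` {0<..<1}"
    using img \<gamma>(3) by (metis image_image)
  moreover have "filterlim (\<lambda>t. \<gamma> (?r t)) E' (at_right 0)"
  proof (rule filterlim_compose[OF \<gamma>(5)])
    show "filterlim ?r (at_left 1) (at_right 0)"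
      unfolding filterlim_at by (auto intro!: tendsto_eq_intros simp: eventually_at_filter)
  qed
  moreover have "filterlim (\<lambda>t. \<gamma> (?r t)) E (at_left 1)"
  proof (rule filterlim_compose[OF \<gamma>(4)])
    show "filterlim ?r (at_right 0) (at_left 1)"
      unfolding filterlim_at by (auto intro!: tendsto_eq_intros simp: eventually_at_filter)
  qed
  ultimately show ?thesis using assms unfolding simple_curve_in_H_def by blast
qed

lemma compact_curve_part:
  fixes \<gamma> :: "real \<Rightarrow> complex"
  assumes "continuous_on {0<..<1} \<gamma>" "\<gamma> ` {0<..<1} \<subseteq> H" "0 < a" "b < 1"
  shows "compact (\<gamma> ` {a..b})" "\<gamma> ` {a..b} \<subseteq> H"
proof -
  have *: "{a..b} \<subseteq> {0<..<1}" using assms by auto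
  show "compact (\<gamma> ` {a..b})"
    by (rule compact_continuous_image[OF continuous_on_subset[OF assms(1) *]]) simp
  show "\<gamma> ` {a..b} \<subseteq> H" using assms(2) * by blast
qed

text \<open>A compact disc in the half-plane is eventually avoided by both ends, so only a compact
  middle piece of the curve can meet it.\<close>

lemma curve_closedin:
  assumes "simple_curve_in_H E E' C" "end_filter E" "end_filter E'"
  shows "closedin (top_of_set {z. Im z > 0}) C"
proof -
  let ?H = "{z. Im z > 0}"
  obtain \<gamma> :: "real \<Rightarrow> complex" where \<gamma>: "continuous_on {0<..<1} \<gamma>" "C = \<gamma> ` {0<..<1}"
    "filterlim \<gamma> E (at_right 0)" "filterlim \<gamma> E' (at_left 1)" and CH: "C \<subseteq> ?H"
    using assms(1) unfolding simple_curve_in_H_def by blast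
  have "openin (top_of_set ?H) (?H - C)"
    unfolding openin_subopen[of _ "?H - C"]
  proof
    fix z assume z: "z \<in> ?H - C"
    have "open ?H" by (rule open_halfspace_Im_gt)
    then obtain r where r: "r > 0" "cball z r \<subseteq> ?H" using z open_contains_cball by (metis DiffD1)
    have "\<forall>\<^sub>F t in at_right 0. \<gamma> t \<notin> cball z r"
      using end_filter_compact[OF assms(2) compact_cball r(2)] \<gamma>(3) by (rule eventually_compose_filterlim)
    then obtain a where a: "a > 0" "\<And>t. 0 < t \<Longrightarrow> t < a \<Longrightarrow> \<gamma> t \<notin> cball z r"
      unfolding eventually_at_right_field by auto
    have "\<forall>\<^sub>F t in at_left 1. \<gamma> t \<notin> cball z r"
      using end_filter_compact[OF assms(3) compact_cball r(2)] \<gamma>(4) by (rule eventually_compose_filterlim)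
    then obtain b where b: "b < 1" "\<And>t. b < t \<Longrightarrow> t < 1 \<Longrightarrow> \<gamma> t \<notin> cball z r"
      unfolding eventually_at_left_field by auto
    have comp: "compact (\<gamma> ` {a..b})" using compact_curve_part[OF \<gamma>(1) _ a(1) b(1)] CH \<gamma>(2) by blast
    have sub: "\<gamma> ` {a..b} \<subseteq> C" using a b by (auto simp: \<gamma>(2))
    let ?T = "ball z r - \<gamma> ` {a..b}"
    have "open ?T" using compact_imp_closed[OF comp] by (intro open_Diff) auto
    moreover have "?T \<subseteq> ?H - C"
    proof
      fix y assume y: "y \<in> ?T"
      then have "y \<in> cball z r" by auto
      moreover have "y \<notin> C"
      proof
        assume "y \<in> C"
        then obtain t where t: "0 < t" "t < 1" "y = \<gamma> t" by (auto simp: \<gamma>(2))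
        then have "t \<in> {a..b}" using a(2)[of t] b(2)[of t] \<open>y \<in> cball z r\<close> by force
        then show False using y t by blast
      qed
      ultimately show "y \<in> ?H - C" using r by blast
    qed
    moreover have "z \<in> ?T" using z sub r by auto
    ultimately show "\<exists>T. openin (top_of_set ?H) T \<and> z \<in> T \<and> T \<subseteq> ?H - C"
      using open_subset by (metis Diff_subset subset_trans)
  qed
  then show ?thesis using CH by (simp add: closedin_def)
qed

text \<open>Near \<open>E'\<close> only the final stretch of the curve is visible: the initial
  stretch is close to the different end \<open>E\<close>, and what lies between is compact in the
  half-plane.\<close>

lemma curve_tail:
  fixes \<gamma> :: "real \<Rightarrow> complex"
  assumes "continuous_on {0<..<1} \<gamma>" "\<gamma> ` {0<..<1} \<subseteq> {z. Im z > 0}"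
    "filterlim \<gamma> E (at_right 0)" "end_filter E" "end_filter E'" "E \<noteq> E'" "b < 1"
  shows "\<forall>\<^sub>F z in E'. z \<notin> \<gamma> ` {0<..b}"
proof -
  obtain U V where UV: "\<forall>\<^sub>F z in E. z \<in> U" "\<forall>\<^sub>F z in E'. z \<in> V" "U \<inter> V = {}"
    by (rule end_filter_separate[OF assms(4,5,6)])
  have "\<forall>\<^sub>F t in at_right 0. \<gamma> t \<in> U" using UV(1) assms(3) by (rule eventually_compose_filterlim)
  then obtain a where a: "a > 0" "\<And>t. 0 < t \<Longrightarrow> t < a \<Longrightarrow> \<gamma> t \<in> U"
    unfolding eventually_at_right_field by auto
  have "\<forall>\<^sub>F z in E'. z \<notin> \<gamma> ` {a..b}"
    by (intro end_filter_compact assms(5) compact_curve_part[OF assms(1,2) a(1) assms(7)])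
  with UV(2) show ?thesis
  proof eventually_elim
    case (elim z)
    show ?case
    proof
      assume "z \<in> \<gamma> ` {0<..b}"
      then obtain t where t: "0 < t" "t \<le> b" "z = \<gamma> t" by auto
      then show False using a(2)[of t] elim UV(3) by (cases "t < a") auto
    qed
  qed
qed

lemma curve_ends:
  assumes "simple_curve_in_H E E' C" "end_filter E" "end_filter E'" "end_filter D"
    "\<exists>\<^sub>F z in D. z \<in> C"
  shows "D = E \<or> D = E'"
proof (rule ccontr)
  assume contr: "\<not> (D = E \<or> D = E')"
  obtain \<gamma> :: "real \<Rightarrow> complex" where \<gamma>: "continuous_on {0<..<1} \<gamma>" "C = \<gamma> ` {0<..<1}"
    "filterlim \<gamma> E (at_right 0)" "filterlim \<gamma> E' (at_left 1)" and CH: "C \<subseteq> {z. Im z > 0}"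
    using assms(1) unfolding simple_curve_in_H_def by blast
  obtain U V where UV: "\<forall>\<^sub>F z in E'. z \<in> U" "\<forall>\<^sub>F z in D. z \<in> V" "U \<inter> V = {}"
    using end_filter_separate[OF assms(3,4)] contr by metis
  have "\<forall>\<^sub>F t in at_left 1. \<gamma> t \<in> U" using UV(1) \<gamma>(4) by (rule eventually_compose_filterlim)
  then obtain b where b: "b < 1" "\<And>t. b < t \<Longrightarrow> t < 1 \<Longrightarrow> \<gamma> t \<in> U"
    unfolding eventually_at_left_field by auto
  have "\<forall>\<^sub>F z in D. z \<notin> \<gamma> ` {0<..b}"
    using curve_tail[OF \<gamma>(1) _ \<gamma>(3) assms(2,4) _ b(1)] CH \<gamma>(2) contr by blast
  with UV(2) have "\<forall>\<^sub>F z in D. z \<notin> C"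
  proof eventually_elim
    case (elim z)
    show ?case
    proof
      assume "z \<in> C"
      then obtain t where t: "0 < t" "t < 1" "z = \<gamma> t" by (auto simp: \<gamma>(2))
      then show False using b(2)[of t] elim UV(3) by (cases "t \<le> b") auto
    qed
  qed
  then show False using assms(5) by (simp add: frequently_def)
qed

lemma curve_end_frequently:
  assumes "simple_curve_in_H E E' C"
  shows "\<exists>\<^sub>F z in E'. z \<in> C"
proof -
  obtain \<gamma> :: "real \<Rightarrow> complex" where \<gamma>: "C = \<gamma> ` {0<..<1}" "filterlim \<gamma> E' (at_left 1)"
    using assms(1) unfolding simple_curve_in_H_def by blast
  have "\<not> (\<forall>\<^sub>F z in E'. z \<notin> C)"
  proof
    assume "\<forall>\<^sub>F z in E'. z \<notin> C"
    then have "\<forall>\<^sub>F t in at_left 1. \<gamma> t \<notin> C" using \<gamma>(2) by (rule eventually_compose_filterlim)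
    then obtain b where b: "b < 1" "\<And>t. b < t \<Longrightarrow> t < 1 \<Longrightarrow> \<gamma> t \<notin> C"
      unfolding eventually_at_left_field by auto
    obtain t where "max b 0 < t" "t < 1" using dense[of "max b 0" 1] b(1) by auto
    then show False using b(2)[of t] by (auto simp: \<gamma>(1))
  qed
  then show ?thesis by (simp add: frequently_def)
qed

section \<open>Angles on the circle and components as images of arcs\<close>

lemma cis_inj_less_2pi:
  assumes "cis a = cis b" "\<bar>a - b\<bar> < 2 * pi"
  shows "a = b"
proof -
  have "cis (a - b) = 1" using assms(1) by (simp add: cis_divide[symmetric])
  then have "cos (a - b) = 1" by (simp add: complex_eq_iff)
  then obtain k :: int where k: "a - b = k * 2 * pi" using cos_one_2pi_int by auto
  then have "\<bar>real_of_int k\<bar> * (2 * pi) < 1 * (2 * pi)" using assms(2) by (simp add: abs_mult)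
  then have "\<bar>real_of_int k\<bar> < 1" by (simp only: mult_less_cancel_right_disj) auto
  then have "k = 0" by linarith
  then show ?thesis using k by simp
qed

lemma cis_surj_interval:
  assumes "norm u = 1"
  obtains \<theta> where "a \<le> \<theta>" "\<theta> < a + 2 * pi" "cis \<theta> = u"
proof -
  define v where "v = u / cis a"
  have v: "norm v = 1" using assms by (simp add: v_def norm_divide)
  have "cis (Arg2pi v) = v"
    using v complex_norm_eq_1_exp[of v] by (simp add: cis_conv_exp)
  then have "cis (a + Arg2pi v) = u" by (simp add: cis_mult[symmetric] v_def)
  moreover have "0 \<le> Arg2pi v" "Arg2pi v < 2 * pi" using Arg2pi by auto
  ultimately show ?thesis using that[of "a + Arg2pi v"] by simp
qed

context real_pair
begin

text \<open>The curve is traced over the maximal interval of angles around \<open>\<theta>0\<close>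
  with boundary values in the half-plane. By maximality both ends leave the half-plane, so the image
  is relatively closed in \<open>L\<close>; local inverses make it relatively open. Being connected,
  it is the whole component.\<close>

lemma component_is_curve:
  assumes C: "C \<in> components L"
  obtains E E' where "end_filter E" "end_filter E'" "E \<noteq> E'" "simple_curve_in_H E E' C"
proof -
  obtain z0 where z0: "z0 \<in> C" "z0 \<in> L" using C in_components_nonempty in_components_subset by blast
  define u0 where "u0 = A z0 / B z0"
  have Im0: "Im z0 > 0" and nAB: "norm (A z0) = norm (B z0)" using z0 by (auto simp: L_def F_eq_0_iff)
  then have Bz: "B z0 \<noteq> 0" using A_B_not_both_0[of z0] by auto
  then have nu0: "norm u0 = 1" using nAB by (simp add: u0_def norm_divide)
  obtain g where g: "branch g" "(g \<longlongrightarrow> z0) (at u0 within ball 0 1)"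
    using branch_at[OF z0(2)] unfolding u0_def by blast
  have u0in: "u0 \<in> inner_pts g" using nu0 g(2) Im0 by (auto simp: inner_pts_def)
  have ext0: "ext g u0 = z0" using ext_eqI g(2) nu0 by simp
  obtain \<theta>0 where \<theta>0: "cis \<theta>0 = u0" using cis_surj_interval[OF nu0] by metis
  define J where "J = {\<theta>. cis \<theta> \<in> inner_pts g}"
  have ccis: "continuous_on S cis" for S by (intro continuous_intros)
  have "open J"
  proof (subst open_subopen, rule ballI)
    fix \<theta> assume "\<theta> \<in> J"
    then have th: "cis \<theta> \<in> ball 0 1 \<union> inner_pts g" by (simp add: J_def)
    note et = ext_tendsto[OF g(1) th]
    obtain e \<delta> \<psi> where loc: "e > 0" "\<delta> > 0" "\<psi> holomorphic_on ball (cis \<theta>) e" "\<psi> (cis \<theta>) = ext g (cis \<theta>)"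
      "\<And>u. u \<in> ball (cis \<theta>) e \<Longrightarrow> norm u \<le> 1 \<Longrightarrow> ext g u = \<psi> u"
      "\<And>u. u \<in> ball (cis \<theta>) e \<Longrightarrow> norm u = 1 \<Longrightarrow> u \<in> inner_pts g"
      "\<And>z. z \<in> ball (ext g (cis \<theta>)) \<delta> \<Longrightarrow> B z \<noteq> 0 \<and> A z / B z \<in> ball (cis \<theta>) e \<and> \<psi> (A z / B z) = z"
      by (rule branch_local[OF g(1) norm_cis et(2) et(1)]) (rule that)
    have "open (cis -` ball (cis \<theta>) e)" by (intro open_vimage ccis) auto
    moreover have "\<theta> \<in> cis -` ball (cis \<theta>) e" using loc(1) by simp
    moreover have "cis -` ball (cis \<theta>) e \<subseteq> J" using loc(6) by (auto simp: J_def)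
    ultimately show "\<exists>T. open T \<and> \<theta> \<in> T \<and> T \<subseteq> J" by blast
  qed
  \<comment> \<open>Two omitted points are required: with a single one the arc could be the circle
    minus that point, and \<open>W\<close> would have the same value at both ends.\<close>
  obtain v1 where v1: "norm v1 = 1" "v1 \<notin> inner_pts g" using outer_pt_exists[OF g(1), of 1] by auto
  obtain v2 where v2: "norm v2 = 1" "v2 \<noteq> v1" "v2 \<notin> inner_pts g" using outer_pt_exists[OF g(1) v1(1)] by auto
  obtain \<theta>1 where \<theta>1: "\<theta>0 \<le> \<theta>1" "\<theta>1 < \<theta>0 + 2 * pi" "cis \<theta>1 = v1" by (rule cis_surj_interval[OF v1(1)])
  obtain \<theta>2 where \<theta>2: "\<theta>0 \<le> \<theta>2" "\<theta>2 < \<theta>0 + 2 * pi" "cis \<theta>2 = v2" by (rule cis_surj_interval[OF v2(1)])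
  have period: "cis (\<theta> - 2 * pi) = cis \<theta>" for \<theta> by (simp add: cis_divide[symmetric])
  have notJ: "\<theta>1 \<notin> J" "\<theta>2 \<notin> J" "\<theta>1 - 2 * pi \<notin> J" "\<theta>2 - 2 * pi \<notin> J"
    using v1 v2 \<theta>1 \<theta>2 by (auto simp: J_def period)
  \<comment> \<open>\<open>\<beta>\<close> and \<open>\<alpha>\<close> are the nearest angles
    outside \<open>J\<close> above and below \<open>\<theta>0\<close>; they are attained because
    \<open>J\<close> is open.\<close>
  define \<beta> where "\<beta> = Inf ({\<theta>0..} - J)"
  define \<alpha> where "\<alpha> = Sup ({..\<theta>0} - J)"
  have bdd: "bdd_below ({\<theta>0..} - J)" "bdd_above ({..\<theta>0} - J)" by (auto intro: bdd_belowI bdd_aboveI)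
  have ne: "\<theta>1 \<in> {\<theta>0..} - J" "\<theta>2 \<in> {\<theta>0..} - J" "\<theta>1 - 2 * pi \<in> {..\<theta>0} - J" "\<theta>2 - 2 * pi \<in> {..\<theta>0} - J"
    using notJ \<theta>1 \<theta>2 by auto
  have "\<beta> \<in> {\<theta>0..} - J" unfolding \<beta>_def
    by (rule closed_contains_Inf) (use bdd ne \<open>open J\<close> in \<open>auto intro!: closed_Diff\<close>)
  then have \<beta>: "\<theta>0 \<le> \<beta>" "\<beta> \<notin> J" by auto
  have "\<alpha> \<in> {..\<theta>0} - J" unfolding \<alpha>_def
    by (rule closed_contains_Sup) (use bdd ne \<open>open J\<close> in \<open>auto intro!: closed_Diff\<close>)
  then have \<alpha>: "\<alpha> \<le> \<theta>0" "\<alpha> \<notin> J" by auto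
  have "\<theta>0 \<in> J" using u0in \<theta>0 by (simp add: J_def)
  then have ord: "\<alpha> < \<theta>0" "\<theta>0 < \<beta>" using \<alpha> \<beta> by (auto simp: less_le)
  \<comment> \<open>The angles of the omitted points bound \<open>\<beta>\<close> from above, and
    shifted down by one period they bound \<open>\<alpha>\<close> from below. As the two angles
    differ, the length is strictly below \<open>2 * pi\<close>, so \<open>cis\<close> is injective
    even on the closed interval.\<close>
  have "\<beta> \<le> \<theta>1" "\<beta> \<le> \<theta>2" unfolding \<beta>_def by (rule cInf_lower[OF _ bdd(1)], fact)+
  moreover have "\<theta>1 - 2 * pi \<le> \<alpha>" "\<theta>2 - 2 * pi \<le> \<alpha>" unfolding \<alpha>_def by (rule cSup_upper[OF _ bdd(2)], fact)+
  moreover have "\<theta>1 \<noteq> \<theta>2" using \<theta>1 \<theta>2 v2 by auto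
  ultimately have len: "\<beta> - \<alpha> < 2 * pi" by linarith
  have inJ: "\<theta> \<in> J" if "\<alpha> < \<theta>" "\<theta> < \<beta>" for \<theta>
  proof (rule ccontr)
    assume "\<theta> \<notin> J"
    show False
    proof (cases "\<theta> \<ge> \<theta>0")
      case True
      then have "\<beta> \<le> \<theta>" unfolding \<beta>_def using \<open>\<theta> \<notin> J\<close> by (intro cInf_lower bdd) auto
      then show False using that by simp
    next
      case False
      then have "\<theta> \<le> \<alpha>" unfolding \<alpha>_def using \<open>\<theta> \<notin> J\<close> by (intro cSup_upper bdd) auto
      then show False using that by simp
    qed
  qed
  define \<tau> where "\<tau> t = \<alpha> + t * (\<beta> - \<alpha>)" for t
  define \<gamma> where "\<gamma> t = ext g (cis (\<tau> t))" for t
  have ab: "\<beta> - \<alpha> > 0" using ord by simp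
  have \<tau>: "\<alpha> < \<tau> t" "\<tau> t < \<beta>" if "t \<in> {0<..<1}" for t
  proof -
    have "0 < t * (\<beta> - \<alpha>)" "t * (\<beta> - \<alpha>) < 1 * (\<beta> - \<alpha>)"
      using that ab by (auto intro!: mult_strict_right_mono)
    then show "\<alpha> < \<tau> t" "\<tau> t < \<beta>" by (auto simp: \<tau>_def)
  qed
  have \<tau>_surj: "\<theta> \<in> \<tau> ` {0<..<1}" if "\<alpha> < \<theta>" "\<theta> < \<beta>" for \<theta>
    using that ab by (intro image_eqI[of _ _ "(\<theta> - \<alpha>) / (\<beta> - \<alpha>)"]) (auto simp: \<tau>_def field_simps)
  have inner: "cis (\<tau> t) \<in> inner_pts g" if "t \<in> {0<..<1}" for t
    using inJ[OF \<tau>[OF that]] by (simp add: J_def)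
  have \<gamma>L: "\<gamma> t \<in> L" if "t \<in> {0<..<1}" for t using ext_L[OF g(1) inner[OF that]] by (simp add: \<gamma>_def)
  have \<gamma>rel: "A (\<gamma> t) = cis (\<tau> t) * B (\<gamma> t)" if "t \<in> {0<..<1}" for t
    using ext_tendsto(3)[OF g(1), of "cis (\<tau> t)"] inner[OF that] by (simp add: \<gamma>_def)
  have cont\<tau>: "continuous_on S (\<lambda>t. cis (\<tau> t))" for S unfolding \<tau>_def by (intro continuous_intros)
  have cont: "continuous_on {0<..<1} \<gamma>"
    unfolding \<gamma>_def[abs_def]
    by (rule continuous_on_compose2[OF continuous_on_ext[OF g(1)] cont\<tau>]) (use inner in auto)
  have inj: "inj_on \<gamma> {0<..<1}"
  proof (rule inj_onI)
    fix s t assume st: "s \<in> {0<..<1}" "t \<in> {0<..<1}" "\<gamma> s = \<gamma> t"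
    then have "cis (\<tau> s) * B (\<gamma> t) = cis (\<tau> t) * B (\<gamma> t)" using \<gamma>rel[of s] \<gamma>rel[of t] by metis
    then have "cis (\<tau> s) = cis (\<tau> t)" using B_nz[OF \<gamma>rel[OF st(2)]] by simp
    moreover have "\<bar>\<tau> s - \<tau> t\<bar> < 2 * pi" using \<tau>[OF st(1)] \<tau>[OF st(2)] len by linarith
    ultimately have "\<tau> s = \<tau> t" by (rule cis_inj_less_2pi)
    then show "s = t" using ab by (simp add: \<tau>_def)
  qed
  have end_lim: "filterlim \<gamma> E (at s within {0<..<1})"
    if "filterlim g E (at (cis (\<tau> s)) within ball 0 1)" "cis (\<tau> s) \<notin> inner_pts g" "end_filter E" for s E
  proof -
    have "filterlim (ext g) E (at (cis (\<tau> s)) within inner_pts g)"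
      by (rule filterlim_boundary_values[OF _ that(1) ext_tendsto(1)[OF g(1)] at_within_disc_nonbot])
         (use that(3) in \<open>auto simp: inner_pts_def end_filter_def\<close>)
    moreover have "filterlim (\<lambda>t. cis (\<tau> t)) (at (cis (\<tau> s)) within inner_pts g) (at s within {0<..<1})"
      unfolding filterlim_at
    proof
      show "((\<lambda>t. cis (\<tau> t)) \<longlongrightarrow> cis (\<tau> s)) (at s within {0<..<1})"
        using cont\<tau>[of UNIV] by (meson UNIV_I continuous_on_def subset_UNIV tendsto_within_subset)
      show "\<forall>\<^sub>F t in at s within {0<..<1}. cis (\<tau> t) \<in> inner_pts g \<and> cis (\<tau> t) \<noteq> cis (\<tau> s)"
        unfolding eventually_at_filter using inner that(2) by (intro always_eventually) metis
    qed
    ultimately show ?thesis unfolding \<gamma>_def[abs_def] by (rule filterlim_compose)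
  qed
  have out: "cis \<alpha> \<notin> inner_pts g" "cis \<beta> \<notin> inner_pts g" using \<alpha> \<beta> by (auto simp: J_def)
  obtain E where E: "end_filter E" "filterlim g E (at (cis \<alpha>) within ball 0 1)"
    "\<And>a. E = nhds (of_real a) \<Longrightarrow> A (of_real a) = cis \<alpha> * B (of_real a)" "E = at_infinity \<Longrightarrow> cis \<alpha> = 1"
    by (rule branch_limit_cases[OF g(1) norm_cis out(1)]) (rule that)
  obtain E' where E': "end_filter E'" "filterlim g E' (at (cis \<beta>) within ball 0 1)"
    "\<And>a. E' = nhds (of_real a) \<Longrightarrow> A (of_real a) = cis \<beta> * B (of_real a)" "E' = at_infinity \<Longrightarrow> cis \<beta> = 1"
    by (rule branch_limit_cases[OF g(1) norm_cis out(2)]) (rule that)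
  have "cis \<alpha> \<noteq> cis \<beta>" using cis_inj_less_2pi[of \<alpha> \<beta>] len ord by auto
  have "E \<noteq> E'"
  proof
    assume eq: "E = E'"
    from E(1) consider "E = at_infinity" | a :: real where "E = nhds (of_real a)" by (auto simp: end_filter_def)
    then show False
    proof cases
      case 1 then show False using E(4) E'(4) eq \<open>cis \<alpha> \<noteq> cis \<beta>\<close> by simp
    next
      case 2
      then have "A (of_real a) = cis \<alpha> * B (of_real a)" "A (of_real a) = cis \<beta> * B (of_real a)"
        using E(3) E'(3) eq by auto
      then show False using B_nz[of "of_real a"] \<open>cis \<alpha> \<noteq> cis \<beta>\<close> by auto
    qed
  qed
  have \<tau>01: "\<tau> 0 = \<alpha>" "\<tau> 1 = \<beta>" by (auto simp: \<tau>_def)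
  have at01: "at_right (0::real) = at 0 within {0<..<1}" "at_left (1::real) = at 1 within {0<..<1}"
    by (rule at_within_nhd[of _ "{-1<..<1}"] at_within_nhd[of _ "{0<..<2}"]; auto)+
  have curve: "simple_curve_in_H E E' (\<gamma> ` {0<..<1})"
    unfolding simple_curve_in_H_def
  proof (intro conjI exI[of _ \<gamma>])
    show "\<gamma> ` {0<..<1} \<subseteq> {z. Im z > 0}" using \<gamma>L by (auto simp: L_def)
    show "filterlim \<gamma> E (at_right 0)" unfolding at01 by (rule end_lim) (use E out \<tau>01 in auto)
    show "filterlim \<gamma> E' (at_left 1)" unfolding at01 by (rule end_lim) (use E' out \<tau>01 in auto)
  qed (use cont inj in auto)
  let ?G = "\<gamma> ` {0<..<1}"
  have GL: "?G \<subseteq> L" using \<gamma>L by blast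
  have "closedin (top_of_set L) ?G"
    using closedin_subset_trans[OF curve_closedin[OF curve E(1) E'(1)] GL] by (auto simp: L_def)
  moreover have "openin (top_of_set L) ?G"
    unfolding openin_subopen[of _ ?G]
  proof
    fix z1 assume "z1 \<in> ?G"
    then obtain t1 where t1: "t1 \<in> {0<..<1}" "z1 = \<gamma> t1" by blast
    let ?u = "cis (\<tau> t1)"
    have in1: "?u \<in> ball 0 1 \<union> inner_pts g" using inner[OF t1(1)] by simp
    have z1: "z1 = ext g ?u" using t1 by (simp add: \<gamma>_def)
    obtain e \<delta> \<psi> where loc: "e > 0" "\<delta> > 0" "\<psi> holomorphic_on ball ?u e" "\<psi> ?u = z1"
      "\<And>u. u \<in> ball ?u e \<Longrightarrow> norm u \<le> 1 \<Longrightarrow> ext g u = \<psi> u"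
      "\<And>u. u \<in> ball ?u e \<Longrightarrow> norm u = 1 \<Longrightarrow> u \<in> inner_pts g"
      "\<And>z. z \<in> ball z1 \<delta> \<Longrightarrow> B z \<noteq> 0 \<and> A z / B z \<in> ball ?u e \<and> \<psi> (A z / B z) = z"
      by (rule branch_local[OF g(1) norm_cis ext_tendsto(2,1)[OF g(1) in1], folded z1]) (rule that)
    \<comment> \<open>Points of \<open>L\<close> near \<open>z1\<close> have a value of
      \<open>W\<close> whose angle differs from \<open>\<tau> t1\<close> by less than
      \<open>\<eta>\<close>; that angle therefore stays in the arc and is reached by the
      curve.\<close>
    define \<eta> where "\<eta> = min (\<tau> t1 - \<alpha>) (\<beta> - \<tau> t1)"
    have \<eta>: "\<eta> > 0" using \<tau>[OF t1(1)] by (simp add: \<eta>_def)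
    define a where "a z = Arg (A z / B z / ?u)" for z
    have Bz1: "B z1 \<noteq> 0" "A z1 / B z1 = ?u"
      using \<gamma>rel[OF t1(1)] B_nz[OF \<gamma>rel[OF t1(1)]] t1(2) by auto
    have "isCont (\<lambda>z. A z / B z / ?u) z1"
      using continuous_on_AB[of UNIV] Bz1 by (intro continuous_intros) (auto simp: continuous_on_eq_continuous_at)
    moreover have "isCont Arg 1" by (rule continuous_at_Arg) simp
    ultimately have "isCont a z1"
      unfolding a_def[abs_def] using Bz1 by (intro isCont_o2[of z1 _ Arg]) auto
    moreover have "a z1 = 0" using Bz1 by (simp add: a_def)
    ultimately have "(a \<longlongrightarrow> 0) (nhds z1)" by (metis isCont_def tendsto_nhds_iff)
    then have "\<forall>\<^sub>F z in nhds z1. \<bar>a z\<bar> < \<eta>" using \<eta> by (auto dest: tendstoD)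
    moreover have "\<forall>\<^sub>F z in nhds z1. z \<in> ball z1 \<delta>" using loc(2) by (intro eventually_nhds_in_open) auto
    ultimately have "\<forall>\<^sub>F z in nhds z1. z \<in> L \<longrightarrow> z \<in> ?G"
    proof eventually_elim
      case (elim z)
      show ?case
      proof
        assume zL: "z \<in> L"
        have zz: "B z \<noteq> 0" "A z / B z \<in> ball ?u e" "\<psi> (A z / B z) = z" using loc(7)[OF elim(2)] by auto
        have n1: "norm (A z / B z) = 1" using zL zz(1) by (auto simp: L_def F_eq_0_iff norm_divide)
        define \<theta> where "\<theta> = \<tau> t1 + a z"
        have nn: "norm (A z / B z / ?u) = 1" using norm_divide[of "A z / B z" ?u] by (metis n1 norm_cis div_by_1)
        have "cis (a z) = A z / B z / ?u"
        proof -
          have "A z / B z / ?u \<noteq> 0" using nn by (metis norm_zero zero_neq_one)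
          then show ?thesis unfolding a_def using cis_Arg nn by (simp only: sgn_eq) simp
        qed
        then have c\<theta>: "cis \<theta> = A z / B z" by (simp add: \<theta>_def cis_mult[symmetric])
        have "\<alpha> < \<theta>" "\<theta> < \<beta>" using elim(1) by (auto simp: \<theta>_def \<eta>_def)
        then obtain t where t: "t \<in> {0<..<1}" "\<theta> = \<tau> t" using \<tau>_surj by blast
        have "\<gamma> t = z" using loc(5)[OF zz(2)] n1 zz(3) c\<theta> t(2) by (simp add: \<gamma>_def)
        then show "z \<in> ?G" using t(1) by blast
      qed
    qed
    then obtain S where "open S" "z1 \<in> S" "\<And>z. z \<in> S \<Longrightarrow> z \<in> L \<longrightarrow> z \<in> ?G" unfolding eventually_nhds by blast
    then show "\<exists>T. openin (top_of_set L) T \<and> z1 \<in> T \<and> T \<subseteq> ?G"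
      using \<gamma>L t1 by (intro exI[of _ "L \<inter> S"]) (auto simp: openin_open)
  qed
  moreover have "connected ?G" using cont by (intro connected_continuous_image) auto
  moreover have z0G: "z0 \<in> ?G"
  proof -
    obtain t where t: "t \<in> {0<..<1}" "\<theta>0 = \<tau> t" using \<tau>_surj[OF ord] by blast
    then have "\<gamma> t = z0" using \<theta>0 ext0 by (simp add: \<gamma>_def)
    then show ?thesis using t by blast
  qed
  ultimately have "?G = C"
  proof -
    assume G: "closedin (top_of_set L) ?G" "openin (top_of_set L) ?G" "connected ?G"
    have "?G \<subseteq> C" using components_maximal[OF C G(3) GL] z0 z0G by blast
    moreover have "C \<subseteq> ?G"
    proof -
      have "connected C" "C \<subseteq> L" using in_components_connected[OF C] in_components_subset[OF C] .
      moreover obtain S where "open S" "?G = L \<inter> S" using G(2) unfolding openin_open by blast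
      moreover obtain S' where "closed S'" "?G = L \<inter> S'" using G(1) unfolding closedin_closed by blast
      ultimately have "openin (top_of_set C) (C \<inter> ?G)" "closedin (top_of_set C) (C \<inter> ?G)"
        unfolding openin_open closedin_closed by blast+
      moreover note \<open>connected C\<close>
      ultimately show ?thesis using z0 z0G unfolding connected_clopen by blast
    qed
    ultimately show ?thesis by blast
  qed
  then show ?thesis using that E(1) E'(1) \<open>E \<noteq> E'\<close> curve by blast
qed

end

subsection \<open>The real locus near its ends\<close>

text \<open>Near the boundary point \<open>E\<close> the set \<open>L\<close> consists of exactly \<open>c\<close> rays emanating from \<open>E\<close>.\<close>
definition end_star :: "complex set \<Rightarrow> complex filter \<Rightarrow> nat \<Rightarrow> bool" where
  "end_star L E c \<longleftrightarrow> (\<exists>V \<rho>. (\<forall>\<^sub>F z in E. z \<in> V) \<and> L \<inter> V = (\<Union>l<c. \<rho> l) \<and> disjoint_family_on \<rho> {..<c} \<and>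
     (\<forall>l<c. connected (\<rho> l) \<and> (\<exists>\<^sub>F z in E. z \<in> \<rho> l) \<and> closedin (top_of_set (L \<inter> V)) (\<rho> l)))"

lemma Arg_upper: "Im z > 0 \<Longrightarrow> 0 < Arg z \<and> Arg z < pi"
  using Arg_lt_pi[of z] by blast

text \<open>The power is real when \<open>Arg z\<close> is a multiple of \<open>pi / k\<close>. The
  angles \<open>0\<close> and \<open>pi\<close> are excluded in the open half-plane; this leaves
  \<open>k - 1\<close> rays and accounts for the shift in \<open>Suc l\<close>.\<close>

lemma Im_power_eq_0_iff:
  assumes "Im z > 0" "k > 0"
  shows "Im (z ^ k) = 0 \<longleftrightarrow> (\<exists>l<k-1. Arg z = pi * real (Suc l) / real k)"
proof -
  have zz: "z \<noteq> 0" using assms by auto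
  have "z ^ k = rcis (norm z ^ k) (real k * Arg z)"
    by (metis DeMoivre2 rcis_cmod_Arg)
  then have im: "Im (z ^ k) = 0 \<longleftrightarrow> sin (real k * Arg z) = 0" using zz by simp
  note ar = Arg_upper[OF assms(1)]
  show ?thesis
  proof
    assume "Im (z ^ k) = 0"
    then obtain i :: int where i: "real k * Arg z = real_of_int i * pi" using im sin_zero_iff_int2 by auto
    have "0 < real k * Arg z" using ar assms by simp
    then have "i > 0" using i by (simp add: zero_less_mult_iff)
    have "real k * Arg z < real k * pi" using ar assms by simp
    then have "real_of_int i < real k" using i by simp
    then have "i < int k" by linarith
    define l where "l = nat i - 1"
    have "Suc l = nat i" "l < k - 1" using \<open>i > 0\<close> \<open>i < int k\<close> by (auto simp: l_def)
    moreover have "Arg z = pi * real (nat i) / real k" using i \<open>i > 0\<close> assms(2) by (simp add: field_simps)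
    ultimately show "\<exists>l<k-1. Arg z = pi * real (Suc l) / real k" by auto
  next
    assume "\<exists>l<k-1. Arg z = pi * real (Suc l) / real k"
    then obtain l where "Arg z = pi * real (Suc l) / real k" by blast
    then have "real k * Arg z = real_of_int (int (Suc l)) * pi" using assms(2) by (simp add: field_simps)
    then show "Im (z ^ k) = 0" using im sin_zero_iff_int2 by metis
  qed
qed

text \<open>In the conformal coordinate \<open>h\<close>, a \<open>k\<close>-th root of
  \<open>(z - c) ^ k * g z / g c\<close>, the locus is the set where \<open>h ^ k\<close> is real.
  Since \<open>h\<close> commutes with conjugation and has derivative \<open>1\<close> at
  \<open>c\<close>, it preserves the upper half-plane near \<open>c\<close>, and the straight rays
  pull back to rays of \<open>L\<close>.\<close>

lemma end_star_local:
  fixes g :: "complex \<Rightarrow> complex" and a :: real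
  assumes r: "r > 0" and hol: "g holomorphic_on ball (of_real a) r" and g0: "g (of_real a) \<noteq> 0"
    and cnj_g: "\<And>z. z \<in> ball (of_real a) r \<Longrightarrow> g (cnj z) = cnj (g z)"
    and k: "k > 0" and LH: "L \<subseteq> {z. Im z > 0}"
    and L: "\<And>z. z \<in> ball (of_real a) r \<Longrightarrow> Im z > 0 \<Longrightarrow> z \<in> L \<longleftrightarrow> Im ((z - of_real a) ^ k * g z) = 0"
  shows "end_star L (nhds (of_real a)) (k - 1)"
proof -
  define c :: complex where "c = of_real a"
  have cnj_c: "cnj c = c" by (simp add: c_def)
  have cnj_ball: "z \<in> ball c s \<Longrightarrow> cnj z \<in> ball c s" for z s
    using cnj_c by (metis complex_cnj_diff complex_mod_cnj dist_norm mem_ball)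
  have "g c = cnj (g c)" using cnj_g[of c] r cnj_c by (simp add: c_def)
  then have gc: "Im (g c) = 0" "g c \<noteq> 0" using g0 by (auto simp: complex_eq_iff c_def)
  then have gre: "g c = of_real (Re (g c))" "Re (g c) \<noteq> 0" by (auto simp: complex_eq_iff)
  have "isCont g c"
    using hol r unfolding c_def by (metis centre_in_ball continuous_on_eq_continuous_at holomorphic_on_imp_continuous_on open_ball)
  then have "(g \<longlongrightarrow> g c) (nhds c)" by (simp add: isCont_def tendsto_nhds_iff)
  then have "((\<lambda>z. Re (g z / g c)) \<longlongrightarrow> Re (g c / g c)) (nhds c)" using gc by (intro tendsto_intros)
  then have "((\<lambda>z. Re (g z / g c)) \<longlongrightarrow> 1) (nhds c)" using gc by simp
  then have "\<forall>\<^sub>F z in nhds c. Re (g z / g c) > 0" by (rule order_tendstoD) simp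
  then obtain d where d: "d > 0" "\<And>z. dist z c < d \<Longrightarrow> Re (g z / g c) > 0" unfolding eventually_nhds_metric by blast
  define r1 where "r1 = min r d"
  have r1: "r1 > 0" using r d by (simp add: r1_def)
  have b1: "z \<in> ball (of_real a) r" "Re (g z / g c) > 0" if "z \<in> ball c r1" for z
    using that d(2)[of z] by (auto simp: r1_def c_def dist_commute)
  \<comment> \<open>A principal \<open>k\<close>-th root exists because \<open>g z / g c\<close>
    stays in the right half-plane. Dividing by the real number \<open>g c\<close> changes no reality
    condition and normalises \<open>\<phi> c = 1\<close>.\<close>
  define \<phi> where "\<phi> z = exp (Ln (g z / g c) / of_nat k)" for z
  define h where "h z = (z - c) * \<phi> z" for z
  have hol1: "g holomorphic_on ball c r1" by (rule holomorphic_on_subset[OF hol]) (use b1 in blast)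
  have nonneg: "g z / g c \<notin> \<real>\<^sub>\<le>\<^sub>0" if "z \<in> ball c r1" for z using b1(2)[OF that] by (auto simp: complex_nonpos_Reals_iff)
  have holphi: "\<phi> holomorphic_on ball c r1"
    unfolding \<phi>_def[abs_def] using hol1 gc nonneg k by (intro holomorphic_intros) auto
  then have holh: "h holomorphic_on ball c r1" unfolding h_def[abs_def] by (intro holomorphic_intros)
  have hpow: "h z ^ k = (z - c) ^ k * g z / g c" if "z \<in> ball c r1" for z
  proof -
    have "g z / g c \<noteq> 0" using b1(2)[OF that] by auto
    then have "\<phi> z ^ k = g z / g c" using k by (simp add: \<phi>_def exp_divide_power_eq)
    then show ?thesis by (simp add: h_def power_mult_distrib)
  qed
  have cnj_h: "h (cnj z) = cnj (h z)" if "z \<in> ball c r1" for z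
  proof -
    have "g (cnj z) / g c = cnj (g z / g c)" using cnj_g[OF b1(1)[OF that]] \<open>g c = cnj (g c)\<close> by simp
    then have "Ln (g (cnj z) / g c) = cnj (Ln (g z / g c))" using cnj_Ln[OF nonneg[OF that]] by simp
    then show ?thesis by (simp add: h_def \<phi>_def exp_cnj cnj_c)
  qed
  have "(\<phi> has_field_derivative deriv \<phi> c) (at c)" using holphi r1 by (intro holomorphic_derivI[of _ "ball c r1"]) auto
  then have "(h has_field_derivative ((1 - 0) * \<phi> c + deriv \<phi> c * (c - c))) (at c)"
    unfolding h_def[abs_def] by (intro DERIV_mult' derivative_intros | simp add: algebra_simps)+
  moreover have "\<phi> c = 1" using gc by (simp add: \<phi>_def)
  ultimately have dh: "(h has_field_derivative 1) (at c)" by simp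
  obtain r2 where r2: "r2 > 0" "ball c r2 \<subseteq> ball c r1" "inj_on h (ball c r2)"
    using has_complex_derivative_locally_injective[OF holh _ open_ball, of c] r1 dh
    by (metis DERIV_imp_deriv centre_in_ball zero_neq_one)
  have hc: "h c = 0" by (simp add: h_def)
  let ?B = "ball c r2"
  have holh2: "h holomorphic_on ?B" using holh r2(2) holomorphic_on_subset by blast
  have Im_h0: "Im z = 0" if "z \<in> ?B" "Im (h z) = 0" for z
  proof -
    have "cnj (h z) = h z" using that by (simp add: complex_eq_iff)
    then have "h (cnj z) = h z" using cnj_h that r2(2) by auto
    then have "cnj z = z" using that cnj_ball r2(3) by (metis inj_onD)
    then show ?thesis by (simp add: complex_eq_iff)
  qed
  \<comment> \<open>By injectivity and symmetry \<open>Im (h z)\<close> does not vanish off the real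
    axis, so its sign is constant on the upper half-ball. The sign is read off just above
    \<open>c\<close>, where \<open>h\<close> behaves like \<open>z - c\<close>.\<close>
  have pos: "Im (h z) > 0" if z: "z \<in> ?B" "Im z > 0" for z
  proof (rule ccontr)
    assume neg: "\<not> Im (h z) > 0"
    have "((\<lambda>y. (h y - h c) / (y - c)) \<longlongrightarrow> 1) (at c)" using dh by (simp add: has_field_derivative_iff)
    then have "((\<lambda>y. Re ((h y - h c) / (y - c))) \<longlongrightarrow> Re 1) (at c)" by (rule tendsto_Re)
    then have "\<forall>\<^sub>F y in at c. Re ((h y - h c) / (y - c)) > 0" by (rule order_tendstoD) simp
    then obtain s where s: "s > 0" "\<And>y. y \<noteq> c \<Longrightarrow> dist y c < s \<Longrightarrow> Re (h y / (y - c)) > 0"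
      unfolding eventually_at hc by auto
    define t where "t = min s r2 / 2"
    have t: "t > 0" "t < s" "t < r2" using s(1) r2(1) by (auto simp: t_def)
    define y where "y = c + \<i> * of_real t"
    have y: "y - c = \<i> * of_real t" "dist y c = t" "y \<noteq> c" using t(1) by (auto simp: y_def dist_norm norm_mult)
    have "Re (h y / (y - c)) > 0" using s(2)[OF y(3)] y(2) t(2) by simp
    moreover have "h y / (y - c) = h y / \<i> / of_real t" unfolding y(1) by (rule divide_divide_eq_left[symmetric])
    then have "Re (h y / (y - c)) = Im (h y) / t" by (simp only: Re_divide_of_real) (simp add: Re_divide)
    ultimately have "Im (h y) > 0" using t(1) by (simp add: zero_less_divide_iff)
    moreover have "y \<in> ?B \<inter> {z. Im z > 0}" using y t by (auto simp: y_def c_def dist_commute)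
    moreover have "connected ((\<lambda>z. Im (h z)) ` (?B \<inter> {z. Im z > 0}))"
      by (intro connected_continuous_image continuous_intros convex_connected convex_Int convex_halfspace_Im_gt
          continuous_on_subset[OF holomorphic_on_imp_continuous_on[OF holh2]]) auto
    ultimately have "0 \<in> (\<lambda>z. Im (h z)) ` (?B \<inter> {z. Im z > 0})"
      using z neg by (intro connectedD_interval[of _ "Im (h z)" "Im (h y)" 0]) auto
    then show False using Im_h0 by force
  qed
  have pos_iff: "Im (h z) > 0 \<longleftrightarrow> Im z > 0" if z: "z \<in> ?B" for z
  proof -
    have "Im (h z) < 0" if "Im z < 0"
      using pos[of "cnj z"] cnj_h[of z] cnj_ball[OF z] z r2(2) that by auto
    moreover have "Im (h z) = 0" if "Im z = 0"
    proof -
      have "cnj z = z" using that by (simp add: complex_eq_iff)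
      then have "h z = cnj (h z)" using cnj_h[of z] z r2(2) by auto
      then show ?thesis by (simp add: complex_eq_iff)
    qed
    ultimately show ?thesis using pos[OF z] by (cases "Im z" "0::real" rule: linorder_cases) auto
  qed
  obtain \<psi> where \<psi>: "\<psi> holomorphic_on h ` ?B" "\<And>z. z \<in> ?B \<Longrightarrow> \<psi> (h z) = z"
    using holomorphic_has_inverse[OF holh2 open_ball r2(3)] by metis
  have op: "open (h ` ?B)" using open_mapping_thm3[OF holh2 open_ball r2(3)] .
  moreover have "0 \<in> h ` ?B" using hc r2(1) by (metis centre_in_ball imageI)
  ultimately obtain \<delta> where \<delta>: "\<delta> > 0" "ball 0 \<delta> \<subseteq> h ` ?B" by (rule openE)
  have \<psi>B: "\<psi> \<zeta> \<in> ?B" "h (\<psi> \<zeta>) = \<zeta>" if "\<zeta> \<in> ball 0 \<delta>" for \<zeta>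
    using that \<delta>(2) \<psi>(2) by auto
  have cont\<psi>: "continuous_on (ball 0 \<delta>) \<psi>"
    using holomorphic_on_imp_continuous_on[OF \<psi>(1)] \<delta>(2) continuous_on_subset by blast
  have conth: "continuous_on ?B h" using holomorphic_on_imp_continuous_on[OF holh2] .
  define V where "V = ?B \<inter> h -` ball 0 \<delta>"
  have "open V" unfolding V_def using conth by (intro continuous_open_preimage) auto
  have "c \<in> V" using hc r2(1) \<delta>(1) by (simp add: V_def)
  define \<theta> where "\<theta> l = pi * real (Suc l) / real k" for l
  have \<theta>: "0 < \<theta> l" "\<theta> l < pi" if "l < k - 1" for l
  proof -
    have "0 < pi * real (Suc l)" "pi * real (Suc l) < pi * real k" using that by simp_all
    then show "0 < \<theta> l" "\<theta> l < pi" using k by (simp_all add: \<theta>_def divide_less_eq)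
  qed
  have inj\<theta>: "\<theta> l = \<theta> l' \<Longrightarrow> l = l'" for l l' using k by (simp add: \<theta>_def)
  define \<rho> where "\<rho> l = {z \<in> V. Im z > 0 \<and> Arg (h z) = \<theta> l}" for l
  have LV: "z \<in> L \<longleftrightarrow> (\<exists>l<k-1. Arg (h z) = \<theta> l)" if z: "z \<in> V" "Im z > 0" for z
  proof -
    have zB: "z \<in> ?B" "z \<in> ball c r1" using z r2(2) by (auto simp: V_def)
    have "z \<in> L \<longleftrightarrow> Im ((z - c) ^ k * g z) = 0" using L[OF b1(1)[OF zB(2)] z(2)] by (simp add: c_def)
    also have "(z - c) ^ k * g z = of_real (Re (g c)) * h z ^ k" using hpow[OF zB(2)] gre gc by (simp add: field_simps)
    also have "Im (of_real (Re (g c)) * h z ^ k) = 0 \<longleftrightarrow> Im (h z ^ k) = 0" using gre(2) by simp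
    also have "\<dots> \<longleftrightarrow> (\<exists>l<k-1. Arg (h z) = \<theta> l)"
      unfolding \<theta>_def by (rule Im_power_eq_0_iff[OF _ k]) (use pos_iff[OF zB(1)] z in simp)
    finally show ?thesis .
  qed
  have ray: "\<rho> l = \<psi> ` ((\<lambda>t. of_real t * cis (\<theta> l)) ` {0<..<\<delta>})" if l: "l < k - 1" for l
  proof -
    have ray_in: "\<psi> (of_real t * cis (\<theta> l)) \<in> \<rho> l" if t: "t \<in> {0<..<\<delta>}" for t
    proof -
      let ?\<zeta> = "of_real t * cis (\<theta> l)"
      have b: "?\<zeta> \<in> ball 0 \<delta>" using t by (simp add: norm_mult)
      have "Im ?\<zeta> > 0" using t \<theta>[OF l] by (simp add: sin_gt_zero)
      then have "Im (\<psi> ?\<zeta>) > 0" using pos_iff[OF \<psi>B(1)[OF b]] \<psi>B(2)[OF b] by simp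
      moreover have "Arg ?\<zeta> = \<theta> l"
        using t \<theta>[OF l] by (intro Arg_unique[of t]) (auto simp: cis_conv_exp)
      ultimately show ?thesis using \<psi>B[OF b] b by (simp add: \<rho>_def V_def)
    qed
    have "z \<in> \<psi> ` ((\<lambda>t. of_real t * cis (\<theta> l)) ` {0<..<\<delta>})" if z: "z \<in> \<rho> l" for z
    proof -
      have "h z = of_real (norm (h z)) * cis (\<theta> l)"
        using z rcis_cmod_Arg[of "h z"] by (simp add: \<rho>_def rcis_def)
      moreover have "norm (h z) \<in> {0<..<\<delta>}"
        using z pos_iff[of z] by (auto simp: \<rho>_def V_def)
      ultimately have "h z \<in> (\<lambda>t. of_real t * cis (\<theta> l)) ` {0<..<\<delta>}" by blast
      moreover have "\<psi> (h z) = z" using z \<psi>(2) by (simp add: \<rho>_def V_def)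
      ultimately show ?thesis by (metis imageI)
    qed
    then show ?thesis using ray_in by blast
  qed
  have ray_ball: "(\<lambda>t. of_real t * cis (\<theta> l)) ` {0<..<\<delta>} \<subseteq> ball 0 \<delta>" for l by (auto simp: norm_mult)
  show ?thesis unfolding end_star_def
  proof (intro exI[of _ V] exI[of _ \<rho>] conjI allI impI)
    show "\<forall>\<^sub>F z in nhds (of_real a). z \<in> V" using \<open>open V\<close> \<open>c \<in> V\<close> unfolding c_def by (rule eventually_nhds_in_open)
    show "L \<inter> V = (\<Union>l<k - 1. \<rho> l)" using LV LH by (auto simp: \<rho>_def)
    show "disjoint_family_on \<rho> {..<k - 1}" using inj\<theta> by (auto simp: disjoint_family_on_def \<rho>_def)
    fix l assume l: "l < k - 1"
    show "connected (\<rho> l)" unfolding ray[OF l]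
      by (intro connected_continuous_image continuous_on_subset[OF cont\<psi> ray_ball] continuous_intros) auto
    show "\<exists>\<^sub>F z in nhds (of_real a). z \<in> \<rho> l"
      unfolding frequently_def
    proof
      assume "\<forall>\<^sub>F z in nhds (of_real a). z \<notin> \<rho> l"
      moreover have "((\<lambda>t. \<psi> (of_real t * cis (\<theta> l))) \<longlongrightarrow> c) (at_right 0)"
      proof -
        have "isCont \<psi> 0" using cont\<psi> \<delta>(1) by (simp add: continuous_on_eq_continuous_at)
        moreover have "((\<lambda>t. of_real t * cis (\<theta> l)) \<longlongrightarrow> of_real 0 * cis (\<theta> l)) (at_right 0)" by (intro tendsto_intros)
        ultimately have "((\<lambda>t. \<psi> (of_real t * cis (\<theta> l))) \<longlongrightarrow> \<psi> 0) (at_right 0)"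
          by (intro isCont_tendsto_compose[of 0 \<psi>]) auto
        then show ?thesis using \<psi>(2)[of c] hc r2(1) by simp
      qed
      ultimately have "\<forall>\<^sub>F t in at_right 0. \<psi> (of_real t * cis (\<theta> l)) \<notin> \<rho> l"
        unfolding c_def by (rule eventually_compose_filterlim)
      moreover have "\<forall>\<^sub>F t in at_right 0. t \<in> {0<..<\<delta>}" using \<delta>(1) eventually_at_right_real by blast
      ultimately have "\<forall>\<^sub>F t in at_right (0::real). False"
        by eventually_elim (use ray[OF l] in blast)
      then show False by simp
    qed
    have "closedin (top_of_set (V \<inter> {z. Im z > 0})) (V \<inter> {z. Im z > 0} \<inter> (\<lambda>z. Arg (h z)) -` {\<theta> l})"
    proof (rule continuous_closedin_preimage)
      have "continuous_on {z. Im z > 0} Arg"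
        by (intro continuous_at_imp_continuous_on ballI continuous_at_Arg) (auto simp: complex_nonpos_Reals_iff)
      then show "continuous_on (V \<inter> {z. Im z > 0}) (\<lambda>z. Arg (h z))"
        by (rule continuous_on_compose2) (use pos in \<open>auto simp: V_def intro: continuous_on_subset[OF conth]\<close>)
    qed simp
    moreover have "V \<inter> {z. Im z > 0} \<inter> (\<lambda>z. Arg (h z)) -` {\<theta> l} = \<rho> l" by (auto simp: \<rho>_def)
    ultimately have "closedin (top_of_set (V \<inter> {z. Im z > 0})) (\<rho> l)" by simp
    moreover have "\<rho> l \<subseteq> L \<inter> V" using LV l by (auto simp: \<rho>_def)
    ultimately show "closedin (top_of_set (L \<inter> V)) (\<rho> l)"
      by (rule closedin_subset_trans) (use LH in auto)
  qed
qed

text \<open>The map \<open>z \<mapsto> 1 / cnj z\<close> preserves the upper half-plane and interchanges \<open>0\<close> and \<open>\<infinity>\<close>.\<close>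
lemma end_star_infinity:
  assumes star: "end_star L' (nhds 0) c" and L'H: "L' \<subseteq> {z. Im z > 0}" and LH: "L \<subseteq> {z. Im z > 0}"
    and LL': "\<And>z. Im z > 0 \<Longrightarrow> z \<in> L \<longleftrightarrow> 1 / cnj z \<in> L'"
  shows "end_star L at_infinity c"
proof -
  let ?\<tau> = "\<lambda>z. 1 / cnj z" and ?H = "{z. Im z > 0}"
  have \<tau>\<tau>: "?\<tau> (?\<tau> z) = z" for z by simp
  have \<tau>H: "Im (?\<tau> z) > 0" if "Im z > 0" for z
  proof -
    have "Im (?\<tau> z) = Im z / (norm z)\<^sup>2" by (simp add: Im_divide cmod_power2)
    moreover have "norm z \<noteq> 0" using that by auto
    ultimately show ?thesis using that by simp
  qed
  have cont: "continuous_on S ?\<tau>" if "S \<subseteq> ?H" for S using that by (intro continuous_intros) auto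
  obtain V \<rho> where V: "\<forall>\<^sub>F z in nhds 0. z \<in> V" "L' \<inter> V = (\<Union>l<c. \<rho> l)" "disjoint_family_on \<rho> {..<c}"
    and \<rho>: "\<And>l. l < c \<Longrightarrow> connected (\<rho> l)" "\<And>l. l < c \<Longrightarrow> \<exists>\<^sub>F z in nhds 0. z \<in> \<rho> l"
       "\<And>l. l < c \<Longrightarrow> closedin (top_of_set (L' \<inter> V)) (\<rho> l)"
    using star unfolding end_star_def by blast
  have \<rho>H: "\<rho> l \<subseteq> ?H" if "l < c" for l using V(2) L'H that by blast
  have inv: "?\<tau> ` S = {z. ?\<tau> z \<in> S}" for S
  proof -
    have "z \<in> ?\<tau> ` S" if "?\<tau> z \<in> S" for z using imageI[OF that, of ?\<tau>] by simp
    then show ?thesis by auto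
  qed
  have lim0: "filterlim ?\<tau> (nhds 0) at_infinity"
  proof -
    have "filterlim (\<lambda>z. inverse (cnj z)) (nhds 0) (at_infinity :: complex filter)"
      by (rule filterlim_compose[OF tendsto_inverse_0])
         (simp add: filterlim_at_infinity_conv_norm_at_top filterlim_norm_at_top)
    then show ?thesis by (simp add: inverse_eq_divide)
  qed
  have liminf: "filterlim ?\<tau> at_infinity (at 0)"
  proof -
    have "filterlim (\<lambda>z. inverse (cnj z)) at_infinity (at 0)"
      by (rule filterlim_compose[OF filterlim_inverse_at_infinity])
         (auto simp: filterlim_at eventually_at_filter intro!: tendsto_eq_intros)
    then show ?thesis by (simp add: inverse_eq_divide)
  qed
  have LV: "L \<inter> {z. ?\<tau> z \<in> V} = ?\<tau> ` (L' \<inter> V)"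
    unfolding inv using LL' LH L'H \<tau>H by (auto) (metis (no_types, lifting) \<tau>\<tau> \<tau>H mem_Collect_eq subsetD)+
  show ?thesis unfolding end_star_def
  proof (intro exI[of _ "{z. ?\<tau> z \<in> V}"] exI[of _ "\<lambda>l. ?\<tau> ` \<rho> l"] conjI allI impI)
    show "\<forall>\<^sub>F z in at_infinity. z \<in> {z. ?\<tau> z \<in> V}" using eventually_compose_filterlim[OF V(1) lim0] by simp
    show "L \<inter> {z. ?\<tau> z \<in> V} = (\<Union>l<c. ?\<tau> ` \<rho> l)" unfolding LV V(2) by (rule image_UN)
    show "disjoint_family_on (\<lambda>l. ?\<tau> ` \<rho> l) {..<c}"
      using V(3) unfolding disjoint_family_on_def inv by blast
    fix l assume l: "l < c"
    show "connected (?\<tau> ` \<rho> l)" using \<rho>(1)[OF l] cont[OF \<rho>H[OF l]] by (intro connected_continuous_image)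
    show "\<exists>\<^sub>F z in at_infinity. z \<in> ?\<tau> ` \<rho> l"
      unfolding frequently_def
    proof
      assume "\<forall>\<^sub>F z in at_infinity. z \<notin> ?\<tau> ` \<rho> l"
      then have "\<forall>\<^sub>F z in at 0. ?\<tau> z \<notin> ?\<tau> ` \<rho> l" using liminf by (rule eventually_compose_filterlim)
      then have "\<forall>\<^sub>F z in at 0. z \<notin> \<rho> l" unfolding inv by simp
      moreover have "0 \<notin> \<rho> l" using \<rho>H[OF l] by auto
      ultimately have "\<forall>\<^sub>F z in nhds 0. z \<notin> \<rho> l" unfolding eventually_at_filter by (auto elim!: eventually_mono)
      then show False using \<rho>(2)[OF l] by (simp add: frequently_def)
    qed
    have sub: "L \<inter> {z. ?\<tau> z \<in> V} \<subseteq> ?H" using LH by blast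
    have "?\<tau> \<in> (L \<inter> {z. ?\<tau> z \<in> V}) \<rightarrow> L' \<inter> V" using LL' LH by blast
    then have "closedin (top_of_set (L \<inter> {z. ?\<tau> z \<in> V})) ((L \<inter> {z. ?\<tau> z \<in> V}) \<inter> ?\<tau> -` \<rho> l)"
      by (intro continuous_closedin_preimage_gen[OF cont[OF sub] _ \<rho>(3)[OF l]])
    moreover have "(L \<inter> {z. ?\<tau> z \<in> V}) \<inter> ?\<tau> -` \<rho> l = ?\<tau> ` \<rho> l"
      using LV V(2) l unfolding inv by blast
    ultimately show "closedin (top_of_set (L \<inter> {z. ?\<tau> z \<in> V})) (?\<tau> ` \<rho> l)" by simp
  qed
qed

subsection \<open>Counting curves and ends\<close>

text \<open>The final stretch of the curve is connected and lies in a finite disjoint union of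
  relatively closed rays, hence in one of them. Because the other end of the curve is different,
  near \<open>E\<close> the component consists of this stretch alone.\<close>

lemma component_tail_in_ray:
  assumes C: "C \<in> components L" and curve: "simple_curve_in_H E' E C" "end_filter E'" "end_filter E" "E' \<noteq> E"
    and V: "\<forall>\<^sub>F z in E. z \<in> V" "L \<inter> V = (\<Union>l<c. \<rho> l)" "disjoint_family_on \<rho> {..<c}"
      "\<And>l. l < c \<Longrightarrow> closedin (top_of_set (L \<inter> V)) (\<rho> l)"
  obtains m where "m < (c::nat)" "\<forall>\<^sub>F z in E. z \<in> C \<longrightarrow> z \<in> \<rho> m"
proof -
  obtain \<gamma> :: "real \<Rightarrow> complex" where \<gamma>: "continuous_on {0<..<1} \<gamma>" "C = \<gamma> ` {0<..<1}"
    "filterlim \<gamma> E' (at_right 0)" "filterlim \<gamma> E (at_left 1)" and CH: "C \<subseteq> {z. Im z > 0}"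
    using curve(1) unfolding simple_curve_in_H_def by blast
  have "\<forall>\<^sub>F t in at_left 1. \<gamma> t \<in> V" using V(1) \<gamma>(4) by (rule eventually_compose_filterlim)
  then obtain b0 where b0: "b0 < 1" "\<And>t. b0 < t \<Longrightarrow> t < 1 \<Longrightarrow> \<gamma> t \<in> V"
    unfolding eventually_at_left_field by auto
  define b where "b = max b0 (1/2)"
  have b: "0 < b" "b < 1" "\<And>t. b < t \<Longrightarrow> t < 1 \<Longrightarrow> \<gamma> t \<in> V" using b0 by (auto simp: b_def)
  define T where "T = \<gamma> ` {b<..<1}"
  have "connected T" unfolding T_def using b(1) by (intro connected_continuous_image continuous_on_subset[OF \<gamma>(1)]) auto
  have "T \<subseteq> C" using b(1) by (auto simp: T_def \<gamma>(2))
  then have TL: "T \<subseteq> L \<inter> V" using b(3) in_components_subset[OF C] by (auto simp: T_def)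
  obtain t0 where "b < t0" "t0 < 1" using dense b(2) by blast
  then have "\<gamma> t0 \<in> T" by (auto simp: T_def)
  then obtain m where m: "m < c" "\<gamma> t0 \<in> \<rho> m" using TL V(2) by blast
  let ?B = "\<Union>l\<in>{..<c} - {m}. \<rho> l"
  have "closedin (top_of_set (L \<inter> V)) ?B" using V(4) by (intro closedin_Union) auto
  then obtain S where S: "closed S" "?B = (L \<inter> V) \<inter> S" unfolding closedin_closed by blast
  obtain S' where S': "closed S'" "\<rho> m = (L \<inter> V) \<inter> S'" using V(4)[OF m(1)] unfolding closedin_closed by blast
  have "T \<subseteq> \<rho> m"
  proof (rule ccontr)
    assume "\<not> T \<subseteq> \<rho> m"
    have "T \<subseteq> S' \<union> S" using TL V(2) S(2) S'(2) by blast
    moreover have "S' \<inter> S \<inter> T = {}"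
    proof -
      have "\<rho> m \<inter> ?B = {}" using V(3) m(1) by (auto simp: disjoint_family_on_def)
      then show ?thesis using TL S(2) S'(2) by blast
    qed
    moreover have "S' \<inter> T \<noteq> {}" using m(2) S'(2) \<open>\<gamma> t0 \<in> T\<close> by blast
    moreover have "S \<inter> T \<noteq> {}" using \<open>\<not> T \<subseteq> \<rho> m\<close> \<open>T \<subseteq> S' \<union> S\<close> TL S'(2) by blast
    ultimately show False using \<open>connected T\<close> S(1) S'(1) unfolding connected_closed by blast
  qed
  have "\<forall>\<^sub>F z in E. z \<notin> \<gamma> ` {0<..b}"
    using CH \<gamma>(2) by (intro curve_tail[OF \<gamma>(1) _ \<gamma>(3) curve(2,3,4) b(2)]) simp
  then have "\<forall>\<^sub>F z in E. z \<in> C \<longrightarrow> z \<in> \<rho> m"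
  proof eventually_elim
    case (elim z)
    show ?case
    proof
      assume "z \<in> C"
      then obtain t where t: "0 < t" "t < 1" "z = \<gamma> t" by (auto simp: \<gamma>(2))
      then have "b < t" using elim by force
      then show "z \<in> \<rho> m" using t \<open>T \<subseteq> \<rho> m\<close> by (auto simp: T_def)
    qed
  qed
  then show ?thesis using that m(1) by blast
qed

text \<open>From here on only topology and counting matter: the polynomials enter solely through the
  shape of the components and the number of rays at each end.\<close>

locale curve_family =
  fixes L :: "complex set"
  assumes L_upper: "L \<subseteq> {z. Im z > 0}"
    and components_curves: "\<And>C. C \<in> components L \<Longrightarrow>
      \<exists>E E'. end_filter E \<and> end_filter E' \<and> E \<noteq> E' \<and> simple_curve_in_H E E' C"
begin

text \<open>Ends are defined by accumulation, which refers to no parametrisation; for the curves at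
  hand this singles out exactly the two limit filters, as \<open>component_ends\<close>
  shows.\<close>

definition has_end :: "complex set \<Rightarrow> complex filter \<Rightarrow> bool" where
  "has_end C E \<longleftrightarrow> C \<in> components L \<and> end_filter E \<and> (\<exists>\<^sub>F z in E. z \<in> C)"

lemma component_ends:
  assumes "C \<in> components L"
  obtains E E' where "E \<noteq> E'" "end_filter E" "end_filter E'" "simple_curve_in_H E E' C" "\<And>D. has_end C D \<longleftrightarrow> D = E \<or> D = E'"
proof -
  obtain E E' where *: "end_filter E" "end_filter E'" "E \<noteq> E'" "simple_curve_in_H E E' C"
    using components_curves[OF assms] by blast
  have "has_end C D \<longleftrightarrow> D = E \<or> D = E'" for D
    using curve_ends[OF *(4,1,2)] curve_end_frequently[OF *(4)]
      curve_end_frequently[OF simple_curve_in_H_commute[OF *(4)]] * assms unfolding has_end_def by blast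
  then show ?thesis using that * by blast
qed

lemma curve_between_ends:
  assumes "has_end C D" "has_end C D'" "D \<noteq> D'"
  shows "simple_curve_in_H D D' C"
proof -
  have C: "C \<in> components L" using assms by (simp add: has_end_def)
  obtain E E' where E: "E \<noteq> E'" "end_filter E" "end_filter E'" "simple_curve_in_H E E' C" "\<And>D. has_end C D \<longleftrightarrow> D = E \<or> D = E'"
    by (rule component_ends[OF C]) (rule that)
  have "D = E \<and> D' = E' \<or> D = E' \<and> D' = E" using assms E(5)[of D] E(5)[of D'] by blast
  then show ?thesis using E(4) simple_curve_in_H_commute by blast
qed

lemma other_end:
  assumes "has_end C D"
  obtains D' where "has_end C D'" "D \<noteq> D'"
proof -
  have C: "C \<in> components L" using assms by (simp add: has_end_def)
  obtain E E' where E: "E \<noteq> E'" "end_filter E" "end_filter E'" "simple_curve_in_H E E' C" "\<And>D. has_end C D \<longleftrightarrow> D = E \<or> D = E'"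
    by (rule component_ends[OF C]) (rule that)
  then show ?thesis using assms that[of E] that[of E'] by blast
qed

lemma at_most_two_ends:
  assumes "has_end C D1" "has_end C D2" "has_end C D3"
  shows "D1 = D2 \<or> D2 = D3 \<or> D1 = D3"
proof -
  have C: "C \<in> components L" using assms by (simp add: has_end_def)
  obtain E E' where E: "E \<noteq> E'" "end_filter E" "end_filter E'" "simple_curve_in_H E E' C" "\<And>D. has_end C D \<longleftrightarrow> D = E \<or> D = E'"
    by (rule component_ends[OF C]) (rule that)
  then show ?thesis using assms E(5)[of D1] E(5)[of D2] E(5)[of D3] by blast
qed

text \<open>Each ray extends to a component. Two rays cannot extend to the same one, since a
  component has two different ends and so approaches \<open>E\<close> along a single ray; conversely
  its tail at \<open>E\<close> lies in some ray.\<close>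

lemma card_has_end:
  assumes E: "end_filter E" and star: "end_star L E c"
  shows "finite {C. has_end C E}" "card {C. has_end C E} = c"
proof -
  obtain V \<rho> where V: "\<forall>\<^sub>F z in E. z \<in> V" "L \<inter> V = (\<Union>l<c. \<rho> l)" "disjoint_family_on \<rho> {..<c}"
    and \<rho>: "\<And>l. l < c \<Longrightarrow> connected (\<rho> l)" "\<And>l. l < c \<Longrightarrow> \<exists>\<^sub>F z in E. z \<in> \<rho> l"
       "\<And>l. l < c \<Longrightarrow> closedin (top_of_set (L \<inter> V)) (\<rho> l)"
    using star unfolding end_star_def by blast
  have "\<forall>l\<in>{..<c}. \<exists>C. C \<in> components L \<and> \<rho> l \<subseteq> C"
  proof
    fix l assume "l \<in> {..<c}"
    then have l: "l < c" by simp
    have sub: "\<rho> l \<subseteq> L" using V(2) l by blast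
    have "\<rho> l \<noteq> {}" using frequently_ex[OF \<rho>(2)[OF l]] by blast
    then show "\<exists>C. C \<in> components L \<and> \<rho> l \<subseteq> C"
      using exists_component_superset[OF sub _ \<rho>(1)[OF l]] sub by blast
  qed
  then obtain f where f: "\<And>l. l < c \<Longrightarrow> f l \<in> components L" "\<And>l. l < c \<Longrightarrow> \<rho> l \<subseteq> f l" by (metis lessThan_iff)
  have tail: "\<exists>m<c. \<forall>\<^sub>F z in E. z \<in> C \<longrightarrow> z \<in> \<rho> m" if C: "has_end C E" for C
  proof -
    obtain D where D: "has_end C D" "E \<noteq> D" by (rule other_end[OF C])
    have C': "C \<in> components L" "simple_curve_in_H D E C" "end_filter D"
      using curve_between_ends[OF D(1) C] D C by (auto simp: has_end_def)
    then obtain m where "m < c" "\<forall>\<^sub>F z in E. z \<in> C \<longrightarrow> z \<in> \<rho> m"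
      using component_tail_in_ray[OF C' E D(2)[symmetric] V \<rho>(3)] by blast
    then show ?thesis by blast
  qed
  have mem: "has_end (f l) E" if "l < c" for l
  proof -
    have "\<exists>\<^sub>F z in E. z \<in> f l" using \<rho>(2)[OF that] by (rule frequently_elim1) (use f(2)[OF that] in blast)
    then show ?thesis unfolding has_end_def using f(1)[OF that] E by simp
  qed
  have meet: "\<exists>z. P z \<and> Q z" if "\<exists>\<^sub>F z in E. P z" "\<forall>\<^sub>F z in E. Q z" for P Q
    using frequently_eventually_conj[OF that] by (auto dest!: frequently_ex)
  have "bij_betw f {..<c} {C. has_end C E}"
    unfolding bij_betw_def
  proof
    show "inj_on f {..<c}"
    proof (rule inj_onI)
      fix l l' assume ll: "l \<in> {..<c}" "l' \<in> {..<c}" "f l = f l'"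
      obtain m where m: "m < c" "\<forall>\<^sub>F z in E. z \<in> f l \<longrightarrow> z \<in> \<rho> m" using tail[OF mem[of l]] ll by auto
      have "i = m" if i: "i < c" "f i = f l" for i
      proof -
        obtain z where "z \<in> \<rho> i" "z \<in> f l \<longrightarrow> z \<in> \<rho> m" using meet[OF \<rho>(2)[OF i(1)] m(2)] by blast
        then have "z \<in> \<rho> i \<inter> \<rho> m" using f(2)[OF i(1)] i(2) by auto
        then show "i = m" using V(3) i(1) m(1) unfolding disjoint_family_on_def by blast
      qed
      then show "l = l'" using ll by (metis lessThan_iff)
    qed
    show "f ` {..<c} = {C. has_end C E}"
    proof
      show "f ` {..<c} \<subseteq> {C. has_end C E}" using mem by auto
      show "{C. has_end C E} \<subseteq> f ` {..<c}"
      proof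
        fix C assume "C \<in> {C. has_end C E}"
        then have C: "has_end C E" by simp
        obtain m where m: "m < c" "\<forall>\<^sub>F z in E. z \<in> C \<longrightarrow> z \<in> \<rho> m" using tail[OF C] by blast
        have "\<exists>\<^sub>F z in E. z \<in> C" using C by (simp add: has_end_def)
        then obtain z where "z \<in> C" "z \<in> \<rho> m" using meet[OF _ m(2)] by blast
        then have "z \<in> C \<inter> f m" using f(2)[OF m(1)] by blast
        then have "C = f m" using components_nonoverlap C f(1)[OF m(1)] unfolding has_end_def by blast
        then show "C \<in> f ` {..<c}" using m(1) by blast
      qed
    qed
  qed
  then show "finite {C. has_end C E}" "card {C. has_end C E} = c"
    using bij_betw_finite bij_betw_same_card by force+
qed

text \<open>One ray at each \<open>x j\<close> means one curve \<open>Cf j\<close> through that end,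
  and two indices are linked when their curves coincide. An index left over has a curve whose other
  end can only be \<open>\<infinity>\<close>, so the number of rays there determines the number of
  pairs.\<close>

lemma chordal_link_pattern:
  fixes x :: "nat \<Rightarrow> real"
  assumes inj: "inj_on x {1..n}" and mn: "2 * m \<le> n"
    and star_x: "\<And>j. j \<in> {1..n} \<Longrightarrow> end_star L (nhds (of_real (x j))) 1"
    and star_inf: "end_star L at_infinity (n - 2 * m)"
    and star_other: "\<And>a. a \<notin> x ` {1..n} \<Longrightarrow> end_star L (nhds (of_real a)) 0"
    and locus: "real_locus R \<inter> {z. Im z > 0} = L"
  shows "chordal_link_pattern n m x R"
proof -
  define N where "N j = nhds (complex_of_real (x j))" for j
  have endN: "end_filter (N j)" "end_filter at_infinity" for j by (auto simp: N_def end_filter_def)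
  have injN: "i = j" if "N i = N j" "i \<in> {1..n}" "j \<in> {1..n}" for i j
  proof -
    have "x i = x j"
    proof (rule ccontr)
      assume "x i \<noteq> x j"
      then obtain U V where "open U" "open V" "of_real (x i) \<in> U" "complex_of_real (x j) \<in> V" "U \<inter> V = {}"
        using hausdorff[of "complex_of_real (x i)" "of_real (x j)"] by auto
      then have "\<forall>\<^sub>F z in N i. z \<in> U" "\<forall>\<^sub>F z in N j. z \<in> V" by (auto simp: N_def intro: eventually_nhds_in_open)
      then have "\<forall>\<^sub>F z in N i. z \<in> U \<inter> V" using that(1) by (auto elim: eventually_elim2)
      then show False using \<open>U \<inter> V = {}\<close> by (auto simp: N_def)
    qed
    then show ?thesis using inj that by (auto dest: inj_onD)
  qed
  have N_inf: "N j \<noteq> at_infinity" for j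
  proof
    assume "N j = at_infinity"
    moreover have "\<forall>\<^sub>F z in N j. z \<in> ball (of_real (x j)) 1"
      unfolding N_def by (intro eventually_nhds_in_open) auto
    ultimately have ev: "\<forall>\<^sub>F z in at_infinity. z \<in> ball (complex_of_real (x j)) 1" by simp
    moreover have "\<forall>\<^sub>F z in at_infinity. z \<notin> ball (complex_of_real (x j)) 1"
      using bounded_ball[of "complex_of_real (x j)" 1] unfolding bounded_iff eventually_at_infinity
      by (metis less_add_one linorder_not_le order_trans_rules(21))
    ultimately have "\<forall>\<^sub>F z :: complex in at_infinity. False" by eventually_elim auto
    then show False unfolding eventually_False using trivial_limit_at_infinity by blast
  qed
  have "\<exists>!C. has_end C (N j)" if "j \<in> {1..n}" for j
  proof -
    have "card {C. has_end C (N j)} = 1" using card_has_end(2)[OF endN(1)[of j]] star_x[OF that] by (simp add: N_def)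
    then obtain C where "{C. has_end C (N j)} = {C}" by (rule card_1_singletonE)
    then show ?thesis by (intro ex1I[of _ C]) auto
  qed
  then obtain Cf where Cf: "\<And>j. j \<in> {1..n} \<Longrightarrow> has_end (Cf j) (N j)"
     "\<And>j C. j \<in> {1..n} \<Longrightarrow> has_end C (N j) \<Longrightarrow> C = Cf j" by metis
  have ends: "D = at_infinity \<or> (\<exists>j\<in>{1..n}. D = N j)" if D: "has_end C D" for C D
  proof (rule ccontr)
    assume *: "\<not> (D = at_infinity \<or> (\<exists>j\<in>{1..n}. D = N j))"
    then obtain a where a: "D = nhds (complex_of_real a)" using D by (auto simp: has_end_def end_filter_def)
    then have "a \<notin> x ` {1..n}" using * by (auto simp: N_def)
    then have "{C. has_end C D} = {}"
      using card_has_end[OF _ star_other, of a] a D by (auto simp: has_end_def)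
    then show False using D by blast
  qed
  define P where "P = {{i, j} | i j. i \<in> {1..n} \<and> j \<in> {1..n} \<and> i \<noteq> j \<and> Cf i = Cf j}"
  have PI: "{i, j} \<in> P" if "i \<in> {1..n}" "j \<in> {1..n}" "i \<noteq> j" "Cf i = Cf j" for i j
    using that by (auto simp: P_def)
  have PD: "i \<in> {1..n} \<and> j \<in> {1..n} \<and> i \<noteq> j \<and> Cf i = Cf j" if "{i, j} \<in> P" for i j
    using that by (auto simp: P_def doubleton_eq_iff)
  have PE: "\<exists>j. p = {i, j}" if "p \<in> P" "i \<in> p" for p i
    using that by (auto simp: P_def)
  have uniq: "j = k" if "{i, j} \<in> P" "{i, k} \<in> P" for i j k
  proof -
    note 1 = PD[OF that(1)] and 2 = PD[OF that(2)]
    have "has_end (Cf i) (N i)" "has_end (Cf i) (N j)" "has_end (Cf i) (N k)" using 1 2 Cf(1) by metis+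
    then have "N i = N j \<or> N j = N k \<or> N i = N k" by (rule at_most_two_ends)
    then show ?thesis using 1 2 injN by blast
  qed
  have P_eq: "p = p'" if "p \<in> P" "p' \<in> P" "i \<in> p" "i \<in> p'" for p p' i
    using PE[OF that(1,3)] PE[OF that(2,4)] uniq that by metis
  have P_sub: "p \<subseteq> {1..n}" "card p = 2" "finite p" if "p \<in> P" for p
    using that by (auto simp: P_def)
  define U where "U = {1..n} - \<Union>P"
  define S where "S = {{j} |j. j \<in> U}"
  have unpaired: "has_end (Cf j) at_infinity" if j: "j \<in> U" for j
  proof -
    have j1: "j \<in> {1..n}" using j by (simp add: U_def)
    obtain D where D: "has_end (Cf j) D" "N j \<noteq> D" by (rule other_end[OF Cf(1)[OF j1]])
    have "\<not> (\<exists>i\<in>{1..n}. D = N i)"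
    proof
      assume "\<exists>i\<in>{1..n}. D = N i"
      then obtain i where i: "i \<in> {1..n}" "D = N i" by blast
      then have "Cf j = Cf i" using Cf(2) D(1) by blast
      then have "{j, i} \<in> P" using PI[OF j1 i(1)] D(2) i(2) by blast
      then show False using j by (auto simp: U_def)
    qed
    then show ?thesis using ends[OF D(1)] D(1) by blast
  qed
  \<comment> \<open>The choice is immaterial: both indices of a linked pair have the same
    curve.\<close>
  define Cc where "Cc b = Cf (SOME i. i \<in> b)" for b
  have Cc_pair: "Cc b = Cf i" if bp: "b \<in> P" "i \<in> b" for b i
  proof -
    obtain j where j: "b = {i, j}" using PE[OF bp] by blast
    define s where "s = (SOME i. i \<in> b)"
    have "s \<in> b" unfolding s_def using bp(2) by (rule someI)
    then have "s = i \<or> s = j" using j by blast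
    moreover have "Cf i = Cf j" using PD[of i j] bp(1) j by simp
    ultimately show ?thesis by (auto simp: Cc_def s_def[symmetric])
  qed
  have Cc_single: "Cc {j} = Cf j" for j by (simp add: Cc_def)
  have block: "\<exists>i\<in>b. i \<in> {1..n} \<and> Cc b = Cf i" if "b \<in> P \<union> S" for b
  proof (cases "b \<in> P")
    case True
    then obtain i where "i \<in> b" using P_sub(2) by fastforce
    then show ?thesis using Cc_pair[OF True] P_sub(1)[OF True] by blast
  next
    case False
    then show ?thesis using that Cc_single by (auto simp: S_def U_def)
  qed
  have block_unique: "b = b'" if b: "b \<in> P \<union> S" "b' \<in> P \<union> S" "Cc b = Cc b'" for b b'
  proof -
    obtain i i' where i: "i \<in> b" "i \<in> {1..n}" "Cc b = Cf i" and i': "i' \<in> b'" "i' \<in> {1..n}" "Cc b' = Cf i'"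
      using block b by metis
    show ?thesis
    proof (cases "i = i'")
      case True
      then show ?thesis using b i i' P_eq[of b b' i] by (auto simp: S_def U_def)
    next
      case False
      then have "{i, i'} \<in> P" using PI i i' b(3) by metis
      then show ?thesis using b i i' P_eq[of b "{i, i'}" i] P_eq[of b' "{i, i'}" i'] by (auto simp: S_def U_def)
    qed
  qed
  have Cc_comp: "Cc b \<in> components L" if "b \<in> P \<union> S" for b
    using block[OF that] Cf(1) by (auto simp: has_end_def)
  have union: "L = (\<Union>b\<in>P \<union> S. Cc b)"
  proof
    show "(\<Union>b\<in>P \<union> S. Cc b) \<subseteq> L" using Cc_comp in_components_subset by blast
    show "L \<subseteq> (\<Union>b\<in>P \<union> S. Cc b)"
    proof
      fix z assume "z \<in> L"
      then obtain C where C: "C \<in> components L" "z \<in> C" by (metis UnionE Union_components)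
      obtain E E' where E: "E \<noteq> E'" "end_filter E" "end_filter E'" "simple_curve_in_H E E' C" "\<And>D. has_end C D \<longleftrightarrow> D = E \<or> D = E'"
        by (rule component_ends[OF C(1)]) (rule that)
      \<comment> \<open>The two ends differ, so at most one of them is \<open>\<infinity>\<close>;
        no component avoids all the points \<open>x j\<close>.\<close>
      then obtain j where j: "j \<in> {1..n}" "has_end C (N j)" using ends[of C E] ends[of C E'] by blast
      have Cj: "C = Cf j" using Cf(2) j by blast
      show "z \<in> (\<Union>b\<in>P \<union> S. Cc b)"
      proof (cases "j \<in> U")
        case True
        then have "{j} \<in> S" by (auto simp: S_def)
        then show ?thesis using Cc_single[of j] Cj C(2) by blast
      next
        case False
        then obtain b where "b \<in> P" "j \<in> b" using j(1) by (auto simp: U_def)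
        then show ?thesis using Cc_pair Cj C(2) by blast
      qed
    qed
  qed
  have "bij_betw Cf U {C. has_end C at_infinity}"
    unfolding bij_betw_def
  proof
    show "inj_on Cf U"
    proof (rule inj_onI, rule ccontr)
      fix i j assume *: "i \<in> U" "j \<in> U" "Cf i = Cf j" "i \<noteq> j"
      then have "{i, j} \<in> P" using PI by (auto simp: U_def)
      then show False using * by (auto simp: U_def)
    qed
    show "Cf ` U = {C. has_end C at_infinity}"
    proof
      show "Cf ` U \<subseteq> {C. has_end C at_infinity}" using unpaired by blast
      show "{C. has_end C at_infinity} \<subseteq> Cf ` U"
      proof
        fix C assume "C \<in> {C. has_end C at_infinity}"
        then have C: "has_end C at_infinity" by simp
        obtain D where D: "has_end C D" "at_infinity \<noteq> D" by (rule other_end[OF C])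
        then obtain j where j: "j \<in> {1..n}" "D = N j" using ends by blast
        have Cj: "C = Cf j" using Cf(2) j D by blast
        have "j \<in> U"
        proof (rule ccontr)
          assume "j \<notin> U"
          then obtain b where b: "b \<in> P" "j \<in> b" using j(1) by (auto simp: U_def)
          then obtain i where "b = {j, i}" using PE by blast
          then have i: "i \<in> {1..n}" "i \<noteq> j" "Cf i = Cf j" using PD[of j i] b by auto
          have "has_end C (N i)" using Cf(1)[OF i(1)] i(3) Cj by simp
          then have "N i = N j \<or> N j = at_infinity \<or> N i = at_infinity"
            using at_most_two_ends[OF _ _ C] D(1) j(2) by blast
          then show False using N_inf injN i j by blast
        qed
        then show "C \<in> Cf ` U" using Cj by blast
      qed
    qed
  qed
  then have cardU: "card U = n - 2 * m" using bij_betw_same_card card_has_end(2)[OF endN(2) star_inf] by metis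
  have disjP: "disjoint P" unfolding disjoint_def using P_eq by blast
  \<comment> \<open>The unpaired indices number both \<open>n - 2 * card P\<close> and
    \<open>n - 2 * m\<close>. The bounds on \<open>card (\<Union>P)\<close> and \<open>2 * m\<close>
    make both natural subtractions exact.\<close>
  have cardP: "card P = m"
  proof -
    have "card (\<Union>P) = (\<Sum>p\<in>P. card p)"
      using disjP P_sub(3) by (intro card_Union_disjoint) auto
    also have "\<dots> = 2 * card P" using P_sub(2) by simp
    finally have "card (\<Union>P) = 2 * card P" .
    moreover have "card U = card {1..n} - card (\<Union>P)"
      unfolding U_def using P_sub(1) finite_subset[of "\<Union>P" "{1..n}"] by (intro card_Diff_subset) auto
    moreover have "card (\<Union>P) \<le> card {1..n}" using P_sub(1) by (intro card_mono) auto
    ultimately show ?thesis using cardU mn by simp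
  qed
  show ?thesis
    unfolding chordal_link_pattern_def Let_def
  proof (intro exI[of _ P] exI[of _ Cc] conjI ballI allI impI)
    fix p assume "p \<in> P"
    then show "p \<subseteq> {1..n}" "card p = 2" using P_sub by auto
  next
    fix i j assume ij: "{i, j} \<in> P"
    note d = PD[OF ij]
    have "has_end (Cf i) (N i)" "has_end (Cf i) (N j)" "N i \<noteq> N j" using d Cf(1) injN by metis+
    then have "simple_curve_in_H (N i) (N j) (Cf i)" by (rule curve_between_ends)
    then show "simple_curve_in_H (nhds (of_real (x i))) (nhds (of_real (x j))) (Cc {i, j})"
      using Cc_pair[OF ij, of i] by (simp add: N_def)
  next
    fix j assume j: "j \<in> {1..n} - \<Union>P"
    then have "has_end (Cf j) (N j)" "has_end (Cf j) at_infinity" using Cf(1) unpaired by (auto simp: U_def)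
    then have "simple_curve_in_H (N j) at_infinity (Cf j)" using N_inf by (rule curve_between_ends)
    then show "simple_curve_in_H (nhds (of_real (x j))) at_infinity (Cc {j})"
      by (simp add: N_def Cc_single)
  next
    have "Cc b \<inter> Cc b' = {}" if bb: "b \<in> P \<union> S" "b' \<in> P \<union> S" "b \<noteq> b'" for b b'
    proof -
      have "Cc b \<noteq> Cc b'" using block_unique[OF bb(1,2)] bb(3) by blast
      then show ?thesis using components_nonoverlap[OF Cc_comp[OF bb(1)] Cc_comp[OF bb(2)]] by simp
    qed
    then have "disjoint_family_on Cc (P \<union> S)" unfolding disjoint_family_on_def by blast
    then show "disjoint_family_on Cc (P \<union> {{j} |j. j \<in> {1..n} - \<Union>P})" by (simp add: S_def U_def)
    show "real_locus R \<inter> {z. Im z > 0} = (\<Union>b\<in>P \<union> {{j} |j. j \<in> {1..n} - \<Union>P}. Cc b)"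
      using locus union by (simp add: S_def U_def)
  qed (use disjP cardP in auto)
qed

end

subsection \<open>Rational functions with prescribed critical points and poles\<close>

text \<open>Logarithmic derivatives add. Writing the derivative of a factor as
  \<open>f i z * d i\<close> keeps the rule free of quotients.\<close>

lemma has_field_derivative_prod_log:
  fixes f :: "'i \<Rightarrow> complex \<Rightarrow> complex"
  assumes "\<And>i. i \<in> I \<Longrightarrow> (f i has_field_derivative f i z * d i) (at z)"
  shows "((\<lambda>w. \<Prod>i\<in>I. f i w) has_field_derivative (\<Prod>i\<in>I. f i z) * (\<Sum>i\<in>I. d i)) (at z)"
  using assms
proof (induction I rule: infinite_finite_induct)
  case (insert i I)
  have "((\<lambda>w. f i w * (\<Prod>i\<in>I. f i w)) has_field_derivative
      (f i z * d i) * (\<Prod>i\<in>I. f i z) + ((\<Prod>i\<in>I. f i z) * (\<Sum>i\<in>I. d i)) * f i z) (at z)"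
    using insert by (intro DERIV_mult) auto
  then show ?case using insert by (simp add: algebra_simps)
qed auto

lemma poly_pderiv_linear_prod:
  fixes a :: "'i \<Rightarrow> complex"
  assumes "\<And>i. i \<in> I \<Longrightarrow> z \<noteq> a i"
  shows "poly (pderiv (\<Prod>i\<in>I. [:- a i, 1:])) z = poly (\<Prod>i\<in>I. [:- a i, 1:]) z * (\<Sum>i\<in>I. 1 / (z - a i))"
proof -
  have "((\<lambda>w. \<Prod>i\<in>I. w - a i) has_field_derivative (\<Prod>i\<in>I. z - a i) * (\<Sum>i\<in>I. 1 / (z - a i))) (at z)"
    by (rule has_field_derivative_prod_log) (use assms in \<open>auto intro!: derivative_eq_intros\<close>)
  moreover have "(poly (\<Prod>i\<in>I. [:- a i, 1:]) has_field_derivative poly (pderiv (\<Prod>i\<in>I. [:- a i, 1:])) z) (at z)"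
    by (rule poly_DERIV)
  moreover have "poly (\<Prod>i\<in>I. [:- a i, 1:]) = (\<lambda>w. \<Prod>i\<in>I. w - a i)" by (auto simp: poly_prod)
  ultimately show ?thesis using DERIV_unique by metis
qed

text \<open>Splitting off the factor that vanishes at \<open>a k\<close> gives \<open>q' = s\<close>
  and \<open>q'' = 2 * s'\<close> there; this is the origin of the numerator \<open>2\<close> in the
  stationary relations.\<close>

lemma linear_prod_derivs:
  fixes a :: "'i \<Rightarrow> complex"
  assumes "finite I" "inj_on a I" "k \<in> I"
  defines "q \<equiv> \<Prod>i\<in>I. [:- a i, 1:]" and "s \<equiv> \<Prod>i\<in>I - {k}. [:- a i, 1:]"
  shows "q = [:- a k, 1:] * s" "poly (pderiv q) (a k) = poly s (a k)" "poly s (a k) \<noteq> 0"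
    "poly (pderiv (pderiv q)) (a k) = poly (pderiv q) (a k) * (\<Sum>l\<in>I - {k}. 2 / (a k - a l))"
    "poly (pderiv (pderiv q)) (a k) = 2 * poly (pderiv s) (a k)"
proof -
  show q: "q = [:- a k, 1:] * s" unfolding q_def s_def using assms(1,3) by (rule prod.remove)
  have d: "pderiv q = [:- a k, 1:] * pderiv s + s" unfolding q pderiv_mult by (simp add: pderiv_pCons)
  have dd: "pderiv (pderiv q) = [:- a k, 1:] * pderiv (pderiv s) + 2 * pderiv s"
    unfolding d pderiv_add pderiv_mult by (simp add: pderiv_pCons)
  show ds: "poly (pderiv q) (a k) = poly s (a k)" by (simp add: d)
  show dds: "poly (pderiv (pderiv q)) (a k) = 2 * poly (pderiv s) (a k)" by (simp add: dd)
  have ne: "a k \<noteq> a l" if "l \<in> I - {k}" for l using assms(2,3) that by (auto dest: inj_onD)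
  then show "poly s (a k) \<noteq> 0" using assms(1) by (auto simp: s_def poly_prod)
  have "poly (pderiv s) (a k) = poly s (a k) * (\<Sum>l\<in>I - {k}. 1 / (a k - a l))"
    unfolding s_def using ne by (intro poly_pderiv_linear_prod)
  then show "poly (pderiv (pderiv q)) (a k) = poly (pderiv q) (a k) * (\<Sum>l\<in>I - {k}. 2 / (a k - a l))"
    unfolding ds dds by (simp add: sum_distrib_left mult.commute)
qed

text \<open>Denominators may be cleared because neither \<open>N\<close> nor \<open>q'\<close>
  vanishes at \<open>\<xi> k\<close>. The resulting identity is homogeneous in \<open>N\<close> and
  in \<open>q\<close>, so it is insensitive to leading coefficients.\<close>

lemma stationary_iff_wronskian_jets:
  fixes x :: "nat \<Rightarrow> real" and \<xi> :: "nat \<Rightarrow> complex"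
  assumes inj: "inj_on \<xi> {1..m}" and ne: "\<forall>k\<in>{1..m}. \<forall>j\<in>{1..n}. \<xi> k \<noteq> of_real (x j)"
  defines "q \<equiv> \<Prod>k\<in>{1..m}. [:- \<xi> k, 1:]" and "N \<equiv> \<Prod>j\<in>{1..n}. [:- complex_of_real (x j), 1:]"
  shows "stationary_relations n m x \<xi> \<longleftrightarrow>
    (\<forall>k\<in>{1..m}. poly (pderiv N) (\<xi> k) * poly (pderiv q) (\<xi> k) = poly N (\<xi> k) * poly (pderiv (pderiv q)) (\<xi> k))"
  unfolding stationary_relations_def
proof (intro ball_cong refl)
  fix k assume k: "k \<in> {1..m}"
  note d = linear_prod_derivs[OF _ inj k, folded q_def]
  have N0: "poly N (\<xi> k) \<noteq> 0" using ne k by (auto simp: N_def poly_prod)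
  have q0: "poly (pderiv q) (\<xi> k) \<noteq> 0" using d by simp
  have "poly (pderiv N) (\<xi> k) = poly N (\<xi> k) * (\<Sum>j\<in>{1..n}. 1 / (\<xi> k - of_real (x j)))"
    unfolding N_def using ne k by (intro poly_pderiv_linear_prod) auto
  moreover have "poly (pderiv (pderiv q)) (\<xi> k) = poly (pderiv q) (\<xi> k) * (\<Sum>l\<in>{1..m} - {k}. 2 / (\<xi> k - \<xi> l))"
    using d by simp
  ultimately have "poly (pderiv N) (\<xi> k) * poly (pderiv q) (\<xi> k) = poly N (\<xi> k) * poly (pderiv (pderiv q)) (\<xi> k) \<longleftrightarrow>
    (\<Sum>j\<in>{1..n}. 1 / (\<xi> k - of_real (x j))) = (\<Sum>l\<in>{1..m} - {k}. 2 / (\<xi> k - \<xi> l))"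
    using N0 q0 by (simp add: mult.commute mult.left_commute)
  then show "- (\<Sum>j\<in>{1..n}. 1 / (\<xi> k - of_real (x j))) + (\<Sum>l\<in>{1..m} - {k}. 2 / (\<xi> k - \<xi> l)) = 0 \<longleftrightarrow>
     poly (pderiv N) (\<xi> k) * poly (pderiv q) (\<xi> k) = poly N (\<xi> k) * poly (pderiv (pderiv q)) (\<xi> k)"
    by (auto simp: add_eq_0_iff)
qed

lemma square_prod_dvd:
  fixes a :: "'i \<Rightarrow> complex"
  assumes "finite I" "inj_on a I"
    and "\<And>i. i \<in> I \<Longrightarrow> poly D (a i) = 0" "\<And>i. i \<in> I \<Longrightarrow> poly (pderiv D) (a i) = 0"
  shows "(\<Prod>i\<in>I. [:- a i, 1:])\<^sup>2 dvd D"
  using assms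
proof (induction I arbitrary: D rule: finite_induct)
  case (insert i I)
  obtain E1 where E1: "D = [:- a i, 1:] * E1" using insert.prems(2)[of i] by (auto simp: poly_eq_0_iff_dvd)
  then have "pderiv D = [:- a i, 1:] * pderiv E1 + E1" by (simp only: pderiv_mult) (simp add: pderiv_pCons)
  then have "poly E1 (a i) = 0" using insert.prems(3)[of i] by simp
  then obtain E where E: "E1 = [:- a i, 1:] * E" by (auto simp: poly_eq_0_iff_dvd)
  have D: "D = [:- a i, 1:]\<^sup>2 * E" unfolding E1 E by (simp only: power2_eq_square mult.assoc)
  have dD: "pderiv D = [:- a i, 1:] * (2 * E + [:- a i, 1:] * pderiv E)"
  proof -
    define l where "l = [:- a i, 1:]"
    have "pderiv l = 1" by (simp add: l_def pderiv_pCons)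
    then show ?thesis unfolding D l_def[symmetric] by (simp add: power2_eq_square pderiv_mult algebra_simps)
  qed
  have "(\<Prod>i\<in>I. [:- a i, 1:])\<^sup>2 dvd E"
  proof (rule insert.IH)
    show "inj_on a I" using insert.prems(1) by simp
    fix l assume l: "l \<in> I"
    have "l \<noteq> i" using l insert.hyps(2) by auto
    then have ne: "a l - a i \<noteq> 0" using inj_onD[OF insert.prems(1), of l i] l by auto
    show El: "poly E (a l) = 0" using insert.prems(2)[of l] l ne by (simp add: D)
    show "poly (pderiv E) (a l) = 0" using insert.prems(3)[of l] l ne El by (simp add: dD)
  qed
  then show ?case unfolding D prod.insert[OF insert.hyps] power_mult_distrib by (rule mult_dvd_mono[OF dvd_refl])
qed auto

section \<open>Rational antiderivatives of \<open>N / q\<^sup>2\<close>\<close>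

lemma pderiv_sum: "pderiv (\<Sum>i\<in>I. f i) = (\<Sum>i\<in>I. pderiv (f i))"
  by (induction I rule: infinite_finite_induct) (auto simp: pderiv_add)

lemma poly_antiderivative: "\<exists>S. pderiv S = (T :: complex poly)"
proof -
  have "pderiv (\<Sum>i\<le>degree T. monom (coeff T i / of_nat (Suc i)) (Suc i)) = (\<Sum>i\<le>degree T. monom (coeff T i) i)"
    by (simp add: pderiv_sum pderiv_monom del: of_nat_Suc)
  then show ?thesis using poly_as_sum_of_monoms by metis
qed

lemma wronskian_linear:
  "wronskian (p + p') q = wronskian p q + wronskian p' q"
  "wronskian (p - p') q = wronskian p q - wronskian p' q"
  "wronskian (smult c p) q = smult c (wronskian p q)"
  by (simp_all add: wronskian_def pderiv_add pderiv_diff pderiv_smult algebra_simps smult_diff_right)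

lemma wronskian_sum: "wronskian (\<Sum>i\<in>I. f i) q = (\<Sum>i\<in>I. wronskian (f i) q)"
  by (induction I rule: infinite_finite_induct) (auto simp: wronskian_linear, simp_all add: wronskian_def)

text \<open>Partial fractions: the stationary relations say that \<open>N / q\<^sup>2\<close> has no residues, so it
  has a rational antiderivative \<open>p / q\<close>.\<close>
lemma exists_wronskian_preimage:
  fixes a :: "'i \<Rightarrow> complex"
  assumes fin: "finite I" and inj: "inj_on a I"
  defines "q \<equiv> \<Prod>k\<in>I. [:- a k, 1:]"
  assumes jets: "\<And>k. k \<in> I \<Longrightarrow> poly (pderiv N) (a k) * poly (pderiv q) (a k) = poly N (a k) * poly (pderiv (pderiv q)) (a k)"
  shows "\<exists>p. wronskian p q = N"
proof -
  define s where "s k = (\<Prod>i\<in>I - {k}. [:- a i, 1:])" for k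
  note d = linear_prod_derivs[OF fin inj, folded q_def s_def]
  \<comment> \<open>\<open>b k\<close> is the coefficient of the double pole of
    \<open>N / q\<^sup>2\<close> at \<open>a k\<close>. As \<open>s k / q\<close> equals
    \<open>1 / (z - a k)\<close>, the polynomial \<open>D\<close> is what remains of the numerator
    after removing all these double poles.\<close>
  define b where "b k = poly N (a k) / (poly (s k) (a k))\<^sup>2" for k
  define D where "D = N - (\<Sum>k\<in>I. smult (b k) ((s k)\<^sup>2))"
  have van: "poly (s k) (a l) = 0" if "k \<in> I" "l \<in> I" "k \<noteq> l" for k l
    using that fin by (auto simp: s_def poly_prod)
  have "q\<^sup>2 dvd D"
    unfolding q_def
  proof (rule square_prod_dvd[OF fin inj])
    fix l assume l: "l \<in> I"
    have "poly (\<Sum>k\<in>I. smult (b k) ((s k)\<^sup>2)) (a l) = (\<Sum>k\<in>I. if k = l then b l * (poly (s l) (a l))\<^sup>2 else 0)"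
      unfolding poly_sum by (intro sum.cong) (use van l in \<open>auto\<close>)
    also have "\<dots> = poly N (a l)" using fin l d(3)[OF l] by (simp add: b_def)
    finally show "poly D (a l) = 0" by (simp add: D_def)
    have "poly (pderiv (\<Sum>k\<in>I. smult (b k) ((s k)\<^sup>2))) (a l) =
        (\<Sum>k\<in>I. if k = l then b l * (2 * poly (s l) (a l) * poly (pderiv (s l)) (a l)) else 0)"
      unfolding pderiv_sum poly_sum
      by (intro sum.cong) (use van l in \<open>auto simp: pderiv_smult power2_eq_square pderiv_mult\<close>)
    also have "\<dots> = b l * poly (s l) (a l) * poly (pderiv (pderiv q)) (a l)"
      using fin l d(5)[OF l] by simp
    also have "\<dots> = poly N (a l) * poly (pderiv (pderiv q)) (a l) / poly (s l) (a l)"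
      using d(3)[OF l] by (simp add: b_def power2_eq_square)
    \<comment> \<open>This is the vanishing of the residue at \<open>a l\<close>, supplied by the
      jet condition.\<close>
    also have "\<dots> = poly (pderiv N) (a l)"
      using jets[OF l] d(2,3)[OF l] by (simp add: divide_eq_eq)
    finally show "poly (pderiv D) (a l) = 0" by (simp add: D_def pderiv_diff)
  qed
  then obtain T where T: "D = q\<^sup>2 * T" by auto
  obtain S where S: "pderiv S = T" using poly_antiderivative by blast
  \<comment> \<open>Termwise integration: the polynomial part \<open>T\<close> contributes
    \<open>S\<close>, and each double pole contributes \<open>- b k / (z - a k)\<close>; everything
    is multiplied by \<open>q\<close>.\<close>
  define p where "p = q * S - (\<Sum>k\<in>I. smult (b k) (s k))"
  have 1: "wronskian (q * S) q = q\<^sup>2 * T"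
    by (simp add: wronskian_def pderiv_mult S power2_eq_square algebra_simps)
  have 2: "wronskian (s k) q = - (s k)\<^sup>2" if "k \<in> I" for k
    unfolding wronskian_def d(1)[OF that] pderiv_mult by (simp add: pderiv_pCons power2_eq_square algebra_simps)
  have "wronskian p q = q\<^sup>2 * T - (\<Sum>k\<in>I. smult (b k) (- (s k)\<^sup>2))"
    unfolding p_def wronskian_linear wronskian_sum 1 using 2 by simp
  also have "\<dots> = q\<^sup>2 * T + (\<Sum>k\<in>I. smult (b k) ((s k)\<^sup>2))" by (simp add: sum_negf)
  also have "\<dots> = N" unfolding T[symmetric] D_def by simp
  finally show ?thesis by blast
qed

section \<open>Real coefficients and the degree of the numerator\<close>

lemma map_poly_cnj_eqI:
  assumes "\<And>z. poly p (cnj z) = cnj (poly p z)"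
  shows "map_poly cnj p = p"
proof -
  have "poly (map_poly cnj p) z = poly p z" for z using assms[of z] by simp
  then show ?thesis by (simp add: poly_eq_poly_eq_iff[symmetric] fun_eq_iff)
qed

lemma map_poly_cnj_hom:
  "map_poly cnj (p + p') = map_poly cnj p + map_poly cnj p'"
  "map_poly cnj (p * p') = map_poly cnj p * map_poly cnj p'"
  "map_poly cnj (p - p') = map_poly cnj p - map_poly cnj p'"
  "map_poly cnj (pderiv p) = pderiv (map_poly cnj p)"
proof -
  show "map_poly cnj (p + p') = map_poly cnj p + map_poly cnj p'"
    "map_poly cnj (p * p') = map_poly cnj p * map_poly cnj p'"
    "map_poly cnj (p - p') = map_poly cnj p - map_poly cnj p'"
    by (simp_all add: poly_eq_poly_eq_iff[symmetric] fun_eq_iff)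
  show "map_poly cnj (pderiv p) = pderiv (map_poly cnj p)"
    by (intro poly_eqI) (simp add: coeff_map_poly coeff_pderiv)
qed

text \<open>The equation for \<open>p\<close> is linear and invariant under conjugation, so
  averaging a solution with its conjugate gives a real solution.\<close>

lemma exists_real_wronskian_preimage:
  assumes "wronskian p q = N" "map_poly cnj q = q" "map_poly cnj N = N"
  shows "\<exists>p. wronskian p q = N \<and> map_poly cnj p = p"
proof (intro exI conjI)
  let ?p = "smult (1/2) (p + map_poly cnj p)"
  have "wronskian (map_poly cnj p) q = map_poly cnj (wronskian p q)"
    by (simp add: wronskian_def map_poly_cnj_hom assms(2))
  then have "wronskian (map_poly cnj p) q = N" using assms by simp
  then have "wronskian ?p q = smult (1/2) (N + N)" using assms(1) by (simp only: wronskian_linear)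
  also have "\<dots> = N" by (simp only: smult_add_right smult_add_left[symmetric]) simp
  finally show "wronskian ?p q = N" .
  show "map_poly cnj ?p = ?p" by (rule map_poly_cnj_eqI) simp
qed

text \<open>With \<open>d = degree p\<close>, the coefficient of degree \<open>d + m - 1\<close> in
  the Wronskian is \<open>d - m\<close> times the leading coefficient of \<open>p\<close>. If
  \<open>d = m\<close>, the degree of \<open>N\<close> would be below \<open>2 * m\<close>, hence
  below \<open>n\<close>; so the coefficient is nonzero and \<open>d + m - 1 = n\<close>.\<close>

lemma degree_of_wronskian_preimage:
  assumes w: "wronskian p q = N" and q: "degree q = m" "lead_coeff q = 1" "0 < m" and N: "degree N = n" "2 * m \<le> n"
  shows "degree p + m = Suc n"
proof -
  have p0: "p \<noteq> 0" using assms by (auto simp: wronskian_def)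
  have q0: "q \<noteq> 0" using q by auto
  define d where "d = degree p"
  show ?thesis
  proof (cases "d = 0")
    case True
    then obtain c where c: "p = [:c:]" by (auto simp: d_def elim: degree_eq_zeroE)
    then have "N = - smult c (pderiv q)" using w by (simp add: wronskian_def)
    then have "degree N \<le> degree (pderiv q)" using degree_smult_le by simp
    then show ?thesis using assms by (simp add: degree_pderiv)
  next
    case False
    have "coeff (pderiv p * q) (degree (pderiv p) + degree q) = lead_coeff (pderiv p) * lead_coeff q"
      by (rule coeff_mult_degree_sum)
    then have 1: "coeff (pderiv p * q) (d + m - 1) = of_nat d * lead_coeff p"
      using False q by (simp add: degree_pderiv d_def coeff_pderiv)
    have "coeff (p * pderiv q) (degree p + degree (pderiv q)) = lead_coeff p * lead_coeff (pderiv q)"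
      by (rule coeff_mult_degree_sum)
    then have 2: "coeff (p * pderiv q) (d + m - 1) = of_nat m * lead_coeff p"
      using False q by (simp add: degree_pderiv d_def coeff_pderiv)
    have c: "coeff N (d + m - 1) = (of_nat d - of_nat m) * lead_coeff p"
      using 1 2 w by (auto simp: wronskian_def algebra_simps)
    have "degree (pderiv p * q) \<le> d + m - 1"
      using degree_mult_le[of "pderiv p" q] q False by (simp add: degree_pderiv d_def)
    moreover have "degree (p * pderiv q) \<le> d + m - 1"
      using degree_mult_le[of p "pderiv q"] q by (simp add: degree_pderiv d_def)
    ultimately have le: "degree N \<le> d + m - 1" using w by (auto simp: wronskian_def intro: degree_diff_le)
    have "d \<noteq> m" using le N q False by auto
    then have "coeff N (d + m - 1) \<noteq> 0" using c p0 by simp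
    then have "d + m - 1 \<le> degree N" by (rule le_degree)
    then show ?thesis using le N False by (simp add: d_def)
  qed
qed

lemma wronskian_no_common_root:
  assumes "wronskian p q = N" "\<And>z. poly q z = 0 \<Longrightarrow> poly N z \<noteq> 0" "poly q z = 0"
  shows "poly p z \<noteq> 0" "poly (pderiv q) z \<noteq> 0"
proof -
  have "poly N z = - poly p z * poly (pderiv q) z" using assms(1,3) by (auto simp: wronskian_def)
  then show "poly p z \<noteq> 0" "poly (pderiv q) z \<noteq> 0" using assms(2)[OF assms(3)] by auto
qed

section \<open>Poles and derivatives of a quotient in lowest terms\<close>

lemma coprime_poly_complexI:
  fixes p q :: "complex poly"
  assumes "q \<noteq> 0" "\<And>z. poly q z = 0 \<Longrightarrow> poly p z \<noteq> 0"
  shows "coprime p q"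
proof (rule coprimeI)
  fix c assume c: "c dvd p" "c dvd q"
  then have "c \<noteq> 0" using assms(1) by auto
  moreover have "degree c = 0"
  proof (rule ccontr)
    assume "degree c \<noteq> 0"
    then obtain z where "poly c z = 0" using fundamental_theorem_of_algebra[of c] constant_degree[of c] by auto
    then have "poly p z = 0" "poly q z = 0" using c by (auto simp: dvd_def)
    then show False using assms(2) by blast
  qed
  ultimately show "is_unit c" by (simp add: is_unit_iff_degree)
qed

lemma coprime_poly_complexD:
  fixes p q :: "complex poly"
  assumes "coprime p q" "poly q z = 0"
  shows "poly p z \<noteq> 0"
proof
  assume "poly p z = 0"
  then have "[:- z, 1:] dvd p" "[:- z, 1:] dvd q" using assms by (auto simp: poly_eq_0_iff_dvd)
  then have "is_unit [:- z, 1:]" using assms(1) by (meson coprime_def)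
  then show False by (simp add: is_unit_iff_degree)
qed

definition quotient_of :: "complex poly \<Rightarrow> complex poly \<Rightarrow> (complex \<Rightarrow> complex) \<Rightarrow> bool" where
  "quotient_of p q R \<longleftrightarrow> q \<noteq> 0 \<and> coprime p q \<and> (\<forall>z. R z = poly p z / poly q z)"

lemma isCont_quotient:
  assumes "quotient_of p q R" "poly q z \<noteq> 0"
  shows "isCont R z"
proof -
  have "isCont (\<lambda>z. poly p z / poly q z) z" using assms(2) by (intro continuous_intros) auto
  moreover have "R = (\<lambda>z. poly p z / poly q z)" using assms(1) by (auto simp: quotient_of_def)
  ultimately show ?thesis by simp
qed

lemma pole_order_quotient:
  assumes R: "quotient_of p q R" and z: "poly q z = 0"
  shows "is_pole R z" "zorder R z = - int (order z q)"
proof -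
  have q0: "q \<noteq> 0" and cp: "coprime p q" and Req: "\<And>z. R z = poly p z / poly q z" using R by (auto simp: quotient_of_def)
  define k where "k = order z q"
  have k: "k > 0" using z q0 by (simp add: k_def order_gt_0_iff)
  obtain s where s: "q = [:- z, 1:] ^ k * s" "\<not> [:- z, 1:] dvd s" unfolding k_def using order_decomp[OF q0] by blast
  have sz: "poly s z \<noteq> 0" using s(2) by (simp add: poly_eq_0_iff_dvd)
  have pz: "poly p z \<noteq> 0" using coprime_poly_complexD[OF cp z] .
  define S where "S = {w. poly s w \<noteq> 0}"
  have S: "open S" "z \<in> S" unfolding S_def using sz by (auto intro!: open_Collect_neq continuous_intros)
  have hol: "(\<lambda>w. poly p w / poly s w) holomorphic_on S" by (auto simp: S_def intro!: holomorphic_intros)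
  \<comment> \<open>At \<open>w = z\<close> both sides are \<open>0\<close> by the convention for
    division by zero, so the identity holds for every \<open>w\<close>.\<close>
  have eq: "R w = poly p w / poly s w * (w - z) powi (- int k)" for w
    by (simp add: Req s(1) power_int_minus field_simps)
  have nz: "poly p z / poly s z \<noteq> 0" using pz sz by simp
  show "zorder R z = - int (order z q)"
    unfolding k_def[symmetric] by (rule zorder_eqI[OF S hol nz eq])
  have "is_pole (\<lambda>w. poly p w / poly s w / (w - z) ^ k) z"
    using is_pole_basic[OF hol S nz k] .
  moreover have "R = (\<lambda>w. poly p w / poly s w / (w - z) ^ k)" by (simp add: fun_eq_iff eq power_int_minus field_simps)
  ultimately show "is_pole R z" by simp
qed

lemma is_pole_quotient_iff:
  assumes "quotient_of p q R"
  shows "is_pole R z \<longleftrightarrow> poly q z = 0"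
  using pole_order_quotient(1)[OF assms] isCont_quotient[OF assms, of z] not_tendsto_and_filterlim_at_infinity[of "at z" R "R z"]
  by (auto simp: is_pole_def isCont_def)

lemma deriv_quotient:
  assumes R: "quotient_of p q R" and z: "poly q z \<noteq> 0"
  shows "deriv R z = poly (wronskian p q) z / (poly q z)\<^sup>2"
    "deriv R z = 0 \<Longrightarrow> deriv (deriv R) z = poly (pderiv (wronskian p q)) z / (poly q z)\<^sup>2"
proof -
  have Req: "R = (\<lambda>z. poly p z / poly q z)" using R by (auto simp: quotient_of_def)
  have d: "deriv R w = poly (wronskian p q) w / (poly q w)\<^sup>2" if "poly q w \<noteq> 0" for w
    unfolding Req by (rule DERIV_imp_deriv)
      (use that in \<open>auto intro!: derivative_eq_intros simp: wronskian_def power2_eq_square field_simps\<close>)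
  then show "deriv R z = poly (wronskian p q) z / (poly q z)\<^sup>2" using z by blast
  assume "deriv R z = 0"
  then have N0: "poly (wronskian p q) z = 0" using d[OF z] z by simp
  have "open {w. poly q w \<noteq> 0}" by (auto intro!: open_Collect_neq continuous_intros)
  then have "\<forall>\<^sub>F w in nhds z. poly q w \<noteq> 0" using z eventually_nhds_in_open[of "{w. poly q w \<noteq> 0}" z] by simp
  then have "\<forall>\<^sub>F w in nhds z. deriv R w = poly (wronskian p q) w / (poly q w)\<^sup>2" by eventually_elim (rule d)
  then have "deriv (deriv R) z = deriv (\<lambda>w. poly (wronskian p q) w / (poly q w)\<^sup>2) z" by (rule deriv_cong_ev) simp
  also have "\<dots> = poly (pderiv (wronskian p q)) z / (poly q z)\<^sup>2"
    by (rule DERIV_imp_deriv) (use z N0 in \<open>auto intro!: derivative_eq_intros simp: power2_eq_square field_simps\<close>)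
  finally show "deriv (deriv R) z = poly (pderiv (wronskian p q)) z / (poly q z)\<^sup>2" .
qed

subsection \<open>The master function\<close>

text \<open>The logarithmic derivative of the master function in \<open>\<xi> k\<close> is \<open>4\<close> times the left-hand side of the
  \<open>k\<close>-th stationary relation.\<close>
lemma master_critical_point_iff:
  fixes x :: "nat \<Rightarrow> real" and \<xi> :: "nat \<Rightarrow> complex"
  assumes injx: "inj_on x {1..n}" and inj: "inj_on \<xi> {1..m}"
    and ne: "\<forall>k\<in>{1..m}. \<forall>j\<in>{1..n}. \<xi> k \<noteq> of_real (x j)"
  shows "master_critical_point n m x \<xi> \<longleftrightarrow> stationary_relations n m x \<xi>"
  unfolding master_critical_point_def stationary_relations_def
proof (intro ball_cong refl)
  fix k assume k: "k \<in> {1..m}"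
  define X where "X = (\<Prod>i\<in>{1..n}. \<Prod>j\<in>{i<..n}. (complex_of_real (x i) - of_real (x j)) ^ 2)"
  define f where "f w i j = ((\<xi>(k := w)) i - (\<xi>(k := w)) j) ^ 8" for w i j
  define h where "h w i j = (of_real (x i) - (\<xi>(k := w)) j) powi (-4)" for w i and j :: nat
  \<comment> \<open>\<open>d\<close> and \<open>e\<close> are the logarithmic derivatives of the
    factors \<open>f\<close> and \<open>h\<close> at \<open>\<xi> k\<close>. Factors without the
    index \<open>k\<close> contribute \<open>0\<close>; for \<open>f\<close> the sign depends on
    whether \<open>k\<close> is the first or the second index.\<close>
  define d where "d i j = (if i = k then 8 / (\<xi> k - \<xi> j) else 0) - (if j = k then 8 / (\<xi> i - \<xi> k) else 0)" for i j
  define e where "e i j = (if j = k then - 4 / (\<xi> k - of_real (x i)) else 0)" for i j :: nat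
  have diff: "\<xi> i \<noteq> \<xi> j" if "i \<in> {1..m}" "j \<in> {i<..m}" for i j
    using inj that by (auto dest: inj_onD)
  have df: "((\<lambda>w. f w i j) has_field_derivative f (\<xi> k) i j * d i j) (at (\<xi> k))"
    if ij: "i \<in> {1..m}" "j \<in> {i<..m}" for i j
  proof -
    have "\<xi> i - \<xi> j \<noteq> 0" using diff[OF ij] by simp
    moreover have "i \<noteq> j" using ij by auto
    ultimately show ?thesis
      unfolding f_def d_def
      by (cases "i = k"; cases "j = k")
         (auto intro!: derivative_eq_intros simp: field_simps power_numeral_reduce)
  qed
  have dh: "((\<lambda>w. h w i j) has_field_derivative h (\<xi> k) i j * e i j) (at (\<xi> k))"
    if ij: "i \<in> {1..n}" "j \<in> {1..m}" for i j
  proof -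
    have z: "of_real (x i) - \<xi> k \<noteq> 0" "\<xi> k - of_real (x i) \<noteq> 0" using bspec[OF bspec[OF ne k] ij(1)] by auto
    have "((\<lambda>w. (of_real (x i) - w) powi (-4)) has_field_derivative
       (of_real (x i) - \<xi> k) powi (-4) * (- 4 / (\<xi> k - of_real (x i)))) (at (\<xi> k))"
    proof (rule derivative_eq_intros refl | (use z in simp; fail))+
      define y where "y = complex_of_real (x i) - \<xi> k"
      have y: "y \<noteq> 0" "\<xi> k - of_real (x i) = - y" using z by (auto simp: y_def)
      have "y powi (-4) = y powi (-5) * y" using power_int_add_1[of y "-5"] y by simp
      then show "of_int (- 4) * (of_real (x i) - \<xi> k) powi (- 4 - 1) * (0 - 1) =
        (of_real (x i) - \<xi> k) powi - 4 * (- 4 / (\<xi> k - of_real (x i)))"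
        using y(1) unfolding y(2) y_def[symmetric] by simp
    qed
    then show ?thesis unfolding h_def e_def by (cases "j = k") auto
  qed
  have dF: "((\<lambda>w. \<Prod>i\<in>{1..m}. \<Prod>j\<in>{i<..m}. f w i j) has_field_derivative
     (\<Prod>i\<in>{1..m}. \<Prod>j\<in>{i<..m}. f (\<xi> k) i j) * (\<Sum>i\<in>{1..m}. \<Sum>j\<in>{i<..m}. d i j)) (at (\<xi> k))"
    by (intro has_field_derivative_prod_log df)
  have dH: "((\<lambda>w. \<Prod>i\<in>{1..n}. \<Prod>j\<in>{1..m}. h w i j) has_field_derivative
     (\<Prod>i\<in>{1..n}. \<Prod>j\<in>{1..m}. h (\<xi> k) i j) * (\<Sum>i\<in>{1..n}. \<Sum>j\<in>{1..m}. e i j)) (at (\<xi> k))"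
    by (intro has_field_derivative_prod_log dh)
  define Sx where "Sx = (\<Sum>j\<in>{1..n}. 1 / (\<xi> k - of_real (x j)))"
  define Sxi where "Sxi = (\<Sum>l\<in>{1..m} - {k}. 2 / (\<xi> k - \<xi> l))"
  \<comment> \<open>The ordered pairs containing \<open>k\<close> are those with \<open>k\<close>
    first and those with \<open>k\<close> second. Flipping signs in the second group merges both
    into one sum over all indices other than \<open>k\<close>.\<close>
  have "(\<Sum>i\<in>{1..m}. \<Sum>j\<in>{i<..m}. d i j) = (\<Sum>i\<in>{1..m}. \<Sum>j\<in>{i<..m}. if i = k then 8 / (\<xi> k - \<xi> j) else 0)
     - (\<Sum>i\<in>{1..m}. \<Sum>j\<in>{i<..m}. if j = k then 8 / (\<xi> i - \<xi> k) else 0)"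
    by (simp add: d_def sum_subtractf)
  also have "(\<Sum>i\<in>{1..m}. \<Sum>j\<in>{i<..m}. if i = k then 8 / (\<xi> k - \<xi> j) else 0) =
     (\<Sum>i\<in>{1..m}. if i = k then \<Sum>j\<in>{k<..m}. 8 / (\<xi> k - \<xi> j) else 0)"
    by (intro sum.cong) auto
  also have "\<dots> = (\<Sum>j\<in>{k<..m}. 8 / (\<xi> k - \<xi> j))" using k by (subst sum.delta) auto
  also have "(\<Sum>i\<in>{1..m}. \<Sum>j\<in>{i<..m}. if j = k then 8 / (\<xi> i - \<xi> k) else 0) =
     (\<Sum>i\<in>{1..m}. if i < k then 8 / (\<xi> i - \<xi> k) else 0)"
    using k by (intro sum.cong) (auto simp: sum.delta)
  also have "\<dots> = (\<Sum>i\<in>{1..<k}. 8 / (\<xi> i - \<xi> k))"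
    using k by (intro sum.mono_neutral_cong_right) auto
  also have "(\<Sum>j\<in>{k<..m}. 8 / (\<xi> k - \<xi> j)) - (\<Sum>i\<in>{1..<k}. 8 / (\<xi> i - \<xi> k)) =
     (\<Sum>j\<in>{k<..m}. 8 / (\<xi> k - \<xi> j)) + (\<Sum>i\<in>{1..<k}. 8 / (\<xi> k - \<xi> i))"
    by (simp add: sum_negf[symmetric] minus_divide_right del: sum_negf)
  also have "\<dots> = (\<Sum>l\<in>{k<..m} \<union> {1..<k}. 8 / (\<xi> k - \<xi> l))" by (rule sum.union_disjoint[symmetric]) auto
  also have "{k<..m} \<union> {1..<k} = {1..m} - {k}" using k by auto
  also have "(\<Sum>l\<in>{1..m} - {k}. 8 / (\<xi> k - \<xi> l)) = 4 * Sxi" by (simp add: Sxi_def sum_distrib_left)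
  finally have sd: "(\<Sum>i\<in>{1..m}. \<Sum>j\<in>{i<..m}. d i j) = 4 * Sxi" .
  have "(\<Sum>i\<in>{1..n}. \<Sum>j\<in>{1..m}. e i j) = (\<Sum>i\<in>{1..n}. - 4 / (\<xi> k - of_real (x i)))"
    unfolding e_def using k by (intro sum.cong) (auto simp: sum.delta)
  also have "\<dots> = - 4 * Sx" by (simp add: Sx_def sum_distrib_left)
  finally have se: "(\<Sum>i\<in>{1..n}. \<Sum>j\<in>{1..m}. e i j) = - 4 * Sx" .
  define c where "c = X * (\<Prod>i\<in>{1..m}. \<Prod>j\<in>{i<..m}. f (\<xi> k) i j) * (\<Prod>i\<in>{1..n}. \<Prod>j\<in>{1..m}. h (\<xi> k) i j)"
  have mf: "master_function n m x (\<xi>(k := w)) =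
     X * (\<Prod>i\<in>{1..m}. \<Prod>j\<in>{i<..m}. f w i j) * (\<Prod>i\<in>{1..n}. \<Prod>j\<in>{1..m}. h w i j)" for w
    by (simp only: master_function_def X_def f_def h_def)
  have deriv: "((\<lambda>w. master_function n m x (\<xi>(k := w))) has_field_derivative c * (4 * (- Sx + Sxi))) (at (\<xi> k))"
    unfolding mf by (rule derivative_eq_intros dF[unfolded sd] dH[unfolded se] refl)+ (simp add: c_def algebra_simps)
  have "c \<noteq> 0"
  proof -
    have "X \<noteq> 0" unfolding X_def using injx by (auto dest: inj_onD)
    moreover have "(\<Prod>i\<in>{1..m}. \<Prod>j\<in>{i<..m}. f (\<xi> k) i j) \<noteq> 0" unfolding f_def using diff by auto
    moreover have "(\<Prod>i\<in>{1..n}. \<Prod>j\<in>{1..m}. h (\<xi> k) i j) \<noteq> 0" unfolding h_def using ne by force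
    ultimately show ?thesis by (simp add: c_def)
  qed
  have "((\<lambda>w. master_function n m x (\<xi>(k := w))) has_field_derivative 0) (at (\<xi> k)) \<longleftrightarrow> c * (4 * (- Sx + Sxi)) = 0"
    using deriv DERIV_unique by metis
  also have "\<dots> \<longleftrightarrow> - Sx + Sxi = 0" using \<open>c \<noteq> 0\<close> by simp
  finally show "((\<lambda>w. master_function n m x (\<xi>(k := w))) has_field_derivative 0) (at (\<xi> k)) \<longleftrightarrow>
     - (\<Sum>j\<in>{1..n}. 1 / (\<xi> k - of_real (x j))) + (\<Sum>l\<in>{1..m} - {k}. 2 / (\<xi> k - \<xi> l)) = 0"
    unfolding Sx_def Sxi_def .
qed

subsection \<open>The equivalence\<close>

lemma poly_eq_linear_prod:
  fixes P :: "complex poly"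
  assumes "P \<noteq> 0" "\<And>z. poly P z = 0 \<Longrightarrow> poly (pderiv P) z \<noteq> 0" "{z. poly P z = 0} = a ` I" "inj_on a I"
  shows "P = smult (lead_coeff P) (\<Prod>i\<in>I. [:- a i, 1:])"
proof -
  have "rsquarefree P" using assms(2) by (auto simp: rsquarefree_roots)
  then have "smult (lead_coeff P) (\<Prod>z|poly P z = 0. [:-z, 1:]) = P"
    by (rule complex_poly_decompose_rsquarefree)
  moreover have "(\<Prod>z|poly P z = 0. [:-z, 1:]) = (\<Prod>i\<in>I. [:- a i, 1:])"
    unfolding assms(3) by (subst prod.reindex[OF assms(4)]) (simp add: o_def)
  ultimately show ?thesis by simp
qed

lemma wronskian_jet:
  assumes "poly q z = 0"
  shows "poly (pderiv (wronskian p q)) z * poly (pderiv q) z = poly (wronskian p q) z * poly (pderiv (pderiv q)) z"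
  using assms by (simp add: wronskian_def pderiv_diff pderiv_mult algebra_simps)

lemma inj_on_of_real: "inj_on f I \<Longrightarrow> inj_on (\<lambda>i. complex_of_real (f i)) I"
  by (rule inj_onI) (simp add: inj_on_eq_iff)

text \<open>Simple poles make the roots of \<open>q\<close> simple and hence non-critical; simple
  critical points make the Wronskian a constant multiple of the product over the \<open>x j\<close>.
  The jet identity at the roots of \<open>q\<close> is then automatic.\<close>

lemma stationary_if_CR:
  fixes x :: "nat \<Rightarrow> real" and \<xi> :: "nat \<Rightarrow> complex"
  assumes injx: "inj_on x {1..n}" and inj: "inj_on \<xi> {1..m}"
    and ne: "\<forall>k\<in>{1..m}. \<forall>j\<in>{1..n}. \<xi> k \<noteq> of_real (x j)"
    and R: "R \<in> CR m n x" and poles: "{z. is_pole R z} = \<xi> ` {1..m}"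
  shows "stationary_relations n m x \<xi>"
proof -
  obtain p q where quot: "quotient_of p q R" using R by (auto simp: CR_def rational_function_def quotient_of_def)
  have q0: "q \<noteq> 0" using quot by (simp add: quotient_of_def)
  have crit: "{z. finite_critical_point R z} = (\<lambda>j. of_real (x j)) ` {1..n}"
    and simple: "\<And>j. j \<in> {1..n} \<Longrightarrow> simple_critical_point R (of_real (x j))"
    and zo: "\<And>z. is_pole R z \<Longrightarrow> zorder R z = -1" using R by (auto simp: CR_def)
  note pole_iff = is_pole_quotient_iff[OF quot]
  have ord1: "order z q = 1" if "poly q z = 0" for z
    using zo pole_iff that pole_order_quotient(2)[OF quot that] by simp
  have q': "poly (pderiv q) z \<noteq> 0" if "poly q z = 0" for z
  proof -
    have "degree q \<noteq> 0"
    proof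
      assume "degree q = 0"
      then obtain c where "q = [:c:]" by (rule degree_eq_zeroE)
      then show False using that q0 by simp
    qed
    then have "pderiv q \<noteq> 0" by (simp add: pderiv_eq_0_iff)
    then show ?thesis using ord1[OF that] order_pderiv[OF q0 that] order_root[of "pderiv q" z] by simp
  qed
  define N where "N = wronskian p q"
  have Npole: "poly N z \<noteq> 0" if "poly q z = 0" for z
    using q'[OF that] coprime_poly_complexD[of p q z] that quot by (simp add: N_def wronskian_def quotient_of_def)
  have Nroot: "poly N z = 0 \<longleftrightarrow> finite_critical_point R z" for z
  proof (cases "poly q z = 0")
    case True
    then show ?thesis using Npole[OF True] zo[of z] pole_iff[of z] by (simp add: finite_critical_point_def)
  next
    case False
    then show ?thesis using deriv_quotient(1)[OF quot False] pole_iff[of z] by (simp add: finite_critical_point_def N_def)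
  qed
  have N': "poly (pderiv N) z \<noteq> 0" if root: "poly N z = 0" for z
  proof -
    have "finite_critical_point R z" "\<not> is_pole R z" using root Nroot Npole pole_iff by auto
    then have "z \<in> (\<lambda>j. of_real (x j)) ` {1..n}" unfolding crit[symmetric] by simp
    then obtain j where "j \<in> {1..n}" "z = of_real (x j)" by blast
    then have s: "deriv R z = 0" "deriv (deriv R) z \<noteq> 0" using simple \<open>\<not> is_pole R z\<close> by (auto simp: simple_critical_point_def)
    have "poly q z \<noteq> 0" using \<open>\<not> is_pole R z\<close> pole_iff by simp
    then show ?thesis using deriv_quotient(2)[OF quot _ s(1)] s(2) by (auto simp: N_def)
  qed
  have Nset: "{z. poly N z = 0} = (\<lambda>j. complex_of_real (x j)) ` {1..n}" unfolding Nroot crit ..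
  have "N \<noteq> 0"
  proof
    assume "N = 0"
    then have "finite (UNIV :: complex set)" using Nset by (metis (mono_tags, lifting) Collect_cong UNIV_def finite_atLeastAtMost finite_imageI poly_0)
    then show False using infinite_UNIV_char_0 by blast
  qed
  have injx': "inj_on (\<lambda>j. complex_of_real (x j)) {1..n}" by (rule inj_on_of_real[OF injx])
  define N1 where "N1 = (\<Prod>j\<in>{1..n}. [:- complex_of_real (x j), 1:])"
  define q1 where "q1 = (\<Prod>k\<in>{1..m}. [:- \<xi> k, 1:])"
  have N1: "N = smult (lead_coeff N) N1" unfolding N1_def
    by (rule poly_eq_linear_prod[OF \<open>N \<noteq> 0\<close> N' Nset injx'])
  have qset: "{z. poly q z = 0} = \<xi> ` {1..m}" using poles pole_iff by simp
  have q1: "q = smult (lead_coeff q) q1" unfolding q1_def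
    by (rule poly_eq_linear_prod[OF q0 q' qset inj])
  have "poly (pderiv N1) (\<xi> k) * poly (pderiv q1) (\<xi> k) = poly N1 (\<xi> k) * poly (pderiv (pderiv q1)) (\<xi> k)"
    if "k \<in> {1..m}" for k
  proof -
    have "poly q (\<xi> k) = 0" using qset that by blast
    then have "poly (pderiv N) (\<xi> k) * poly (pderiv q) (\<xi> k) = poly N (\<xi> k) * poly (pderiv (pderiv q)) (\<xi> k)"
      unfolding N_def by (rule wronskian_jet)
    then have "lead_coeff N * lead_coeff q * (poly (pderiv N1) (\<xi> k) * poly (pderiv q1) (\<xi> k)) =
      lead_coeff N * lead_coeff q * (poly N1 (\<xi> k) * poly (pderiv (pderiv q1)) (\<xi> k))"
      by (subst (asm) (1) N1, subst (asm) (1) q1, subst (asm) (2) N1, subst (asm) (2) q1) (simp add: pderiv_smult mult_ac)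
    then show ?thesis using \<open>N \<noteq> 0\<close> q0 by simp
  qed
  then show ?thesis using stationary_iff_wronskian_jets[OF inj ne] by (simp add: N1_def q1_def)
qed

section \<open>The number of rays of the locus at real points and at infinity\<close>

context real_pair
begin

text \<open>\<open>P / Q\<close> is \<open>R\<close> followed by a real Moebius map of determinant
  \<open>\<alpha>\<^sup>2 + \<beta>\<^sup>2\<close> that sends the value at \<open>c\<close> to
  \<open>0\<close>. The real locus is unchanged, and poles need no separate treatment. The first two
  derivatives of \<open>P\<close> at \<open>c\<close> are the Wronskian and its derivative, so the
  order of \<open>P\<close> at \<open>c\<close> is \<open>2\<close> at a critical point and
  \<open>1\<close> elsewhere.\<close>

lemma end_star_real_point:
  fixes a :: real
  assumes simple: "poly (wronskian p q) (of_real a) = 0 \<Longrightarrow> poly (pderiv (wronskian p q)) (of_real a) \<noteq> 0"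
  shows "end_star L (nhds (of_real a)) (if poly (wronskian p q) (of_real a) = 0 then 1 else 0)"
proof -
  define c :: complex where "c = of_real a"
  define \<alpha> where "\<alpha> = poly q c"
  define \<beta> where "\<beta> = poly p c"
  have cnj_c: "cnj c = c" by (simp add: c_def)
  have cnj_ab: "cnj \<alpha> = \<alpha>" "cnj \<beta> = \<beta>" using real_p[of c] real_q[of c] by (simp_all add: \<alpha>_def \<beta>_def cnj_c)
  then have re: "\<alpha> = of_real (Re \<alpha>)" "\<beta> = of_real (Re \<beta>)" by (simp_all add: complex_eq_iff)
  have ab: "\<alpha> \<noteq> 0 \<or> \<beta> \<noteq> 0" using no_common_root[of c] by (auto simp: \<alpha>_def \<beta>_def)
  then have sq: "(Re \<alpha>)\<^sup>2 + (Re \<beta>)\<^sup>2 \<noteq> 0" using re by (metis of_real_0 sum_power2_eq_zero_iff)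
  define P where "P = smult \<alpha> p - smult \<beta> q"
  define Q where "Q = smult \<beta> p + smult \<alpha> q"
  define W where "W = wronskian p q"
  have Pc: "poly P c = 0" by (simp add: P_def \<alpha>_def \<beta>_def)
  have "poly Q c = of_real ((Re \<alpha>)\<^sup>2 + (Re \<beta>)\<^sup>2)"
    using re by (simp add: Q_def \<alpha>_def[symmetric] \<beta>_def[symmetric] power2_eq_square)
  then have Qc: "poly Q c \<noteq> 0" using sq by (metis of_real_eq_0_iff)
  have P0: "P \<noteq> 0"
  proof
    assume "P = 0"
    then have eq: "smult \<alpha> p = smult \<beta> q" by (simp add: P_def)
    show False
    proof (cases "\<alpha> = 0")
      case True then show False using eq ab q_nz by simp
    next
      case False
      then have "degree p = degree (smult \<beta> q)" using eq by (metis degree_smult_eq)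
      then show False using degree_less degree_smult_le[of \<beta> q] by simp
    qed
  qed
  have P1: "poly (pderiv P) c = poly W c"
    by (simp add: P_def W_def wronskian_def pderiv_diff pderiv_smult \<alpha>_def \<beta>_def algebra_simps)
  have P2: "poly (pderiv (pderiv P)) c = poly (pderiv W) c"
    by (simp add: P_def W_def wronskian_def pderiv_diff pderiv_smult pderiv_mult \<alpha>_def \<beta>_def algebra_simps)
  define k where "k = order c P"
  have k: "k = Suc (if poly W c = 0 then 1 else 0)"
  proof (cases "poly W c = 0")
    case False
    then have "order c (pderiv P) = 0" using P1 by (intro order_0I) simp
    then show ?thesis using order_pderiv[OF P0 Pc] False by (simp add: k_def)
  next
    case True
    then have nz: "poly (pderiv (pderiv P)) c \<noteq> 0" using P2 simple by (simp add: W_def c_def)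
    then have "pderiv P \<noteq> 0" by auto
    then have "order c (pderiv P) = Suc (order c (pderiv (pderiv P)))" using P1 True by (intro order_pderiv) auto
    also have "order c (pderiv (pderiv P)) = 0" using nz by (rule order_0I)
    finally show ?thesis using order_pderiv[OF P0 Pc] True by (simp add: k_def)
  qed
  obtain E where E: "P = [:- c, 1:] ^ k * E" "\<not> [:- c, 1:] dvd E" unfolding k_def using order_decomp[OF P0] by blast
  have Ec: "poly E c \<noteq> 0" using E(2) by (simp add: poly_eq_0_iff_dvd)
  have realp: "map_poly cnj p = p" "map_poly cnj q = q" using real_p real_q by (auto intro: map_poly_cnj_eqI)
  have realP: "poly P (cnj z) = cnj (poly P z)" "poly Q (cnj z) = cnj (poly Q z)" for z
    using real_p[of z] real_q[of z] cnj_ab by (simp_all add: P_def Q_def)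
  have "map_poly cnj E = E"
  proof -
    have "map_poly cnj P = map_poly cnj ([:- c, 1:] ^ k) * map_poly cnj E" by (subst E(1)) (rule map_poly_cnj_hom(2))
    also have "map_poly cnj ([:- c, 1:] ^ k) = [:- c, 1:] ^ k"
      by (rule map_poly_cnj_eqI) (simp add: cnj_c)
    finally have "[:- c, 1:] ^ k * map_poly cnj E = [:- c, 1:] ^ k * E"
      using map_poly_cnj_eqI[OF realP(1)] E(1) by simp
    then show ?thesis by simp
  qed
  then have realE: "poly E (cnj z) = cnj (poly E z)" for z using poly_cnj[of E z] by simp
  have "open {z. poly Q z \<noteq> 0}" by (auto intro!: open_Collect_neq continuous_intros)
  moreover have "c \<in> {z. poly Q z \<noteq> 0}" using Qc by simp
  ultimately obtain r where r: "r > 0" "ball c r \<subseteq> {z. poly Q z \<noteq> 0}" by (rule openE)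
  define g where "g z = poly E z / poly Q z" for z
  have "end_star L (nhds (of_real a)) (k - 1)"
  proof (rule end_star_local[where g = g, OF r(1)[unfolded c_def]])
    show "g holomorphic_on ball (of_real a) r" unfolding g_def[abs_def]
      using r(2) by (auto simp: c_def intro!: holomorphic_intros)
    show "g (of_real a) \<noteq> 0" using Ec Qc by (simp add: g_def c_def)
    show "g (cnj z) = cnj (g z)" for z by (simp add: g_def realE realP)
    show "k > 0" using k by simp
    show "L \<subseteq> {z. Im z > 0}" by (auto simp: L_def)
    fix z assume z: "z \<in> ball (of_real a) r" "Im z > 0"
    have "(z - of_real a) ^ k * g z = poly P z / poly Q z"
      by (subst E(1)) (simp add: g_def c_def)
    then have "Im ((z - of_real a) ^ k * g z) = 0 \<longleftrightarrow> Im (poly P z * cnj (poly Q z)) = 0"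
      by (simp only: Im_complex_div_eq_0)
    also have "Im (poly P z * cnj (poly Q z)) = ((Re \<alpha>)\<^sup>2 + (Re \<beta>)\<^sup>2) * F z"
      unfolding P_def Q_def F_def
      by (subst (1 2) re(1), subst (1 2) re(2)) (simp add: power2_eq_square algebra_simps)
    also have "\<dots> = 0 \<longleftrightarrow> F z = 0" using sq by (simp only: mult_eq_0_iff) blast
    finally show "z \<in> L \<longleftrightarrow> Im ((z - of_real a) ^ k * g z) = 0" using z(2) by (simp add: L_def)
  qed
  then show ?thesis using k by (simp add: W_def c_def)
qed

lemma quotient_at_infinity:
  "w \<noteq> 0 \<Longrightarrow> poly q (1 / w) / poly p (1 / w) = w ^ (degree p - degree q) * (poly (reflect_poly q) w / poly (reflect_poly p) w)"
proof -
  assume w: "w \<noteq> 0"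
  have "w ^ degree p = w ^ (degree p - degree q) * w ^ degree q"
    using degree_less by (simp add: power_add[symmetric])
  then show ?thesis using w by (simp add: poly_reflect_poly_nz inverse_eq_divide)
qed

text \<open>The reciprocal of \<open>R\<close> is real where \<open>R\<close> is and has a zero of
  order \<open>degree p - degree q\<close> at \<open>\<infinity>\<close>, which inversion moves to
  \<open>0\<close>. The reversed polynomials express the nonvanishing factor there.\<close>

lemma end_star_at_infinity: "end_star L at_infinity (degree p - degree q - 1)"
proof -
  define k where "k = degree p - degree q"
  define g where "g w = poly (reflect_poly q) w / poly (reflect_poly p) w" for w
  define L' where "L' = {w. Im w > 0 \<and> Im (w ^ k * g w) = 0}"
  have p0: "p \<noteq> 0" using degree_less by auto
  have "open {z. poly (reflect_poly p) z \<noteq> 0}" by (auto intro!: open_Collect_neq continuous_intros)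
  moreover have "0 \<in> {z. poly (reflect_poly p) z \<noteq> 0}" using p0 by simp
  ultimately obtain r where r: "r > 0" "ball 0 r \<subseteq> {z. poly (reflect_poly p) z \<noteq> 0}" by (rule openE)
  have cnj_g: "g (cnj w) = cnj (g w)" for w
  proof (cases "w = 0")
    case True
    have "cnj (lead_coeff p) = lead_coeff p" "cnj (lead_coeff q) = lead_coeff q"
      using map_poly_cnj_eqI[of p] map_poly_cnj_eqI[of q] real_p real_q by (metis coeff_map_poly complex_cnj_zero)+
    then show ?thesis using True by (simp add: g_def)
  next
    case False
    then show ?thesis using real_p[of "inverse w"] real_q[of "inverse w"] by (simp add: g_def poly_reflect_poly_nz)
  qed
  have "end_star L' (nhds (of_real 0)) (k - 1)"
  proof (rule end_star_local[where g = g and r = r])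
    show "g holomorphic_on ball (of_real 0) r" unfolding g_def[abs_def]
      using r(2) by (auto intro!: holomorphic_intros)
    show "g (of_real 0) \<noteq> 0" using p0 q_nz by (simp add: g_def)
    show "k > 0" using degree_less by (simp add: k_def)
  qed (use r cnj_g in \<open>auto simp: L'_def\<close>)
  then have "end_star L' (nhds 0) (k - 1)" by simp
  then show ?thesis
    unfolding k_def[symmetric]
  proof (rule end_star_infinity)
    fix z assume z: "Im z > 0"
    define w where "w = 1 / cnj z"
    have w: "w \<noteq> 0" "1 / w = cnj z" using z by (auto simp: w_def)
    have "Im w > 0"
    proof -
      have "Im w = Im z / (norm z)\<^sup>2" by (simp add: w_def Im_divide cmod_power2)
      moreover have "norm z \<noteq> 0" using z by auto
      ultimately show ?thesis using z by simp
    qed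
    then have "w \<in> L' \<longleftrightarrow> Im (poly q (1 / w) / poly p (1 / w)) = 0"
      unfolding quotient_at_infinity[OF w(1)] by (simp add: L'_def k_def g_def)
    also have "poly q (1 / w) / poly p (1 / w) = cnj (poly q z / poly p z)" by (simp add: w(2) real_p real_q)
    also have "Im (cnj (poly q z / poly p z)) = 0 \<longleftrightarrow> Im (poly q z / poly p z) = 0"
      by (simp only: cnj.sel neg_equal_0_iff_equal)
    also have "\<dots> \<longleftrightarrow> Im (poly q z * cnj (poly p z)) = 0" by (rule Im_complex_div_eq_0)
    also have "\<dots> \<longleftrightarrow> F z = 0" by (auto simp: F_def algebra_simps)
    finally show "z \<in> L \<longleftrightarrow> 1 / cnj z \<in> L'" using z by (simp add: L_def w_def)
  qed (auto simp: L'_def L_def)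
qed

end

text \<open>\<open>R\<close> is a real antiderivative of \<open>N / q\<^sup>2\<close>. Its critical
  points and poles are read off from \<open>N\<close> and \<open>q\<close>, while the order at
  \<open>\<infinity>\<close> follows from \<open>degree p = n + 1 - m\<close>.\<close>

lemma CR_link_pattern_exists:
  fixes x :: "nat \<Rightarrow> real" and \<xi> :: "nat \<Rightarrow> complex"
  assumes m: "0 < m" "m \<le> n div 2" and injx: "inj_on x {1..n}" and inj: "inj_on \<xi> {1..m}"
    and ne: "\<forall>k\<in>{1..m}. \<forall>j\<in>{1..n}. \<xi> k \<noteq> of_real (x j)"
    and cnj_xi: "cnj ` \<xi> ` {1..m} = \<xi> ` {1..m}"
    and stat: "stationary_relations n m x \<xi>"
  shows "\<exists>R\<in>CR m n x. {z. is_pole R z} = \<xi> ` {1..m} \<and> chordal_link_pattern n m x R"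
proof -
  define q where "q = (\<Prod>k\<in>{1..m}. [:- \<xi> k, 1:])"
  define N where "N = (\<Prod>j\<in>{1..n}. [:- complex_of_real (x j), 1:])"
  have mn: "2 * m \<le> n" using m by linarith
  have deg: "degree q = m" "degree N = n"
    unfolding q_def N_def by (subst degree_prod_eq_sum_degree; simp)+
  have lq: "lead_coeff q = 1" unfolding q_def by (simp add: lead_coeff_prod)
  have q0: "q \<noteq> 0" using lq by auto
  have q_roots: "poly q z = 0 \<longleftrightarrow> z \<in> \<xi> ` {1..m}" for z by (auto simp: q_def poly_prod)
  have N_roots: "poly N z = 0 \<longleftrightarrow> z \<in> (\<lambda>j. of_real (x j)) ` {1..n}" for z by (auto simp: N_def poly_prod)
  have real_q: "map_poly cnj q = q"
  proof (rule map_poly_cnj_eqI)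
    fix z
    \<comment> \<open>As a product over the set of values, \<open>q\<close> is visibly invariant
      under any permutation of the \<open>\<xi> k\<close>, in particular under conjugation.\<close>
    have pq: "poly q w = (\<Prod>u\<in>\<xi> ` {1..m}. w - u)" for w
      by (subst prod.reindex[OF inj]) (simp add: q_def poly_prod o_def)
    have "poly q (cnj z) = (\<Prod>u\<in>cnj ` \<xi> ` {1..m}. cnj z - u)" unfolding pq cnj_xi ..
    also have "\<dots> = (\<Prod>u\<in>\<xi> ` {1..m}. cnj z - cnj u)" by (subst prod.reindex) (auto simp: inj_on_def)
    also have "\<dots> = cnj (poly q z)" unfolding pq by simp
    finally show "poly q (cnj z) = cnj (poly q z)" .
  qed
  have real_N: "map_poly cnj N = N" by (rule map_poly_cnj_eqI) (simp add: N_def poly_prod)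
  have jets: "poly (pderiv N) (\<xi> k) * poly (pderiv q) (\<xi> k) = poly N (\<xi> k) * poly (pderiv (pderiv q)) (\<xi> k)"
    if "k \<in> {1..m}" for k
    using stat stationary_iff_wronskian_jets[OF inj ne] that by (simp add: N_def q_def)
  have "\<exists>p. wronskian p q = N"
    unfolding q_def by (rule exists_wronskian_preimage[OF _ inj]) (use jets in \<open>auto simp: q_def\<close>)
  then obtain p where p: "wronskian p q = N" "map_poly cnj p = p"
    using exists_real_wronskian_preimage real_q real_N by blast
  have degp: "degree p + m = Suc n" by (rule degree_of_wronskian_preimage[OF p(1) deg(1) lq m(1) deg(2) mn])
  have sep: "poly N z \<noteq> 0" if "poly q z = 0" for z using that ne unfolding q_roots N_roots by auto
  have pq: "poly p z \<noteq> 0" "poly (pderiv q) z \<noteq> 0" if "poly q z = 0" for z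
    using wronskian_no_common_root[OF p(1) _ that] sep by blast+
  have cop: "coprime p q" using q0 pq(1) by (rule coprime_poly_complexI)
  define R where "R z = poly p z / poly q z" for z
  have quot: "quotient_of p q R" using q0 cop by (simp add: quotient_of_def R_def)
  note pole_iff = is_pole_quotient_iff[OF quot]
  have poles: "{z. is_pole R z} = \<xi> ` {1..m}" using pole_iff q_roots by auto
  have N': "poly (pderiv N) z \<noteq> 0" if root: "poly N z = 0" for z
  proof -
    have injx': "inj_on (\<lambda>j. complex_of_real (x j)) {1..n}" by (rule inj_on_of_real[OF injx])
    obtain j where j: "j \<in> {1..n}" "z = of_real (x j)" using root N_roots by auto
    show ?thesis using linear_prod_derivs(2,3)[OF _ injx' j(1)] by (simp add: N_def j(2))
  qed
  have zo: "zorder R z = -1" if "poly q z = 0" for z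
  proof -
    have "order z (pderiv q) = 0" using pq(2)[OF that] by (rule order_0I)
    then have "order z q = 1" using order_pderiv[OF q0 that] by simp
    then show ?thesis using pole_order_quotient(2)[OF quot that] by simp
  qed
  have crit: "finite_critical_point R z \<longleftrightarrow> poly N z = 0" for z
  proof (cases "poly q z = 0")
    case True
    then show ?thesis using sep[OF True] zo[OF True] pole_iff[of z] by (simp add: finite_critical_point_def)
  next
    case False
    then show ?thesis using deriv_quotient(1)[OF quot False] pole_iff[of z] p(1) by (simp add: finite_critical_point_def)
  qed
  have simple: "simple_critical_point R z" if "poly N z = 0" for z
  proof -
    have qz: "poly q z \<noteq> 0" using that sep by blast
    have d: "deriv R z = 0" using deriv_quotient(1)[OF quot qz] that p(1) by simp
    then show ?thesis using deriv_quotient(2)[OF quot qz d] N'[OF that] p(1) qz pole_iff[of z]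
      by (simp add: simple_critical_point_def)
  qed
  interpret rp: real_pair p q
  proof
    show "poly p (cnj z) = cnj (poly p z)" "poly q (cnj z) = cnj (poly q z)" for z
      using poly_cnj[of p z] poly_cnj[of q z] p(2) real_q by simp_all
    show "poly p z = 0 \<Longrightarrow> poly q z \<noteq> 0" for z using pq(1) by blast
    show "degree q < degree p" using degp deg mn by simp
    fix z assume "Im z \<noteq> 0"
    then have "poly N z \<noteq> 0" unfolding N_roots by auto
    then show "poly (wronskian p q) z \<noteq> 0" using p(1) by simp
  qed
  have k: "degree p - degree q = n - 2 * m + 1" using degp deg mn by simp
  have inf: "is_pole (\<lambda>z. R (1 / z)) 0" "zorder (\<lambda>z. R (1 / z)) 0 = - (int n - 2 * int m + 1)"
  proof -
    define g where "g w = poly (reflect_poly p) w / poly (reflect_poly q) w" for w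
    define S where "S = {w. poly (reflect_poly q) w \<noteq> 0}"
    have S: "open S" "0 \<in> S" unfolding S_def using q0 by (auto intro!: open_Collect_neq continuous_intros)
    have hol: "g holomorphic_on S" unfolding g_def[abs_def] S_def by (auto intro!: holomorphic_intros)
    have g0: "g 0 \<noteq> 0" using q0 rp.degree_less by (auto simp: g_def)
    \<comment> \<open>The case \<open>w = 0\<close> must be left out, because
      \<open>1 / 0 = 0\<close> makes the left side \<open>R 0\<close> there; only a punctured
      neighbourhood of \<open>0\<close> matters for the pole.\<close>
    have eq: "R (1 / w) = g w / w ^ (n - 2 * m + 1)" if "w \<noteq> 0" for w
    proof -
      have "R (1 / w) = inverse (poly q (1 / w) / poly p (1 / w))" by (simp add: R_def)
      then show ?thesis unfolding rp.quotient_at_infinity[OF that] k by (simp add: g_def field_simps)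
    qed
    have pi: "w powi (- (int n - 2 * int m + 1)) = inverse (w ^ (n - 2 * m + 1))" for w :: complex
    proof -
      have "int n - 2 * int m + 1 = int (n - 2 * m + 1)" using mn by simp
      then show ?thesis by (simp only: power_int_minus power_int_of_nat)
    qed
    show "zorder (\<lambda>z. R (1 / z)) 0 = - (int n - 2 * int m + 1)"
      by (rule zorder_eqI[OF S hol g0], unfold diff_zero pi, subst eq) (auto simp: divide_inverse)
    have "is_pole (\<lambda>w. g w / (w - 0) ^ (n - 2 * m + 1)) 0" by (rule is_pole_basic[OF hol S g0]) simp
    moreover have "\<forall>\<^sub>F w in at 0. g w / (w - 0) ^ (n - 2 * m + 1) = R (1 / w)"
      unfolding eventually_at_filter by (intro always_eventually allI impI, unfold diff_zero) (rule eq[symmetric])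
    then have "is_pole (\<lambda>w. g w / (w - 0) ^ (n - 2 * m + 1)) 0 \<longleftrightarrow> is_pole (\<lambda>z. R (1 / z)) 0"
      by (rule is_pole_cong) (rule refl)
    ultimately show "is_pole (\<lambda>z. R (1 / z)) 0" by (rule iffD1[rotated])
  qed
  have "R \<in> CR m n x"
    unfolding CR_def mem_Collect_eq
  proof (intro conjI allI ballI impI)
    show "rational_function R" using quot by (auto simp: rational_function_def quotient_of_def)
    show "cnj (R (cnj z)) = R z" for z by (simp add: R_def rp.real_p rp.real_q)
    show "{z. finite_critical_point R z} = (\<lambda>j. of_real (x j)) ` {1..n}" using crit N_roots by auto
    show "simple_critical_point R (of_real (x j))" if "j \<in> {1..n}" for j
      using that by (intro simple) (auto simp: N_roots)
    show "finite {z. is_pole R z}" "card {z. is_pole R z} = m"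
      unfolding poles using inj by (auto simp: card_image)
    show "is_pole R z \<Longrightarrow> zorder R z = - 1" for z using zo pole_iff by blast
  qed (use inf in auto)
  moreover have "chordal_link_pattern n m x R"
  proof -
    interpret curve_family rp.L
    proof
      show "rp.L \<subseteq> {z. Im z > 0}" by (auto simp: rp.L_def)
      show "\<exists>E E'. end_filter E \<and> end_filter E' \<and> E \<noteq> E' \<and> simple_curve_in_H E E' C" if "C \<in> components rp.L" for C
        using rp.component_is_curve[OF that] by metis
    qed
    \<comment> \<open>The local degree of \<open>R\<close> is \<open>2\<close> at the points
      \<open>x j\<close> and \<open>1\<close> at every other real point, including real
      poles.\<close>
    have star: "end_star rp.L (nhds (of_real a)) (if poly N (of_real a) = 0 then 1 else 0)" for a
      using rp.end_star_real_point[of a] N' p(1) by simp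
    show ?thesis
    proof (rule chordal_link_pattern[OF injx mn])
      show "end_star rp.L (nhds (of_real (x j))) 1" if "j \<in> {1..n}" for j
      proof -
        have "poly N (of_real (x j)) = 0" using that N_roots by auto
        then show ?thesis using star[of "x j"] by simp
      qed
      show "end_star rp.L at_infinity (n - 2 * m)" using rp.end_star_at_infinity k by simp
      show "end_star rp.L (nhds (of_real a)) 0" if "a \<notin> x ` {1..n}" for a
      proof -
        have "poly N (of_real a) \<noteq> 0" using that N_roots by auto
        then show ?thesis using star[of a] by simp
      qed
      have "is_pole R z \<or> R z \<in> \<real> \<longleftrightarrow> rp.F z = 0" for z
      proof (cases "poly q z = 0")
        case True then show ?thesis using pole_iff by (simp add: rp.F_def)
      next
        case False
        then show ?thesis using pole_iff[of z] by (simp add: complex_is_Real_iff R_def Im_complex_div_eq_0 rp.F_def)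
      qed
      then show "real_locus R \<inter> {z. Im z > 0} = rp.L" by (auto simp: real_locus_def rp.L_def)
    qed
  qed
  ultimately show ?thesis using poles by blast
qed

theorem theorem1p9:
  fixes n m :: nat and x :: "nat \<Rightarrow> real" and \<xi> :: "nat \<Rightarrow> complex"
  assumes "0 < n" and "0 < m" and "m \<le> n div 2"
    and "inj_on x {1..n}"
    and "inj_on \<xi> {1..m}"
    and "\<forall>k\<in>{1..m}. \<forall>j\<in>{1..n}. \<xi> k \<noteq> of_real (x j)"
    and "cnj ` \<xi> ` {1..m} = \<xi> ` {1..m}"
  shows "(stationary_relations n m x \<xi> \<longleftrightarrow>
            (\<exists>R\<in>CR m n x. {z. is_pole R z} = \<xi> ` {1..m} \<and> chordal_link_pattern n m x R))
       \<and> ((\<exists>R\<in>CR m n x. {z. is_pole R z} = \<xi> ` {1..m} \<and> chordal_link_pattern n m x R) \<longleftrightarrow>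
            master_critical_point n m x \<xi>)"
proof -
  have "stationary_relations n m x \<xi> \<longleftrightarrow>
      (\<exists>R\<in>CR m n x. {z. is_pole R z} = \<xi> ` {1..m} \<and> chordal_link_pattern n m x R)"
    using CR_link_pattern_exists[OF assms(2-7)] stationary_if_CR[OF assms(4-6)] by blast
  then show ?thesis using master_critical_point_iff[OF assms(4-6)] by simp
qed

end
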